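(* Let $X$ be a smooth manifold, let $M\to X$ be the bundle of pseudo-Riemannian metrics of a fixed signature, and let $p\ge1$. Let $g_x$ be a metric (of the fixed signature) at a point $x\in X$, and let $O_{g_x}$ be the orthogonal group of $(T_xX,g_x)$. For any $m\geq 1$ there exists an injective map $$\left\{\begin{array}{c}\text{divergence-free, natural tensors } T\colon J^2M\to\otimes^pTX\\ \text{homogeneous of degree } m \text{ in the second derivatives}\end{array}\right\}\ \hookrightarrow\ \left(\mathrm{Div}_x^m\right)^{O_{g_x}}$$ that sends a tensor $T$ to its $m$-th derivative $T^{m)}$ at the point $x$ (i.e. to the value of $T^{m)}$ at any 2-jet of metric at $x$ with value $g_x$).
   Context: $X$ is a smooth manifold; $M\to X$ is the bundle of pseudo-Riemannian metrics of a fixed signature; $J^kM$ is the bundle of $k$-jets of sections of $M$. A second-order $p$-tensor is a smooth morphism of bundles $T\colon J^2M\to\otimes^pTX$ (over the identity of $X$); for a metric $g$, $T(g)$ is the contravariant tensor field $x\mapsto T(j^2_xg)$. It is natural if $T(\tau\cdot j^2_xg)=\tau_*T(j^2_xg)$ for every diffeomorphism $\tau\colon U\to V$ between open sets of $X$ and every metric $g$ (of the fixed signature) near $x\in U$, where $\tau\cdot j^2_xg:=j^2_{\tau(x)}(\tau_*g)$. Divergence: $(\mathrm{div}\,T)(g)^{j_1\ldots j_{p-1}}=\nabla_kT(g)^{j_1\ldots j_{p-1}k}$, with $\nabla$ the Levi-Civita connection of $g$. $T$ is divergence-free if $(\mathrm{div}\,T)(g)=0$ for every metric $g$ (of the fixed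 signature, on any open set). Normal tensors: $N_2\subset S^2T_x^*X\otimes S^2T_x^*X$ and $N^2\subset S^2T_xX\otimes S^2T_xX$ denote the kernels of the symmetrization in the last $3$ indices. A jet $j^2_xg$ defines $g^2_x\in N_2$ by $(g^2_x)_{ijkl}:=g_{ij,kl}$, the second partial derivatives at $x$ of the components of $g$ in normal coordinates for $g$ at $x$. It is known that, for a fixed $g_x$, each natural tensor $T\colon J^2M\to\otimes^pTX$ corresponds bijectively to an $O_{g_x}$-equivariant smooth map $\mathfrak{t}\colon N_2\to\otimes^pT_xX$, with $T(j^2_x\tilde g)=\mathfrak{t}(\tilde g^2_x)$ for every $j^2_x\tilde g$ with value $g_x$ at $x$. Homogeneity: a natural tensor $T$ is homogeneous of degree $m$ in the second derivatives if $\mathfrak{t}\colon N_2\to\otimes^pT_xX$ is a homogeneous polynomial map of degree $m$ (i.e. $T$, written in normal coordinates, is homogeneous polynomial of degree $m$ in the $g_{ab,cd}$). This does not depend on the choice of $x$ and $g_x$. Derivatives: the fibre $\mathbb{A}_{j^1_xg}$ of $J^2_xM\to J^1_xM$ over $j^1_xg$ is an affine space modelled on $S_{2,2}:=S^2T_x^*X\otimes S^2T_x^*X$. The $m$-th derivative of $T$ at $j^2_xg$ is the $m$-th differential at $j^2_xg$ of $T_|\colon\mathbb{A}_{j^1_xg}\to\otimes^pT_xX$, a linear map $S^m(S_{2,2})\to\otimes^pT_xX$, seen as an element $T^{m)}_{j^2_xg}\in\otimes^pT_xX\otimes S^m(S^2T_xX\otimes S^2T_xX)$. For $T$ natural it lies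 in $\otimes^pT_xX\otimes S^mN^2$, and for $T$ natural and homogeneous of degree $m$ it depends only on the value $g_x$ of the metric at $x$. For $m\ge1$, $\mathrm{Div}_x^m\subset\otimes^pT_xX\otimes S^mN^2$ is the subspace of tensors whose components satisfy $0=\sum_{(j_p\,c_1\,d_1)}T^{j_1\ldots j_p;\,a_1b_1c_1d_1\,\ldots\,a_mb_mc_md_m}$ (sum over the cyclic permutations of $j_p,c_1,d_1$), and $(\mathrm{Div}_x^m)^{O_{g_x}}$ is its subspace of $O_{g_x}$-invariant elements. *)

theory Defs
  imports "HOL-Analysis.Analysis"
begin

section \<open>Smooth maps between normed spaces\<close>

primrec differentiable_upto ::
  "nat \<Rightarrow> 'a::real_normed_vector set \<Rightarrow> ('a \<Rightarrow> 'b::real_normed_vector) \<Rightarrow> bool" where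
  "differentiable_upto 0 S f \<longleftrightarrow> continuous_on S f"
| "differentiable_upto (Suc k) S f \<longleftrightarrow>
     (\<forall>x\<in>S. f differentiable (at x)) \<and>
     (\<forall>v. differentiable_upto k S (\<lambda>x. frechet_derivative f (at x) v))"

text \<open>Meant for open \<open>S\<close> and finite-dimensional domains, where it is the usual notion
  of being of class \<open>C\<close>-infinity.\<close>

definition smooth_on :: "'a::real_normed_vector set \<Rightarrow> ('a \<Rightarrow> 'b::real_normed_vector) \<Rightarrow> bool" where
  "smooth_on S f \<longleftrightarrow> (\<forall>k. differentiable_upto k S f)"

definition pd :: "'n \<Rightarrow> (real^'n \<Rightarrow> 'b::real_normed_vector) \<Rightarrow> real^'n \<Rightarrow> 'b" where
  "pd k f y = frechet_derivative f (at y) (axis k 1)"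


section \<open>Smooth manifolds\<close>

text \<open>The manifold is the whole type \<open>'x\<close>. A chart is a pair of its domain and its coordinate
  map; only the values of the coordinate map on the domain are relevant. A smooth structure is a
  maximal smooth atlas.\<close>

type_synonym ('x, 'n) chart = "'x set \<times> ('x \<Rightarrow> real^'n)"

definition chart_inv :: "('x, 'n::finite) chart \<Rightarrow> real^'n \<Rightarrow> 'x" where
  "chart_inv c = inv_into (fst c) (snd c)"

definition is_chart :: "('x::topological_space, 'n::finite) chart \<Rightarrow> bool" where
  "is_chart c \<longleftrightarrow> open (fst c) \<and> open (snd c ` fst c) \<and>
     homeomorphism (fst c) (snd c ` fst c) (snd c) (chart_inv c)"

definition smooth_transition :: "('x, 'n::finite) chart \<Rightarrow> ('x, 'n) chart \<Rightarrow> bool" where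
  "smooth_transition c d \<longleftrightarrow> smooth_on (snd c ` (fst c \<inter> fst d)) (snd d \<circ> chart_inv c)"

definition smooth_structure ::
  "('x::{t2_space,second_countable_topology}, 'n::finite) chart set \<Rightarrow> bool" where
  "smooth_structure A \<longleftrightarrow>
     (\<forall>c\<in>A. is_chart c) \<and>
     (\<Union>c\<in>A. fst c) = UNIV \<and>
     (\<forall>c\<in>A. \<forall>d\<in>A. smooth_transition c d) \<and>
     (\<forall>c. is_chart c \<and> (\<forall>d\<in>A. smooth_transition c d \<and> smooth_transition d c) \<longrightarrow> c \<in> A)"

definition charts_at :: "('x, 'n::finite) chart set \<Rightarrow> 'x \<Rightarrow> ('x, 'n) chart set" where
  "charts_at A x = {c \<in> A. x \<in> fst c}"

text \<open>The Jacobian matrix at \<open>x\<close> of the coordinates of \<open>d\<close> with respect to those of \<open>c\<close>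
  (row index: coordinate of \<open>d\<close>).\<close>

definition jac :: "('x, 'n::finite) chart \<Rightarrow> ('x, 'n) chart \<Rightarrow> 'x \<Rightarrow> real^'n^'n" where
  "jac c d x = matrix (frechet_derivative (snd d \<circ> chart_inv c) (at (snd c x)))"


section \<open>Tensors at a point\<close>

text \<open>A tensor at \<open>x\<close> is the family of its components in all the charts at \<open>x\<close>, subject to the
  transformation law. Components are indexed by lists of indices; a family is \<open>0\<close> for
  charts that are not charts at \<open>x\<close> and for lists of the wrong length.\<close>

type_synonym ('x, 'n) tensor = "('x, 'n) chart \<Rightarrow> 'n list \<Rightarrow> real"

definition lin_act :: "nat \<Rightarrow> real^'n^'n \<Rightarrow> ('n::finite list \<Rightarrow> real) \<Rightarrow> 'n list \<Rightarrow> real" where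
  "lin_act k Q t J = (\<Sum>I\<in>{I. length I = k}. (\<Prod>r<k. Q $ (J ! r) $ (I ! r)) * t I)"

definition supported_at ::
  "('x, 'n::finite) chart set \<Rightarrow> nat \<Rightarrow> 'x \<Rightarrow> ('x, 'n) tensor \<Rightarrow> bool" where
  "supported_at A k x t \<longleftrightarrow>
     (\<forall>c I. c \<notin> charts_at A x \<or> length I \<noteq> k \<longrightarrow> t c I = 0)"

text \<open>The \<open>k\<close>-th tensor power of the tangent space at \<open>x\<close>.\<close>

definition tensors :: "('x, 'n::finite) chart set \<Rightarrow> nat \<Rightarrow> 'x \<Rightarrow> ('x, 'n) tensor set" where
  "tensors A k x = {t. supported_at A k x t \<and>
     (\<forall>c\<in>charts_at A x. \<forall>d\<in>charts_at A x. \<forall>J. length J = k \<longrightarrow>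
        t d J = lin_act k (jac c d x) (t c) J)}"

text \<open>The \<open>k\<close>-th tensor power of the cotangent space at \<open>x\<close>.\<close>

definition cotensors :: "('x, 'n::finite) chart set \<Rightarrow> nat \<Rightarrow> 'x \<Rightarrow> ('x, 'n) tensor set" where
  "cotensors A k x = {t. supported_at A k x t \<and>
     (\<forall>c\<in>charts_at A x. \<forall>d\<in>charts_at A x. \<forall>J. length J = k \<longrightarrow>
        t c J = lin_act k (transpose (jac c d x)) (t d) J)}"


section \<open>Metrics\<close>

text \<open>The signature is \<open>(r, s)\<close> with \<open>r\<close> plus signs and \<open>s = CARD('n) - r\<close> minus signs: there is a
  basis (the columns of \<open>P\<close>) that is orthonormal, with exactly \<open>r\<close> vectors of square \<open>1\<close>.\<close>

definition has_signature :: "nat \<Rightarrow> real^'n^'n::finite \<Rightarrow> bool" where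
  "has_signature r B \<longleftrightarrow>
     (\<exists>(P :: real^'n^'n) K. invertible P \<and> card K = r \<and>
        transpose P ** B ** P = (\<chi> i j. if i = j then (if i \<in> K then 1 else - 1) else 0))"

text \<open>The fibre at \<open>x\<close> of the bundle of metrics; again by components in the charts at \<open>x\<close>.\<close>

definition metrics_at ::
  "('x, 'n::finite) chart set \<Rightarrow> nat \<Rightarrow> 'x \<Rightarrow> (('x, 'n) chart \<Rightarrow> real^'n^'n) set" where
  "metrics_at A r x = {B.
     (\<forall>c. c \<notin> charts_at A x \<longrightarrow> B c = 0) \<and>
     (\<forall>c\<in>charts_at A x. \<forall>d\<in>charts_at A x.
        B c = transpose (jac c d x) ** B d ** jac c d x) \<and>
     (\<forall>c\<in>charts_at A x. has_signature r (B c))}"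

type_synonym ('x, 'n) metric = "'x \<Rightarrow> ('x, 'n) chart \<Rightarrow> real^'n^'n"

definition metric_coords ::
  "('x, 'n::finite) metric \<Rightarrow> ('x, 'n) chart \<Rightarrow> real^'n \<Rightarrow> real^'n^'n" where
  "metric_coords g c y = g (chart_inv c y) c"

definition metric_on ::
  "('x::topological_space, 'n::finite) chart set \<Rightarrow> nat \<Rightarrow> 'x set \<Rightarrow> ('x, 'n) metric \<Rightarrow> bool" where
  "metric_on A r W g \<longleftrightarrow> open W \<and> (\<forall>x\<in>W. g x \<in> metrics_at A r x) \<and>
     (\<forall>c\<in>A. smooth_on (snd c ` (fst c \<inter> W)) (metric_coords g c))"


section \<open>Christoffel symbols, divergence and geodesics\<close>

text \<open>The Christoffel symbol of the Levi-Civita connection with upper index \<open>k\<close> and lower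
  indices \<open>i\<close>, \<open>j\<close>, for the metric with components \<open>G\<close>.\<close>

definition christoffel ::
  "(real^'n \<Rightarrow> real^'n^'n) \<Rightarrow> real^'n::finite \<Rightarrow> 'n \<Rightarrow> 'n \<Rightarrow> 'n \<Rightarrow> real" where
  "christoffel G y k i j =
     (\<Sum>l\<in>UNIV. matrix_inv (G y) $ k $ l *
        (pd i (\<lambda>z. G z $ j $ l) y + pd j (\<lambda>z. G z $ i $ l) y - pd l (\<lambda>z. G z $ i $ j) y)) / 2"

text \<open>Components at \<open>y\<close> of the covariant derivative, in the direction of the \<open>k\<close>-th coordinate, of
  the contravariant tensor field with components \<open>S\<close>.\<close>

definition cov_deriv ::
  "(real^'n \<Rightarrow> real^'n^'n) \<Rightarrow> (real^'n \<Rightarrow> 'n list \<Rightarrow> real) \<Rightarrow> real^'n::finite \<Rightarrow> 'n \<Rightarrow> 'n list \<Rightarrow> real"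
where
  "cov_deriv G S y k J = pd k (\<lambda>z. S z J) y +
     (\<Sum>r<length J. \<Sum>l\<in>UNIV. christoffel G y (J ! r) k l * S y (J[r := l]))"

definition divergence ::
  "('x, 'n::finite) metric \<Rightarrow> ('x \<Rightarrow> ('x, 'n) tensor) \<Rightarrow> 'x \<Rightarrow> ('x, 'n) tensor" where
  "divergence g S x c J =
     (\<Sum>k\<in>UNIV. cov_deriv (metric_coords g c) (\<lambda>z. S (chart_inv c z) c) (snd c x) k (J @ [k]))"

definition is_geodesic :: "(real^'n \<Rightarrow> real^'n^'n) \<Rightarrow> (real \<Rightarrow> real^'n::finite) \<Rightarrow> bool" where
  "is_geodesic G \<gamma> \<longleftrightarrow>
     (\<exists>\<gamma>' \<gamma>''. \<forall>t\<in>{0..1}.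
        (\<gamma> has_vector_derivative \<gamma>' t) (at t within {0..1}) \<and>
        (\<gamma>' has_vector_derivative \<gamma>'' t) (at t within {0..1}) \<and>
        (\<forall>k. \<gamma>'' t $ k +
           (\<Sum>i\<in>UNIV. \<Sum>j\<in>UNIV. christoffel G (\<gamma> t) k i j * \<gamma>' t $ i * \<gamma>' t $ j) = 0))"

text \<open>Normal coordinates: \<open>x\<close> is the origin, and the segments issuing from it are geodesics; that
  is, the inverse of the coordinate map is the exponential map at \<open>x\<close> precomposed with a linear
  isomorphism onto the tangent space (on a star-shaped neighbourhood of the origin).\<close>

definition normal_chart ::
  "('x, 'n::finite) chart set \<Rightarrow> 'x set \<Rightarrow> ('x, 'n) metric \<Rightarrow> 'x \<Rightarrow> ('x, 'n) chart \<Rightarrow> bool" where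
  "normal_chart A W g x c \<longleftrightarrow> c \<in> charts_at A x \<and> fst c \<subseteq> W \<and> snd c x = 0 \<and>
     (\<forall>v \<in> snd c ` fst c.
        (\<forall>t\<in>{0..1}. t *\<^sub>R v \<in> snd c ` fst c) \<and>
        is_geodesic (metric_coords g c) (\<lambda>t. t *\<^sub>R v))"


section \<open>Two-jets of metrics\<close>

text \<open>A 2-jet is its base point with the values, first and second partial derivatives of the
  components of the metric in all charts at the point (\<open>0\<close> for other charts). Indices of
  derivatives come last.\<close>

type_synonym 'n jet_coords = "(real^'n^'n) \<times> (real^'n^'n^'n) \<times> (real^'n^'n^'n^'n)"
type_synonym ('x, 'n) jet = "'x \<times> (('x, 'n) chart \<Rightarrow> 'n jet_coords)"

definition jet2 ::
  "('x, 'n::finite) chart set \<Rightarrow> ('x, 'n) metric \<Rightarrow> 'x \<Rightarrow> ('x, 'n) jet" where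
  "jet2 A g x = (x, \<lambda>c.
     if c \<in> charts_at A x then
       (metric_coords g c (snd c x),
        \<chi> i j k. pd k (\<lambda>z. metric_coords g c z $ i $ j) (snd c x),
        \<chi> i j k l. pd l (pd k (\<lambda>z. metric_coords g c z $ i $ j)) (snd c x))
     else 0)"

definition J2M ::
  "('x::topological_space, 'n::finite) chart set \<Rightarrow> nat \<Rightarrow> ('x, 'n) jet set" where
  "J2M A r = {jet2 A g x | W g x. metric_on A r W g \<and> x \<in> W}"

definition jet_value :: "('x, 'n::finite) jet \<Rightarrow> ('x, 'n) chart \<Rightarrow> real^'n^'n" where
  "jet_value j c = fst (snd j c)"

text \<open>The tensors with the symmetries of the second tensor power of the symmetric square of
  the cotangent space.\<close>

definition S22 :: "('x, 'n::finite) chart set \<Rightarrow> 'x \<Rightarrow> ('x, 'n) tensor set" where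
  "S22 A x = {H \<in> cotensors A 4 x. \<forall>c a b e f.
     H c [a, b, e, f] = H c [b, a, e, f] \<and> H c [a, b, e, f] = H c [a, b, f, e]}"

text \<open>The affine structure of the fibres of the 2-jets over the 1-jets: translation of the second
  derivatives.\<close>

definition jet_add ::
  "('x, 'n::finite) jet \<Rightarrow> ('x, 'n) tensor \<Rightarrow> ('x, 'n) jet" where
  "jet_add j H = (fst j, \<lambda>c.
     (fst (snd j c), fst (snd (snd j c)), snd (snd (snd j c)) + (\<chi> a b e f. H c [a, b, e, f])))"


section \<open>Natural tensors\<close>

type_synonym ('x, 'n) op2 = "('x, 'n) jet \<Rightarrow> ('x, 'n) tensor"

text \<open>Smooth bundle morphisms over the identity from the 2-jets of metrics to the \<open>p\<close>-th tensor
  power of the tangent bundle. In a chart the 2-jets form an open subset of a linear subspace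
  (given by the symmetries) of the space of all arrays; smoothness there is having a smooth
  extension to an open subset of the ambient space. Being \<open>extensional\<close> makes equality of
  morphisms equality on the 2-jets.\<close>

definition second_order_tensor ::
  "('x::topological_space, 'n::finite) chart set \<Rightarrow> nat \<Rightarrow> nat \<Rightarrow> ('x, 'n) op2 \<Rightarrow> bool" where
  "second_order_tensor A r p T \<longleftrightarrow>
     T \<in> extensional (J2M A r) \<and>
     (\<forall>j\<in>J2M A r. T j \<in> tensors A p (fst j)) \<and>
     (\<forall>c\<in>A. \<forall>J. length J = p \<longrightarrow>
        (\<exists>D (F :: (real^'n) \<times> 'n jet_coords \<Rightarrow> real). open D \<and> smooth_on D F \<and>
           (\<forall>j\<in>J2M A r. fst j \<in> fst c \<longrightarrow>
              (snd c (fst j), snd j c) \<in> D \<and> T j c J = F (snd c (fst j), snd j c))))"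

definition diffeo ::
  "('x::topological_space, 'n::finite) chart set \<Rightarrow> 'x set \<Rightarrow> 'x set \<Rightarrow> ('x \<Rightarrow> 'x) \<Rightarrow> bool" where
  "diffeo A U V \<tau> \<longleftrightarrow> open U \<and> open V \<and>
     homeomorphism U V \<tau> (inv_into U \<tau>) \<and>
     (\<forall>c\<in>A. \<forall>d\<in>A.
        smooth_on (snd c ` {z \<in> fst c \<inter> U. \<tau> z \<in> fst d})
          (snd d \<circ> \<tau> \<circ> chart_inv c) \<and>
        smooth_on (snd d ` {z \<in> fst d \<inter> V. inv_into U \<tau> z \<in> fst c})
          (snd c \<circ> inv_into U \<tau> \<circ> chart_inv d))"

text \<open>The components of the direct image of a tensor in a chart \<open>d\<close> are the components of the tensor
  in the chart obtained by pulling \<open>d\<close> back along the diffeomorphism.\<close>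

definition pull_chart ::
  "'x set \<Rightarrow> ('x \<Rightarrow> 'x) \<Rightarrow> ('x, 'n::finite) chart \<Rightarrow> ('x, 'n) chart" where
  "pull_chart U \<tau> d = ({z \<in> U. \<tau> z \<in> fst d}, snd d \<circ> \<tau>)"

definition push_metric ::
  "('x, 'n::finite) chart set \<Rightarrow> 'x set \<Rightarrow> ('x \<Rightarrow> 'x) \<Rightarrow> ('x, 'n) metric \<Rightarrow> ('x, 'n) metric" where
  "push_metric A U \<tau> g y d = (if d \<in> A then g (inv_into U \<tau> y) (pull_chart U \<tau> d) else 0)"

definition push_tensor ::
  "('x, 'n::finite) chart set \<Rightarrow> 'x set \<Rightarrow> ('x \<Rightarrow> 'x) \<Rightarrow> ('x, 'n) tensor \<Rightarrow> ('x, 'n) tensor" where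
  "push_tensor A U \<tau> t d I = (if d \<in> A then t (pull_chart U \<tau> d) I else 0)"

definition natural_tensor ::
  "('x::topological_space, 'n::finite) chart set \<Rightarrow> nat \<Rightarrow> nat \<Rightarrow> ('x, 'n) op2 \<Rightarrow> bool" where
  "natural_tensor A r p T \<longleftrightarrow> second_order_tensor A r p T \<and>
     (\<forall>U V \<tau> W g x. diffeo A U V \<tau> \<and> metric_on A r W g \<and> x \<in> U \<and> x \<in> W \<longrightarrow>
        T (jet2 A (push_metric A U \<tau> g) (\<tau> x)) = push_tensor A U \<tau> (T (jet2 A g x)))"

definition divergence_free ::
  "('x::topological_space, 'n::finite) chart set \<Rightarrow> nat \<Rightarrow> nat \<Rightarrow> ('x, 'n) op2 \<Rightarrow> bool" where
  "divergence_free A r p T \<longleftrightarrow>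
     (\<forall>W g. metric_on A r W g \<longrightarrow>
        (\<forall>x\<in>W. \<forall>c\<in>charts_at A x. \<forall>J. length J = p - 1 \<longrightarrow>
           divergence g (\<lambda>z. T (jet2 A g z)) x c J = 0))"


section \<open>Homogeneity in the second derivatives\<close>

definition symmetrize3 :: "('n \<Rightarrow> 'n \<Rightarrow> 'n \<Rightarrow> real) \<Rightarrow> 'n \<Rightarrow> 'n \<Rightarrow> 'n \<Rightarrow> real" where
  "symmetrize3 f b c d = f b c d + f b d c + f c b d + f c d b + f d b c + f d c b"

definition normal_tensors :: "('x, 'n::finite) chart set \<Rightarrow> 'x \<Rightarrow> ('x, 'n) tensor set" where
  "normal_tensors A x = {N \<in> S22 A x. \<forall>c a b e f.
     symmetrize3 (\<lambda>b e f. N c [a, b, e, f]) b e f = 0}"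

text \<open>The normal tensor as a relation: its components in any normal chart \<open>d\<close> are the second
  partial derivatives of the metric in \<open>d\<close>; those in other charts follow by the transformation
  law.\<close>

definition is_normal_tensor ::
  "('x, 'n::finite) chart set \<Rightarrow> 'x set \<Rightarrow> ('x, 'n) metric \<Rightarrow> 'x \<Rightarrow> ('x, 'n) tensor \<Rightarrow> bool" where
  "is_normal_tensor A W g x N \<longleftrightarrow> N \<in> cotensors A 4 x \<and>
     (\<exists>d. normal_chart A W g x d \<and>
        (\<forall>i j k l. N d [i, j, k, l] = snd (snd (snd (jet2 A g x) d)) $ i $ j $ k $ l))"

definition blocks :: "nat \<Rightarrow> 'n::finite list list set" where
  "blocks m = {B. length B = m \<and> (\<forall>b\<in>set B. length b = 4)}"

definition homogeneous_polynomial_map ::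
  "('x, 'n::finite) chart set \<Rightarrow> nat \<Rightarrow> nat \<Rightarrow> 'x \<Rightarrow> (('x, 'n) tensor \<Rightarrow> ('x, 'n) tensor) \<Rightarrow> bool" where
  "homogeneous_polynomial_map A p m x \<phi> \<longleftrightarrow>
     \<phi> \<in> normal_tensors A x \<rightarrow> tensors A p x \<and>
     (\<forall>c\<in>charts_at A x. \<exists>a. \<forall>N\<in>normal_tensors A x. \<forall>J. length J = p \<longrightarrow>
        \<phi> N c J = (\<Sum>B\<in>blocks m. a J B * (\<Prod>s<m. N c (B ! s))))"

definition homogeneous_at ::
  "('x::topological_space, 'n::finite) chart set \<Rightarrow> nat \<Rightarrow> nat \<Rightarrow> nat \<Rightarrow> 'x \<Rightarrow>
     (('x, 'n) chart \<Rightarrow> real^'n^'n) \<Rightarrow> ('x, 'n) op2 \<Rightarrow> bool" where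
  "homogeneous_at A r p m x gx T \<longleftrightarrow>
     (\<exists>\<phi>. homogeneous_polynomial_map A p m x \<phi> \<and>
        (\<forall>W g N. metric_on A r W g \<and> x \<in> W \<and> g x = gx \<and> is_normal_tensor A W g x N \<longrightarrow>
           T (jet2 A g x) = \<phi> N))"

text \<open>Homogeneity is a condition on the map corresponding to \<open>T\<close> at \<open>x\<close> and \<open>gx\<close>; for
  natural tensors it does not depend on \<open>x\<close> and \<open>gx\<close>.\<close>

definition div_free_natural_tensors ::
  "('x::topological_space, 'n::finite) chart set \<Rightarrow> nat \<Rightarrow> nat \<Rightarrow> nat \<Rightarrow> 'x \<Rightarrow>
     (('x, 'n) chart \<Rightarrow> real^'n^'n) \<Rightarrow> ('x, 'n) op2 set" where
  "div_free_natural_tensors A r p m x gx =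
     {T. natural_tensor A r p T \<and> divergence_free A r p T \<and> homogeneous_at A r p m x gx T}"


section \<open>The \<open>m\<close>-th derivative\<close>

text \<open>Iterated directional derivatives along the fibre of the 2-jets over the 1-jets, i.e. the
  values of the \<open>m\<close>-th differential on \<open>m\<close> vectors of the model space.\<close>

primrec fibre_deriv ::
  "('x, 'n::finite) tensor list \<Rightarrow> (('x, 'n) jet \<Rightarrow> real) \<Rightarrow> ('x, 'n) jet \<Rightarrow> real" where
  "fibre_deriv [] f j = f j"
| "fibre_deriv (H # Hs) f j = deriv (\<lambda>t. fibre_deriv Hs f (jet_add j (\<lambda>c I. t * H c I))) 0"

text \<open>The components of a tensor of order \<open>p + 4 * m\<close> are indexed by \<open>p\<close> indices followed by \<open>m\<close>
  blocks of four.  The following are the tensors in the tensor product of the \<open>p\<close>-th tensor power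
  of the tangent space with the \<open>m\<close>-th symmetric power of the dual of \<open>S22\<close>.\<close>

definition sym_block_tensors ::
  "('x, 'n::finite) chart set \<Rightarrow> nat \<Rightarrow> nat \<Rightarrow> 'x \<Rightarrow> ('x, 'n) tensor set" where
  "sym_block_tensors A p m x = {K \<in> tensors A (p + 4 * m) x.
     \<forall>c J. length J = p \<longrightarrow> (\<forall>B\<in>blocks m.
       (\<forall>B'. mset B' = mset B \<longrightarrow> K c (J @ concat B') = K c (J @ concat B)) \<and>
       (\<forall>s<m. \<forall>a b e f.
          K c (J @ concat (B[s := [a, b, e, f]])) = K c (J @ concat (B[s := [b, a, e, f]])) \<and>
          K c (J @ concat (B[s := [a, b, e, f]])) = K c (J @ concat (B[s := [a, b, f, e]]))))}"

text \<open>\<open>K\<close> is the \<open>m\<close>-th derivative of \<open>T\<close> at \<open>j\<close>: the (unique) tensor with these symmetries whose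
  contraction with \<open>m\<close> vectors of the model space is the \<open>m\<close>-th differential on them.\<close>

definition is_mth_derivative ::
  "('x, 'n::finite) chart set \<Rightarrow> nat \<Rightarrow> nat \<Rightarrow> ('x, 'n) op2 \<Rightarrow> ('x, 'n) jet \<Rightarrow> ('x, 'n) tensor \<Rightarrow> bool" where
  "is_mth_derivative A p m T j K \<longleftrightarrow> K \<in> sym_block_tensors A p m (fst j) \<and>
     (\<forall>Hs. length Hs = m \<and> set Hs \<subseteq> S22 A (fst j) \<longrightarrow>
        (\<forall>c\<in>charts_at A (fst j). \<forall>J. length J = p \<longrightarrow>
           fibre_deriv Hs (\<lambda>i. T i c J) j =
             (\<Sum>B\<in>blocks m. K c (J @ concat B) * (\<Prod>s<m. (Hs ! s) c (B ! s)))))"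

text \<open>The tensors each of whose \<open>m\<close> blocks lies in the kernel of the symmetrization in its last
  three indices.\<close>

definition sym_normal_tensors ::
  "('x, 'n::finite) chart set \<Rightarrow> nat \<Rightarrow> nat \<Rightarrow> 'x \<Rightarrow> ('x, 'n) tensor set" where
  "sym_normal_tensors A p m x = {K \<in> sym_block_tensors A p m x.
     \<forall>c J. length J = p \<longrightarrow> (\<forall>B\<in>blocks m. \<forall>s<m. \<forall>a b e f.
       symmetrize3 (\<lambda>b e f. K c (J @ concat (B[s := [a, b, e, f]]))) b e f = 0)}"

definition Div :: "('x, 'n::finite) chart set \<Rightarrow> nat \<Rightarrow> nat \<Rightarrow> 'x \<Rightarrow> ('x, 'n) tensor set" where
  "Div A p m x = {K \<in> sym_normal_tensors A p m x.
     \<forall>c J j a b e f. length J = p - 1 \<longrightarrow> (\<forall>B\<in>blocks (m - 1).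
       K c ((J @ [j]) @ concat ([a, b, e, f] # B)) +
       K c ((J @ [e]) @ concat ([a, b, f, j] # B)) +
       K c ((J @ [f]) @ concat ([a, b, j, e] # B)) = 0)}"

text \<open>Invariance under the orthogonal group of \<open>gx\<close>, an element of which is given in a chart by a
  matrix \<open>Q\<close>.\<close>

definition orthogonal_invariant ::
  "('x, 'n::finite) chart set \<Rightarrow> nat \<Rightarrow> 'x \<Rightarrow> (('x, 'n) chart \<Rightarrow> real^'n^'n) \<Rightarrow> ('x, 'n) tensor \<Rightarrow> bool"
where
  "orthogonal_invariant A k x gx K \<longleftrightarrow>
     (\<forall>c\<in>charts_at A x. \<forall>Q. transpose Q ** gx c ** Q = gx c \<longrightarrow>
        (\<forall>J. length J = k \<longrightarrow> lin_act k Q (K c) J = K c J))"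

definition Div_invariant ::
  "('x, 'n::finite) chart set \<Rightarrow> nat \<Rightarrow> nat \<Rightarrow> 'x \<Rightarrow> (('x, 'n) chart \<Rightarrow> real^'n^'n) \<Rightarrow>
     ('x, 'n) tensor set" where
  "Div_invariant A p m x gx = {K \<in> Div A p m x. orthogonal_invariant A (p + 4 * m) x gx K}"

end

theory Submission
  imports Defs
begin

text \<open>In a chart \<open>c\<close> at \<open>x\<close>, a quadratic and then a cubic change of coordinates bring a 2-jet with value
  \<open>gx\<close> into the form in which the first derivatives vanish and the second derivatives form a normal
  tensor. On the fibre over a 1-jet this normal tensor is the image of the second derivatives, up to a
  constant, under a linear projection \<open>normal_part\<close> that depends neither on the metric nor on the 1-jet.
  Hence \<open>T\<close> is on every such fibre the polynomial \<open>\<phi>\<close> composed with an affine map of fixed linear part,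
  and its \<open>m\<close>-th derivative is the polarization of \<open>\<phi> \<circ> normal_part\<close>, whichever the jet. It determines
  \<open>T\<close> on the jets with value \<open>gx\<close>, and by naturality everywhere, since any two metrics of the same signature
  are related by a linear change of coordinates. Naturality under the linear maps preserving \<open>gx\<close>
  gives the invariance. Finally, adding to a metric a cubic term with coefficients \<open>U\<close> does not change its 2-jet
  and changes the divergence of \<open>T\<close> by the first derivative of \<open>T\<close> along the fibre contracted
  with \<open>U\<close>; that this vanishes for all \<open>U\<close>, differentiated \<open>m - 1\<close> more times along the fibre, is
  the condition defining \<open>Div\<close>.\<close>

subsection \<open>Calculus of smooth maps\<close>

text \<open>The coefficients 1/3 and 1/6 in \<open>normal_part\<close> come from solving for the
  cubic change of coordinates after which the cyclic sums of the second derivatives vanish. Dually,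
  \<open>normal_part\<close> after averaging kills the arrays that are symmetric in their last three
  indices; this is why the blocks of the derivative lie in the kernel of symmetrization. The
  coefficients of \<phi> in different charts are chosen independently of each other, so the
  transformation law of the derivative cannot be read off from them: it holds because all charts
  compute the same fibre derivatives of the same T. Perturbing a metric is possible because, among
  symmetric matrices, the signature is an open condition. The cubic coefficients U are third partial
  derivatives, hence symmetric in three indices; symmetrized unit arrays are therefore the natural
  test perturbations, and they turn the vanishing contraction into the cyclic sum of three
  terms.\<close>

lemma frechet_derivative_cong_open:
  assumes "open S" "x \<in> S" "\<And>y. y \<in> S \<Longrightarrow> f y = g y"
  shows "frechet_derivative f (at x) = frechet_derivative g (at x)"
proof -
  have "(f has_derivative D) (at x) \<longleftrightarrow> (g has_derivative D) (at x)" for D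
    using has_derivative_transform_within_open[of f D x UNIV S g]
      has_derivative_transform_within_open[of g D x UNIV S f] assms by auto
  then show ?thesis by (simp add: frechet_derivative_def)
qed

lemma differentiable_cong_open:
  assumes "open S" "x \<in> S" "\<And>y. y \<in> S \<Longrightarrow> f y = g y"
  shows "f differentiable (at x) \<longleftrightarrow> g differentiable (at x)"
  using has_derivative_transform_within_open[of f _ x UNIV S g]
      has_derivative_transform_within_open[of g _ x UNIV S f] assms
  by (auto simp: differentiable_def)

lemma differentiable_upto_cong:
  assumes "open S" "\<And>x. x \<in> S \<Longrightarrow> f x = g x"
  shows "differentiable_upto k S f \<longleftrightarrow> differentiable_upto k S g"
  using assms(2)
proof (induction k arbitrary: f g)
  case 0
  then show ?case by (simp cong: continuous_on_cong)
next
  case (Suc k)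
  have "differentiable_upto k S (\<lambda>x. frechet_derivative f (at x) v) \<longleftrightarrow>
     differentiable_upto k S (\<lambda>x. frechet_derivative g (at x) v)" for v
    by (rule Suc.IH) (simp add: frechet_derivative_cong_open[OF assms(1) _ Suc.prems])
  moreover have "f differentiable at x \<longleftrightarrow> g differentiable at x" if "x \<in> S" for x
    by (rule differentiable_cong_open[OF assms(1) that Suc.prems])
  ultimately show ?case by auto
qed

lemma differentiable_upto_subset:
  "differentiable_upto k S f \<Longrightarrow> T \<subseteq> S \<Longrightarrow> differentiable_upto k T f"
  by (induction k arbitrary: f) (auto intro: continuous_on_subset)

lemma differentiable_upto_SucD: "differentiable_upto (Suc k) S f \<Longrightarrow> differentiable_upto k S f"
proof (induction k arbitrary: f)
  case 0
  then show ?case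
    by (auto intro!: continuous_at_imp_continuous_on differentiable_imp_continuous_within)
next
  case (Suc k)
  then show ?case by (metis differentiable_upto.simps(2))
qed

lemma differentiable_upto_const: "differentiable_upto k S (\<lambda>x. c)"
  by (induction k arbitrary: c) auto

text \<open>\<open>frechet_derivative\<close> is a choice, which the closure rules below cannot
  compute with directly. This rule lets each of them exhibit an explicit derivative and check the
  remaining orders on that expression.\<close>

lemma differentiable_upto_SucI:
  assumes "open S" "\<And>x. x \<in> S \<Longrightarrow> (f has_derivative f' x) (at x)"
    "\<And>v. differentiable_upto k S (\<lambda>x. f' x v)"
  shows "differentiable_upto (Suc k) S f"
proof -
  have "differentiable_upto k S (\<lambda>x. frechet_derivative f (at x) v)" for v
  proof -
    have "f' x v = frechet_derivative f (at x) v" if "x \<in> S" for x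
      using frechet_derivative_at[OF assms(2)[OF that]] by (rule fun_cong)
    then show ?thesis
      using differentiable_upto_cong[OF assms(1), of "\<lambda>x. f' x v"
          "\<lambda>x. frechet_derivative f (at x) v" k] assms(3) by simp
  qed
  then show ?thesis using assms(2) by (auto intro: differentiableI)
qed

lemma differentiable_upto_bounded_linear:
  assumes "bounded_linear h" "open S" "differentiable_upto k S f"
  shows "differentiable_upto k S (\<lambda>x. h (f x))"
  using assms(3)
proof (induction k arbitrary: f)
  case 0
  then show ?case
    using assms(1) by (auto intro: bounded_linear.continuous_on)
next
  case (Suc k)
  have D: "((\<lambda>x. h (f x)) has_derivative (\<lambda>v. h (frechet_derivative f (at x) v))) (at x)"
    if "x \<in> S" for x
    using Suc.prems that
    by (intro bounded_linear.has_derivative[OF assms(1)]) (auto simp: frechet_derivative_works)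
  show ?case
    using Suc by (intro differentiable_upto_SucI[OF assms(2) D]) auto
qed

lemma differentiable_upto_add:
  assumes "open S" "differentiable_upto k S f" "differentiable_upto k S g"
  shows "differentiable_upto k S (\<lambda>x. f x + g x)"
  using assms(2,3)
proof (induction k arbitrary: f g)
  case 0
  then show ?case by (auto intro: continuous_intros)
next
  case (Suc k)
  have D: "((\<lambda>x. f x + g x) has_derivative
     (\<lambda>v. frechet_derivative f (at x) v + frechet_derivative g (at x) v)) (at x)" if "x \<in> S" for x
    using Suc.prems that by (intro has_derivative_add) (auto simp: frechet_derivative_works)
  show ?case
    using Suc by (intro differentiable_upto_SucI[OF assms(1) D]) auto
qed

lemma (in bounded_bilinear) differentiable_upto:
  assumes "open S" "differentiable_upto k S f" "differentiable_upto k S g"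
  shows "differentiable_upto k S (\<lambda>x. prod (f x) (g x))"
  using assms(2,3)
proof (induction k arbitrary: f g)
  case 0
  then show ?case by (auto intro: continuous_on)
next
  case (Suc k)
  have D: "((\<lambda>x. prod (f x) (g x)) has_derivative
     (\<lambda>v. prod (f x) (frechet_derivative g (at x) v) + prod (frechet_derivative f (at x) v) (g x)))
     (at x)" if "x \<in> S" for x
    using Suc.prems that by (intro FDERIV) (auto simp: frechet_derivative_works)
  show ?case
    using Suc.prems differentiable_upto_SucD[OF Suc.prems(1)] differentiable_upto_SucD[OF Suc.prems(2)]
    by (intro differentiable_upto_SucI[OF assms(1) D] differentiable_upto_add[OF assms(1)] Suc.IH) auto
qed

lemma differentiable_upto_sum:
  assumes "open S" "\<And>i. i \<in> I \<Longrightarrow> differentiable_upto k S (f i)"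
  shows "differentiable_upto k S (\<lambda>x. \<Sum>i\<in>I. f i x)"
  using assms(2)
  by (induction I rule: infinite_finite_induct)
    (auto intro: differentiable_upto_const differentiable_upto_add[OF assms(1)])

lemma differentiable_upto_compose:
  fixes f :: "'a::real_normed_vector \<Rightarrow> 'b::euclidean_space"
    and g :: "'b \<Rightarrow> 'c::real_normed_vector"
  assumes "open S" "open T" "f ` S \<subseteq> T" "differentiable_upto k S f" "differentiable_upto k T g"
  shows "differentiable_upto k S (\<lambda>x. g (f x))"
  using assms(4,5)
proof (induction k arbitrary: g)
  case 0
  then show ?case using assms(3) by (auto intro: continuous_on_compose2)
next
  case (Suc k)
  have D0: "((\<lambda>x. g (f x)) has_derivative
     (\<lambda>v. frechet_derivative g (at (f x)) (frechet_derivative f (at x) v))) (at x)" if "x \<in> S" for x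
    using Suc.prems that assms(3)
    by (intro has_derivative_compose[of f _ x UNIV g]) (auto simp: frechet_derivative_works)
  \<comment> \<open>The derivative of g is applied to a direction that varies with x, while
    \<open>differentiable_upto\<close> speaks of fixed directions. Expanding in a basis leaves fixed
    directions b, to which the induction hypothesis applies.\<close>
  have E: "frechet_derivative g (at (f x)) (frechet_derivative f (at x) v) =
     (\<Sum>b\<in>Basis. (frechet_derivative f (at x) v \<bullet> b) *\<^sub>R frechet_derivative g (at (f x)) b)"
    if "x \<in> S" for x v
  proof -
    have "linear (frechet_derivative g (at (f x)))"
      using Suc.prems that assms(3) by (intro linear_frechet_derivative) auto
    then show ?thesis
      by (subst euclidean_representation[symmetric]) (simp add: linear_sum linear_scale)
  qed
  have D: "((\<lambda>x. g (f x)) has_derivative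
     (\<lambda>v. \<Sum>b\<in>Basis. (frechet_derivative f (at x) v \<bullet> b) *\<^sub>R frechet_derivative g (at (f x)) b)) (at x)"
    if "x \<in> S" for x
    using D0[OF that] by (simp add: E that)
  show ?case
  proof (rule differentiable_upto_SucI[OF assms(1) D])
    fix v
    show "differentiable_upto k S (\<lambda>x. \<Sum>b\<in>Basis. (frechet_derivative f (at x) v \<bullet> b) *\<^sub>R
       frechet_derivative g (at (f x)) b)"
    proof (intro differentiable_upto_sum[OF assms(1)]
        bounded_bilinear.differentiable_upto[OF bounded_bilinear_scaleR assms(1)])
      fix b :: 'b
      show "differentiable_upto k S (\<lambda>x. frechet_derivative f (at x) v \<bullet> b)"
        using Suc.prems
        by (intro differentiable_upto_bounded_linear[OF bounded_linear_inner_left assms(1)]) auto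
      show "differentiable_upto k S (\<lambda>x. frechet_derivative g (at (f x)) b)"
        using Suc.prems(2) differentiable_upto_SucD[OF Suc.prems(1)] by (intro Suc.IH) auto
    qed
  qed
qed

lemma differentiable_upto_inverse:
  fixes f :: "'a::real_normed_vector \<Rightarrow> real"
  assumes "open S" "differentiable_upto k S f" "\<And>x. x \<in> S \<Longrightarrow> f x \<noteq> 0"
  shows "differentiable_upto k S (\<lambda>x. inverse (f x))"
  using assms(2)
proof (induction k)
  case 0
  then show ?case using assms(3) by (auto intro: continuous_intros)
next
  case (Suc k)
  have D: "((\<lambda>x. inverse (f x)) has_derivative
     (\<lambda>v. - (inverse (f x) * frechet_derivative f (at x) v * inverse (f x)))) (at x)" if "x \<in> S" for x
    using Suc.prems that assms(3) by (intro Deriv.has_derivative_inverse) (auto simp: frechet_derivative_works)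
  show ?case
    using Suc differentiable_upto_SucD[OF Suc.prems]
    by (intro differentiable_upto_SucI[OF assms(1) D]
        differentiable_upto_bounded_linear[OF bounded_linear_minus[OF bounded_linear_ident]]
         bounded_bilinear.differentiable_upto[OF bounded_bilinear_mult] assms(1)) auto
qed

lemma smooth_on_cong:
  "open S \<Longrightarrow> (\<And>x. x \<in> S \<Longrightarrow> f x = g x) \<Longrightarrow> smooth_on S f \<longleftrightarrow> smooth_on S g"
  unfolding smooth_on_def using differentiable_upto_cong by metis

lemma smooth_on_subset: "smooth_on S f \<Longrightarrow> T \<subseteq> S \<Longrightarrow> smooth_on T f"
  unfolding smooth_on_def using differentiable_upto_subset by blast

lemma smooth_on_const: "smooth_on S (\<lambda>x. c)"
  by (simp add: smooth_on_def differentiable_upto_const)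

lemma smooth_on_bounded_linear:
  "bounded_linear h \<Longrightarrow> open S \<Longrightarrow> smooth_on S f \<Longrightarrow> smooth_on S (\<lambda>x. h (f x))"
  by (simp add: smooth_on_def differentiable_upto_bounded_linear)

lemma smooth_on_id: "smooth_on S (\<lambda>x. x)"
  unfolding smooth_on_def
proof
  fix k show "differentiable_upto k S (\<lambda>x. x)"
    by (cases k) (auto simp: differentiable_upto_const)
qed

lemma smooth_on_add:
  "open S \<Longrightarrow> smooth_on S f \<Longrightarrow> smooth_on S g \<Longrightarrow> smooth_on S (\<lambda>x. f x + g x)"
  by (simp add: smooth_on_def differentiable_upto_add)

lemma smooth_on_scaleR:
  "open S \<Longrightarrow> smooth_on S f \<Longrightarrow> smooth_on S g \<Longrightarrow> smooth_on S (\<lambda>x. f x *\<^sub>R g x)"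
  by (simp add: smooth_on_def bounded_bilinear.differentiable_upto[OF bounded_bilinear_scaleR])

lemma smooth_on_mult:
  fixes f g :: "'a::real_normed_vector \<Rightarrow> real"
  shows "open S \<Longrightarrow> smooth_on S f \<Longrightarrow> smooth_on S g \<Longrightarrow> smooth_on S (\<lambda>x. f x * g x)"
  by (simp add: smooth_on_def bounded_bilinear.differentiable_upto[OF bounded_bilinear_mult])

lemma smooth_on_minus:
  "open S \<Longrightarrow> smooth_on S f \<Longrightarrow> smooth_on S (\<lambda>x. - f x)"
  by (rule smooth_on_bounded_linear[OF bounded_linear_minus[OF bounded_linear_ident]])

lemma smooth_on_diff:
  "open S \<Longrightarrow> smooth_on S f \<Longrightarrow> smooth_on S g \<Longrightarrow> smooth_on S (\<lambda>x. f x - g x)"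
  using smooth_on_add[of S f "\<lambda>x. - g x"] smooth_on_minus[of S g] by simp

lemma smooth_on_sum:
  "open S \<Longrightarrow> (\<And>i. i \<in> I \<Longrightarrow> smooth_on S (f i)) \<Longrightarrow> smooth_on S (\<lambda>x. \<Sum>i\<in>I. f i x)"
  by (simp add: smooth_on_def differentiable_upto_sum)

lemma smooth_on_prod:
  fixes f :: "'i \<Rightarrow> 'a::real_normed_vector \<Rightarrow> real"
  assumes "open S" "\<And>i. i \<in> I \<Longrightarrow> smooth_on S (f i)"
  shows "smooth_on S (\<lambda>x. \<Prod>i\<in>I. f i x)"
  using assms(2)
  by (induction I rule: infinite_finite_induct)
    (auto intro: smooth_on_const smooth_on_mult[OF assms(1)])

lemma smooth_on_inverse:
  fixes f :: "'a::real_normed_vector \<Rightarrow> real"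
  shows "open S \<Longrightarrow> smooth_on S f \<Longrightarrow> (\<And>x. x \<in> S \<Longrightarrow> f x \<noteq> 0) \<Longrightarrow> smooth_on S (\<lambda>x. inverse (f x))"
  by (simp add: smooth_on_def differentiable_upto_inverse)

lemma smooth_on_compose:
  fixes f :: "'a::real_normed_vector \<Rightarrow> 'b::euclidean_space"
  shows "open S \<Longrightarrow> open T \<Longrightarrow> f ` S \<subseteq> T \<Longrightarrow> smooth_on S f \<Longrightarrow> smooth_on T g \<Longrightarrow>
    smooth_on S (\<lambda>x. g (f x))"
  by (simp add: smooth_on_def differentiable_upto_compose)

lemma bounded_linear_axis: "bounded_linear (axis i :: 'b::real_normed_vector \<Rightarrow> 'b^'n::finite)"
proof
  show "axis i (a + b) = (axis i a + axis i b :: 'b^'n)" for a b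
    by (simp add: vec_eq_iff axis_def)
  show "axis i (r *\<^sub>R b) = r *\<^sub>R (axis i b :: 'b^'n)" for r b
    by (simp add: vec_eq_iff axis_def)
  have "norm (axis i x :: 'b^'n) \<le> norm x * 1" for x
    using norm_le_l1_cart
    by (simp add: norm_vec_def axis_def L2_set_def if_distrib[where f=norm] if_distrib[where f="\<lambda>x. x^2"] cong: if_cong)
  then show "\<exists>K. \<forall>x. norm (axis i x :: 'b^'n) \<le> norm x * K" by blast
qed

lemma vec_eq_sum_axis: "(v :: 'b::real_normed_vector^'n::finite) = (\<Sum>i\<in>UNIV. axis i (v $ i))"
  by (simp add: vec_eq_iff axis_def)

lemma smooth_on_vec_iff:
  fixes f :: "'a::real_normed_vector \<Rightarrow> 'b::real_normed_vector^'n::finite"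
  assumes "open S"
  shows "smooth_on S f \<longleftrightarrow> (\<forall>i. smooth_on S (\<lambda>x. f x $ i))"
proof (intro iffI allI)
  show "smooth_on S (\<lambda>x. f x $ i)" if "smooth_on S f" for i
    by (rule smooth_on_bounded_linear[OF bounded_linear_vec_nth assms that])
next
  assume *: "\<forall>i. smooth_on S (\<lambda>x. f x $ i)"
  have "smooth_on S (\<lambda>x. \<Sum>i\<in>UNIV. axis i (f x $ i))"
    by (intro smooth_on_sum assms smooth_on_bounded_linear[OF bounded_linear_axis assms] *[rule_format])
  then show "smooth_on S f" by (simp flip: vec_eq_sum_axis)
qed

lemma smooth_on_vec_nth:
  "open S \<Longrightarrow> smooth_on S f \<Longrightarrow> smooth_on S (\<lambda>x. f x $ i)"
  by (rule smooth_on_bounded_linear[OF bounded_linear_vec_nth])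

lemma smooth_on_det:
  fixes f :: "'a::real_normed_vector \<Rightarrow> real^'n^'n::finite"
  assumes "open S" "smooth_on S f"
  shows "smooth_on S (\<lambda>x. det (f x))"
  unfolding det_def
  by (intro smooth_on_sum smooth_on_mult smooth_on_prod smooth_on_const smooth_on_vec_nth assms)

lemmas smooth_intros = smooth_on_const smooth_on_id smooth_on_add smooth_on_diff smooth_on_minus
  smooth_on_mult smooth_on_scaleR smooth_on_sum smooth_on_vec_nth

lemma smooth_on_frechet: "smooth_on S f \<Longrightarrow> smooth_on S (\<lambda>x. frechet_derivative f (at x) v)"
  unfolding smooth_on_def by (metis differentiable_upto.simps(2))

lemma smooth_on_pd: "smooth_on S f \<Longrightarrow> smooth_on S (pd k f)"
  unfolding pd_def by (rule smooth_on_frechet)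

lemma smooth_on_differentiable: "smooth_on S f \<Longrightarrow> x \<in> S \<Longrightarrow> f differentiable (at x)"
  unfolding smooth_on_def by (metis differentiable_upto.simps(2))

lemma smooth_on_continuous_on: "smooth_on S f \<Longrightarrow> continuous_on S f"
  unfolding smooth_on_def by (metis differentiable_upto.simps(1))

section \<open>Partial derivatives and their symmetry\<close>

lemma frechet_derivative_eq_pd:
  fixes f :: "real^'n::finite \<Rightarrow> 'b::real_normed_vector"
  assumes "f differentiable (at x)"
  shows "frechet_derivative f (at x) v = (\<Sum>i\<in>UNIV. v $ i *\<^sub>R pd i f x)"
proof -
  interpret linear "frechet_derivative f (at x)" by (rule linear_frechet_derivative[OF assms])
  have "v = (\<Sum>i\<in>UNIV. v $ i *\<^sub>R axis i 1)"
    by (simp add: vec_eq_iff axis_def if_distrib cong: if_cong)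
  then have "frechet_derivative f (at x) v = frechet_derivative f (at x) (\<Sum>i\<in>UNIV. v $ i *\<^sub>R axis i 1)"
    by simp
  then show ?thesis by (simp only: sum scaleR pd_def)
qed

lemma pd_cong:
  assumes "open S" "y \<in> S" "\<And>z. z \<in> S \<Longrightarrow> f z = g z"
  shows "pd k f y = pd k g y"
  unfolding pd_def using frechet_derivative_cong_open[OF assms] by simp

lemma has_derivative_imp_pd:
  "(f has_derivative f') (at y) \<Longrightarrow> pd k f y = f' (axis k 1)"
  unfolding pd_def using frechet_derivative_at by metis

lemma pd_const [simp]: "pd k (\<lambda>x. c) y = 0"
  by (simp add: pd_def)

lemma pd_nth [simp]: "pd k (\<lambda>x. x $ i) y = (if i = k then 1 else 0)"
  by (subst has_derivative_imp_pd[OF bounded_linear.has_derivative[OF bounded_linear_vec_nth has_derivative_ident]])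
    (simp add: axis_def)

lemma pd_add:
  assumes "f differentiable (at y)" "g differentiable (at y)"
  shows "pd k (\<lambda>x. f x + g x) y = pd k f y + pd k g y"
  by (subst has_derivative_imp_pd[OF has_derivative_add])
    (use assms in \<open>auto simp: frechet_derivative_works pd_def\<close>)

lemma pd_diff:
  assumes "f differentiable (at y)" "g differentiable (at y)"
  shows "pd k (\<lambda>x. f x - g x) y = pd k f y - pd k g y"
  by (subst has_derivative_imp_pd[OF has_derivative_diff])
    (use assms in \<open>auto simp: frechet_derivative_works pd_def\<close>)

lemma pd_mult:
  fixes f g :: "real^'n::finite \<Rightarrow> real"
  assumes "f differentiable (at y)" "g differentiable (at y)"
  shows "pd k (\<lambda>x. f x * g x) y = f y * pd k g y + pd k f y * g y"
  by (subst has_derivative_imp_pd[OF has_derivative_mult])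
    (use assms in \<open>auto simp: frechet_derivative_works pd_def\<close>)

lemma pd_sum:
  assumes "\<And>i. i \<in> I \<Longrightarrow> f i differentiable (at y)"
  shows "pd k (\<lambda>x. \<Sum>i\<in>I. f i x) y = (\<Sum>i\<in>I. pd k (f i) y)"
  by (subst has_derivative_imp_pd[OF has_derivative_sum])
    (use assms in \<open>auto simp: frechet_derivative_works pd_def\<close>)

lemma pd_vec_nth:
  assumes "f differentiable (at y)"
  shows "pd k f y $ i = pd k (\<lambda>x. f x $ i) y"
  by (subst has_derivative_imp_pd[OF bounded_linear.has_derivative[OF bounded_linear_vec_nth], of f])
    (use assms in \<open>auto simp: frechet_derivative_works pd_def\<close>)

lemma pd_compose:
  fixes f :: "real^'m::finite \<Rightarrow> real" and \<tau> :: "real^'n::finite \<Rightarrow> real^'m"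
  assumes "\<tau> differentiable (at y)" "f differentiable (at (\<tau> y))"
  shows "pd k (\<lambda>x. f (\<tau> x)) y = (\<Sum>a\<in>UNIV. pd a f (\<tau> y) * pd k (\<lambda>x. \<tau> x $ a) y)"
proof -
  have "pd k (\<lambda>x. f (\<tau> x)) y = frechet_derivative f (at (\<tau> y)) (pd k \<tau> y)"
    by (subst has_derivative_imp_pd[OF has_derivative_compose[of \<tau> _ y UNIV f]])
      (use assms in \<open>auto simp: frechet_derivative_works pd_def\<close>)
  then show ?thesis
    using assms by (simp add: frechet_derivative_eq_pd pd_vec_nth mult.commute)
qed

text \<open>The mean value theorem is applied twice, first in direction k to the difference of two
  shifted copies of f, then in direction l. The left side is symmetric in k and l, which is what
  gives the symmetry of second derivatives.\<close>

lemma second_difference: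
  fixes f :: "real^'n::finite \<Rightarrow> real"
  assumes f: "smooth_on (ball x d) f" and h: "0 < h" "2 * h < d"
  obtains y where "y \<in> ball x d" "dist x y < 2 * h"
    "f (x + h *\<^sub>R axis k 1 + h *\<^sub>R axis l 1) - f (x + h *\<^sub>R axis k 1) - f (x + h *\<^sub>R axis l 1) + f x
      = h * h * pd l (pd k f) y"
proof -
  have B: "dist x (x + s *\<^sub>R axis k 1 + t *\<^sub>R axis l 1) \<le> s + t" if "0 \<le> s" "0 \<le> t" for s t
    using that norm_triangle_ineq[of "s *\<^sub>R axis k (1::real)" "t *\<^sub>R axis l (1::real)"]
      by (simp add: dist_norm norm_minus_commute add.assoc) (simp add: add.commute)
  have in_ball: "x + s *\<^sub>R axis k 1 + t *\<^sub>R axis l 1 \<in> ball x d" if "0 \<le> s" "0 \<le> t" "s \<le> h" "t \<le> h" for s t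
    using B[of s t] that h by auto
  have line: "((\<lambda>s. F (z + s *\<^sub>R axis i 1)) has_real_derivative pd i F (z + s *\<^sub>R axis i 1)) (at s)"
    if "smooth_on (ball x d) F" "z + s *\<^sub>R axis i 1 \<in> ball x d" for F :: "real^'n \<Rightarrow> real" and z s i
  proof -
    have "F differentiable at (z + s *\<^sub>R axis i 1)"
      using smooth_on_differentiable that by blast
    then have FD: "(F has_derivative frechet_derivative F (at (z + s *\<^sub>R axis i 1))) (at (z + s *\<^sub>R axis i 1))"
      by (simp add: frechet_derivative_works)
    interpret linear "frechet_derivative F (at (z + s *\<^sub>R axis i 1))"
      by (rule linear_frechet_derivative) fact
    have "((\<lambda>s. z + s *\<^sub>R axis i 1) has_derivative (\<lambda>r. r *\<^sub>R axis i (1::real))) (at s)"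
      by (auto intro!: derivative_eq_intros)
    from has_derivative_compose[OF this FD]
    have "((\<lambda>s. F (z + s *\<^sub>R axis i 1)) has_derivative
       (\<lambda>r. r * pd i F (z + s *\<^sub>R axis i 1))) (at s)"
      by (simp add: scaleR pd_def)
    then show ?thesis by (simp add: has_field_derivative_def mult_commute_abs)
  qed
  let ?g = "\<lambda>s. f ((x + h *\<^sub>R axis l 1) + s *\<^sub>R axis k 1) - f (x + s *\<^sub>R axis k 1)"
  have "(?g has_real_derivative pd k f ((x + h *\<^sub>R axis l 1) + s *\<^sub>R axis k 1) - pd k f (x + s *\<^sub>R axis k 1)) (at s)"
    if "0 \<le> s" "s \<le> h" for s
    using in_ball[of s 0] in_ball[of s h] that h
    by (intro DERIV_diff line f) (auto simp: algebra_simps)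
  then obtain s where s: "0 < s" "s < h" "?g h - ?g 0 = (h - 0) *
     (pd k f ((x + h *\<^sub>R axis l 1) + s *\<^sub>R axis k 1) - pd k f (x + s *\<^sub>R axis k 1))"
    using MVT2[of 0 h ?g "\<lambda>s. pd k f ((x + h *\<^sub>R axis l 1) + s *\<^sub>R axis k 1) - pd k f (x + s *\<^sub>R axis k 1)"] h
    by auto
  have "((\<lambda>t. pd k f ((x + s *\<^sub>R axis k 1) + t *\<^sub>R axis l 1)) has_real_derivative
      pd l (pd k f) ((x + s *\<^sub>R axis k 1) + t *\<^sub>R axis l 1)) (at t)" if "0 \<le> t" "t \<le> h" for t
    using in_ball[of s t] that s by (intro line smooth_on_pd f) auto
  then obtain t where t: "0 < t" "t < h" "pd k f ((x + s *\<^sub>R axis k 1) + h *\<^sub>R axis l 1) -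
      pd k f ((x + s *\<^sub>R axis k 1) + 0 *\<^sub>R axis l 1) = (h - 0) * pd l (pd k f) ((x + s *\<^sub>R axis k 1) + t *\<^sub>R axis l 1)"
    using MVT2[of 0 h "\<lambda>t. pd k f ((x + s *\<^sub>R axis k 1) + t *\<^sub>R axis l 1)"
      "\<lambda>t. pd l (pd k f) ((x + s *\<^sub>R axis k 1) + t *\<^sub>R axis l 1)"] h
    by auto
  show thesis
  proof
    show "x + s *\<^sub>R axis k 1 + t *\<^sub>R axis l 1 \<in> ball x d" using in_ball s t by simp
    show "dist x (x + s *\<^sub>R axis k 1 + t *\<^sub>R axis l 1) < 2 * h" using B[of s t] s t by auto
    show "f (x + h *\<^sub>R axis k 1 + h *\<^sub>R axis l 1) - f (x + h *\<^sub>R axis k 1) - f (x + h *\<^sub>R axis l 1) + f x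
      = h * h * pd l (pd k f) (x + s *\<^sub>R axis k 1 + t *\<^sub>R axis l 1)"
      using s(3) t(3) by (simp add: algebra_simps)
  qed
qed

lemma pd_commute:
  fixes f :: "real^'n::finite \<Rightarrow> real"
  assumes "open S" "smooth_on S f" "x \<in> S"
  shows "pd l (pd k f) x = pd k (pd l f) x"
proof (rule ccontr)
  assume ne: "pd l (pd k f) x \<noteq> pd k (pd l f) x"
  \<comment> \<open>Half the gap: one and the same number cannot lie within e of both
    values.\<close>
  define e where "e = \<bar>pd l (pd k f) x - pd k (pd l f) x\<bar> / 2"
  have e: "e > 0" using ne by (simp add: e_def)
  obtain d0 where d0: "d0 > 0" "ball x d0 \<subseteq> S" using assms open_contains_ball by blast
  have cont: "continuous (at x) (pd l (pd k f))" for l k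
    using smooth_on_differentiable[OF smooth_on_pd[OF smooth_on_pd[OF assms(2)]] assms(3)]
    by (rule differentiable_imp_continuous_within)
  obtain d1 where d1: "d1 > 0" "\<And>y. dist y x < d1 \<Longrightarrow> dist (pd l (pd k f) y) (pd l (pd k f) x) < e"
    using cont[of l k] e unfolding continuous_at_eps_delta by blast
  obtain d2 where d2: "d2 > 0" "\<And>y. dist y x < d2 \<Longrightarrow> dist (pd k (pd l f) y) (pd k (pd l f) x) < e"
    using cont[of k l] e unfolding continuous_at_eps_delta by blast
  define h where "h = min d0 (min d1 d2) / 3"
  have h: "0 < h" "2 * h < d0" "2 * h < d1" "2 * h < d2" using d0 d1 d2 by (auto simp: h_def)
  have f: "smooth_on (ball x d0) f" using assms(2) d0 smooth_on_subset by blast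
  obtain y where y: "dist x y < 2 * h" "f (x + h *\<^sub>R axis k 1 + h *\<^sub>R axis l 1) - f (x + h *\<^sub>R axis k 1) - f (x + h *\<^sub>R axis l 1) + f x
      = h * h * pd l (pd k f) y"
    using second_difference[OF f h(1,2)] by metis
  obtain y' where y': "dist x y' < 2 * h" "f (x + h *\<^sub>R axis l 1 + h *\<^sub>R axis k 1) - f (x + h *\<^sub>R axis l 1) - f (x + h *\<^sub>R axis k 1) + f x
      = h * h * pd k (pd l f) y'"
    using second_difference[OF f h(1,2)] by metis
  have "h * h * pd l (pd k f) y = h * h * pd k (pd l f) y'"
    using y(2) y'(2) by (simp add: algebra_simps)
  then have eq: "pd l (pd k f) y = pd k (pd l f) y'" using h by simp
  have "dist (pd l (pd k f) y) (pd l (pd k f) x) < e" "dist (pd k (pd l f) y') (pd k (pd l f) x) < e"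
    using d1(2)[of y] d2(2)[of y'] y y' h by (auto simp: dist_commute)
  then show False unfolding eq e_def dist_real_def by argo
qed

section \<open>The inverse function theorem for smooth maps\<close>

lemma matrix_frechet_nth:
  fixes f :: "real^'n::finite \<Rightarrow> real^'m::finite"
  assumes "f differentiable (at y)"
  shows "matrix (frechet_derivative f (at y)) $ a $ i = pd i (\<lambda>z. f z $ a) y"
  using pd_vec_nth[OF assms, of i a] by (simp add: matrix_def pd_def)

text \<open>The derivative of \<psi> at y is the inverse of the Jacobian of \<theta> at \<psi> y,
  and by Cramer's rule that inverse is smooth in the point. So if \<psi> is of class k, its
  derivative is too, and \<psi> gains one order at a time, starting from continuity.\<close>

lemma smooth_inverse:
  fixes \<theta> :: "real^'n::finite \<Rightarrow> real^'n"
  assumes S: "open S" "smooth_on S \<theta>" "x0 \<in> S"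
    and id: "frechet_derivative \<theta> (at x0) = id"
  obtains Y V \<psi> where "open Y" "x0 \<in> Y" "Y \<subseteq> S" "open V" "homeomorphism Y V \<theta> \<psi>" "smooth_on V \<psi>"
proof -
  define f' where "f' x = Blinfun (frechet_derivative \<theta> (at x))" for x
  have D: "(\<theta> has_derivative frechet_derivative \<theta> (at x)) (at x)" if "x \<in> S" for x
    using smooth_on_differentiable[OF S(2) that] by (simp add: frechet_derivative_works)
  have f'_apply: "blinfun_apply (f' x) = frechet_derivative \<theta> (at x)" if "x \<in> S" for x
    unfolding f'_def by (rule bounded_linear_Blinfun_apply) (use D[OF that] in \<open>simp add: has_derivative_bounded_linear\<close>)
  have cont: "continuous_on S f'"
  proof (rule continuous_on_blinfun_componentwise)
    fix i :: "real^'n"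
    show "continuous_on S (\<lambda>x. blinfun_apply (f' x) i)"
      using smooth_on_continuous_on[OF smooth_on_frechet[OF S(2), of i]] f'_apply
      by (simp cong: continuous_on_cong)
  qed
  have inv: "id_blinfun o\<^sub>L f' x0 = id_blinfun"
    by (rule blinfun_eqI) (simp add: f'_apply[OF S(3)] id)
  obtain Y V \<psi> g' where Y: "open Y" "Y \<subseteq> S" "x0 \<in> Y" "open V" "\<theta> x0 \<in> V" "homeomorphism Y V \<theta> \<psi>"
    and g: "\<And>y. y \<in> V \<Longrightarrow> (\<psi> has_derivative (g' y)) (at y)"
    and g': "\<And>y. y \<in> V \<Longrightarrow> g' y = Hilbert_Choice.inv (blinfun_apply (f'(\<psi> y)))"
    and bij: "\<And>y. y \<in> V \<Longrightarrow> bij (blinfun_apply (f'(\<psi> y)))"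
    using inverse_function_theorem[OF S(1) _ cont S(3) inv, of \<theta>] D f'_apply by metis
  have in_Y: "\<psi> y \<in> Y" if "y \<in> V" for y
    using Y(6) that unfolding homeomorphism_def by blast
  define M where "M z = (\<chi> a i. pd i (\<lambda>z. \<theta> z $ a) z)" for z
  have M: "frechet_derivative \<theta> (at z) v = M z *v v" if "z \<in> S" for z v
  proof -
    have "Vector_Spaces.linear (*s) (*s) (frechet_derivative \<theta> (at z))"
      unfolding scalar_mult_eq_scaleR linear_def[symmetric]
      by (intro linear_frechet_derivative smooth_on_differentiable[OF S(2) that])
    moreover have "matrix (frechet_derivative \<theta> (at z)) = M z"
      by (simp add: vec_eq_iff M_def matrix_frechet_nth smooth_on_differentiable[OF S(2) that])
    ultimately show ?thesis using matrix_works[of "frechet_derivative \<theta> (at z)" v] by simp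
  qed
  have M_smooth: "smooth_on S M"
  proof -
    have "smooth_on S (\<lambda>z. M z $ a $ i)" for a i
      unfolding M_def using smooth_on_pd[OF smooth_on_vec_nth[OF S(1,2), of a], of i] by simp
    then show ?thesis by (simp only: smooth_on_vec_iff[OF S(1)]) blast
  qed
  \<comment> \<open>Cramer's rule: where \<open>det (M z)\<close> is nonzero, \<open>Cr v z\<close>
    is the solution w of \<open>M z *v w = v\<close>.\<close>
  define Cr where "Cr v z = (\<chi> k. det (\<chi> i j. if j = k then v $ i else M z $ i $ j) * inverse (det (M z)))" for v z
  define S' where "S' = {z \<in> S. det (M z) \<noteq> 0}"
  have "open S'"
  proof -
    have "continuous_on S (\<lambda>z. det (M z))"
      by (intro smooth_on_continuous_on smooth_on_det S M_smooth)
    then have "open (S \<inter> (\<lambda>z. det (M z)) -` (-{0}))"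
      by (intro continuous_open_preimage S(1) open_Compl) auto
    also have "S \<inter> (\<lambda>z. det (M z)) -` (-{0}) = S'" by (auto simp: S'_def)
    finally show ?thesis .
  qed
  have Cr_smooth: "smooth_on S' (Cr v)" for v
  proof -
    have M': "smooth_on S' M" using M_smooth by (rule smooth_on_subset) (auto simp: S'_def)
    have *: "smooth_on S' (\<lambda>z. \<chi> i j. if j = k then v $ i else M z $ i $ j)" for k
      unfolding smooth_on_vec_iff[OF \<open>open S'\<close>]
    proof (intro allI)
      fix i j
      show "smooth_on S' (\<lambda>x. (\<chi> i j. if j = k then v $ i else M x $ i $ j) $ i $ j)"
        using \<open>open S'\<close> M' by (cases "j = k") (auto intro!: smooth_intros)
    qed
    then show ?thesis
      unfolding Cr_def smooth_on_vec_iff[OF \<open>open S'\<close>] vec_lambda_beta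
      using \<open>open S'\<close>
      by (intro allI smooth_on_mult smooth_on_inverse smooth_on_det[OF _ *] smooth_on_det[OF _ M'])
        (auto simp: S'_def)
  qed
  have invM: "det (M (\<psi> y)) \<noteq> 0 \<and> g' y v = Cr v (\<psi> y)" if "y \<in> V" for y v
  proof -
    have zS: "\<psi> y \<in> S" using in_Y[OF that] Y(2) by blast
    have eq: "blinfun_apply (f' (\<psi> y)) = (*v) (M (\<psi> y))"
      unfolding f'_apply[OF zS] by (rule ext) (rule M[OF zS])
    have b: "bij ((*v) (M (\<psi> y)))"
      using bij[OF that] unfolding eq .
    then have "det (M (\<psi> y)) \<noteq> 0"
      using matrix_left_invertible_injective[of "M (\<psi> y)"] invertible_left_inverse invertible_det_nz
      by (auto simp: bij_def)
    moreover have "M (\<psi> y) *v g' y v = v"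
      unfolding g'[OF that] eq by (rule surj_f_inv_f[OF bij_is_surj[OF b]])
    ultimately show ?thesis
      by (simp add: cramer Cr_def divide_inverse)
  qed
  have in_S': "\<psi> ` V \<subseteq> S'" using invM in_Y Y(2) by (auto simp: S'_def)
  have "differentiable_upto k V \<psi>" for k
  proof (induction k)
    case 0
    then show ?case using Y(6) by (simp add: homeomorphism_def)
  next
    case (Suc k)
    have D: "(\<psi> has_derivative (\<lambda>v. Cr v (\<psi> y))) (at y)" if "y \<in> V" for y
    proof -
      have "g' y = (\<lambda>v. Cr v (\<psi> y))" using invM[OF that] by auto
      then show ?thesis using g[OF that] by simp
    qed
    show ?case
      using Cr_smooth
      by (intro differentiable_upto_SucI[OF Y(4) D]
        differentiable_upto_compose[OF Y(4) \<open>open S'\<close> in_S' Suc]) (auto simp: smooth_on_def)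
  qed
  then show thesis using that Y by (auto simp: smooth_on_def)
qed

subsection \<open>Charts\<close>

lemma is_chartI:
  assumes "open P" "open (\<phi> ` P)" "continuous_on P \<phi>" "continuous_on (\<phi> ` P) g"
    "\<And>z. z \<in> P \<Longrightarrow> g (\<phi> z) = z"
  shows "is_chart (P, \<phi>)" "\<And>y. y \<in> \<phi> ` P \<Longrightarrow> chart_inv (P, \<phi>) y = g y"
proof -
  have inj: "inj_on \<phi> P" by (metis assms(5) inj_onI)
  show eq: "chart_inv (P, \<phi>) y = g y" if "y \<in> \<phi> ` P" for y
    using that inj assms(5) by (auto simp: chart_inv_def)
  have "homeomorphism P (\<phi> ` P) \<phi> g"
    using assms by (auto simp: homeomorphism_def image_iff)
  then have "homeomorphism P (\<phi> ` P) \<phi> (chart_inv (P, \<phi>))"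
    by (rule homeomorphism_cong) (auto simp: eq)
  then show "is_chart (P, \<phi>)" using assms by (simp add: is_chart_def)
qed

locale smooth_manifold =
  fixes A :: "('x::{t2_space,second_countable_topology}, 'n::finite) chart set"
  assumes smooth_structure: "smooth_structure A"
begin

lemma is_chart: "c \<in> A \<Longrightarrow> is_chart c"
  using smooth_structure by (auto simp: smooth_structure_def)

lemma transition: "c \<in> A \<Longrightarrow> d \<in> A \<Longrightarrow> smooth_transition c d"
  using smooth_structure by (auto simp: smooth_structure_def)

lemma maximal:
  assumes "is_chart c" "\<And>d. d \<in> A \<Longrightarrow> smooth_transition c d" "\<And>d. d \<in> A \<Longrightarrow> smooth_transition d c"
  shows "c \<in> A"
proof -
  have "is_chart c \<and> (\<forall>d\<in>A. smooth_transition c d \<and> smooth_transition d c) \<longrightarrow> c \<in> A"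
    using smooth_structure unfolding smooth_structure_def by (elim conjE) (erule spec)
  then show ?thesis using assms by blast
qed

lemma ex_chart_at: "\<exists>c. c \<in> charts_at A x"
proof -
  have "(\<Union>c\<in>A. fst c) = UNIV"
    using smooth_structure unfolding smooth_structure_def by (elim conjE)
  then have "x \<in> (\<Union>c\<in>A. fst c)" by simp
  then show ?thesis unfolding charts_at_def by blast
qed

lemma open_dom: "c \<in> A \<Longrightarrow> open (fst c)"
  using is_chart by (auto simp: is_chart_def)

lemma open_image: "c \<in> A \<Longrightarrow> open (snd c ` fst c)"
  using is_chart by (auto simp: is_chart_def)

lemma chart_inv_left: "c \<in> A \<Longrightarrow> x \<in> fst c \<Longrightarrow> chart_inv c (snd c x) = x"
  using is_chart by (auto simp: is_chart_def homeomorphism_def)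

lemma chart_inv_right: "c \<in> A \<Longrightarrow> y \<in> snd c ` fst c \<Longrightarrow> snd c (chart_inv c y) = y"
  by (auto simp: chart_inv_left)

lemma chart_inv_mem: "c \<in> A \<Longrightarrow> y \<in> snd c ` fst c \<Longrightarrow> chart_inv c y \<in> fst c"
  by (auto simp: chart_inv_left)

lemma chart_continuous: "c \<in> A \<Longrightarrow> continuous_on (fst c) (snd c)"
  using is_chart by (auto simp: is_chart_def homeomorphism_def)

lemma chart_inv_continuous: "c \<in> A \<Longrightarrow> continuous_on (snd c ` fst c) (chart_inv c)"
  using is_chart by (auto simp: is_chart_def homeomorphism_def)

lemma image_eq_vimage:
  "c \<in> A \<Longrightarrow> snd c ` (fst c \<inter> W) = snd c ` fst c \<inter> chart_inv c -` W"
  by (auto simp: chart_inv_left)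

lemma open_image_Int:
  assumes "c \<in> A" "open W"
  shows "open (snd c ` (fst c \<inter> W))"
  unfolding image_eq_vimage[OF assms(1)]
  by (intro continuous_open_preimage chart_inv_continuous open_image assms)

lemma open_vimage_chart:
  assumes "c \<in> A" "open V"
  shows "open {z \<in> fst c. snd c z \<in> V}"
proof -
  have "open (fst c \<inter> snd c -` V)"
    by (intro continuous_open_preimage chart_continuous open_dom assms)
  then show ?thesis by (simp add: vimage_def Int_def)
qed

lemma smooth_trans:
  assumes "c \<in> A" "d \<in> A"
  shows "smooth_on (snd c ` (fst c \<inter> fst d)) (\<lambda>y. snd d (chart_inv c y))"
  using transition[OF assms] by (simp add: smooth_transition_def o_def)

lemma charts_atD: "c \<in> charts_at A x \<Longrightarrow> c \<in> A" "c \<in> charts_at A x \<Longrightarrow> x \<in> fst c"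
  by (auto simp: charts_at_def)

lemma trans_differentiable:
  assumes "c \<in> charts_at A x" "d \<in> charts_at A x"
  shows "(\<lambda>y. snd d (chart_inv c y)) differentiable (at (snd c x))"
  using smooth_on_differentiable[OF smooth_trans[of c d], of "snd c x"] assms
  by (auto simp: charts_at_def)

lemma jac_nth:
  assumes "c \<in> charts_at A x" "d \<in> charts_at A x"
  shows "jac c d x $ a $ i = pd i (\<lambda>y. snd d (chart_inv c y) $ a) (snd c x)"
  using matrix_frechet_nth[OF trans_differentiable[OF assms]] by (simp add: jac_def o_def)

lemma jac_cocycle:
  assumes c: "c \<in> charts_at A x" and d: "d \<in> charts_at A x" and e: "e \<in> charts_at A x"
  shows "jac c e x = jac d e x ** jac c d x"
proof -
  note m = charts_atD[OF c] charts_atD[OF d] charts_atD[OF e]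
  let ?O = "snd c ` (fst c \<inter> (fst d \<inter> fst e))"
  have O: "open ?O" "snd c x \<in> ?O"
    using m by (auto intro!: open_image_Int open_Int open_dom)
  have dx: "snd d (chart_inv c (snd c x)) = snd d x" using m by (simp add: chart_inv_left)
  have eq: "snd e (chart_inv c y) = snd e (chart_inv d (snd d (chart_inv c y)))" if "y \<in> ?O" for y
    using that m by (auto simp: chart_inv_left)
  have "jac c e x $ a $ i = (jac d e x ** jac c d x) $ a $ i" for a i
  proof -
    have "jac c e x $ a $ i = pd i (\<lambda>y. snd e (chart_inv d (snd d (chart_inv c y))) $ a) (snd c x)"
      unfolding jac_nth[OF c e] by (rule pd_cong[OF O]) (use eq in simp)
    also have "\<dots> = (\<Sum>b\<in>UNIV. pd b (\<lambda>y. snd e (chart_inv d y) $ a) (snd d x) * pd i (\<lambda>y. snd d (chart_inv c y) $ b) (snd c x))"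
    proof -
      have "(\<lambda>y. snd e (chart_inv d y) $ a) differentiable (at (snd d (chart_inv c (snd c x))))"
        unfolding dx
        by (intro smooth_on_differentiable[OF smooth_on_vec_nth[OF _ smooth_trans[of d e]]])
          (use m in \<open>auto intro: open_image_Int open_dom\<close>)
      from pd_compose[OF trans_differentiable[OF c d] this, of i] show ?thesis unfolding dx .
    qed
    also have "\<dots> = (jac d e x ** jac c d x) $ a $ i"
      by (simp add: matrix_matrix_mult_def jac_nth[OF d e] jac_nth[OF c d])
    finally show ?thesis .
  qed
  then show ?thesis by (simp add: vec_eq_iff)
qed

lemma jac_self:
  assumes c: "c \<in> charts_at A x"
  shows "jac c c x = mat 1"
proof -
  note m = charts_atD[OF c]
  have "pd i (\<lambda>y. snd c (chart_inv c y) $ a) (snd c x) = pd i (\<lambda>y. y $ a) (snd c x)" for i a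
    by (rule pd_cong[OF open_image[OF m(1)]]) (use m in \<open>auto simp: chart_inv_right\<close>)
  then show ?thesis by (simp add: vec_eq_iff mat_def jac_nth[OF c c] del: pd_nth) (simp add: eq_commute)
qed

lemma jac_inverse:
  assumes "c \<in> charts_at A x" "d \<in> charts_at A x"
  shows "jac d c x ** jac c d x = mat 1"
  using jac_cocycle[OF assms(1,2,1)] jac_self[OF assms(1)] by simp

lemma jac_invertible:
  assumes "c \<in> charts_at A x" "d \<in> charts_at A x"
  shows "invertible (jac c d x)"
  using jac_inverse[OF assms] jac_inverse[OF assms(2,1)] by (auto simp: invertible_def)

lemma jac_smooth:
  assumes c: "c \<in> A" and d: "d \<in> A"
  shows "smooth_on (snd c ` (fst c \<inter> fst d)) (\<lambda>y. jac c d (chart_inv c y))"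
proof -
  let ?O = "snd c ` (fst c \<inter> fst d)"
  have O: "open ?O" by (intro open_image_Int open_dom c d)
  have "smooth_on ?O (\<lambda>y. jac c d (chart_inv c y) $ a $ i)" for a i
  proof -
    have "smooth_on ?O (pd i (\<lambda>y. snd d (chart_inv c y) $ a))"
      by (intro smooth_on_pd smooth_on_vec_nth O smooth_trans c d)
    moreover have "jac c d (chart_inv c y) $ a $ i = pd i (\<lambda>y. snd d (chart_inv c y) $ a) y"
      if "y \<in> ?O" for y
      using that c d by (subst jac_nth) (auto simp: charts_at_def chart_inv_left)
    ultimately show ?thesis
      using smooth_on_cong[OF O, of "\<lambda>y. jac c d (chart_inv c y) $ a $ i"
          "pd i (\<lambda>y. snd d (chart_inv c y) $ a)"] by simp
  qed
  then show ?thesis by (simp add: smooth_on_vec_iff[OF O])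
qed

text \<open>As the atlas is maximal, d belongs to it once its transitions with the old charts are
  smooth, and these are transitions of c composed with \<theta> or \<psi>. All coordinates adapted
  to a metric below arise in this way.\<close>

lemma chart_reparametrization:
  fixes \<theta> \<psi> :: "real^'n \<Rightarrow> real^'n"
  assumes c: "c \<in> A" and Y: "open Y" "open V" "V \<subseteq> snd c ` fst c"
    and h: "homeomorphism Y V \<theta> \<psi>" and s: "smooth_on Y \<theta>" "smooth_on V \<psi>"
  defines "d \<equiv> ({z \<in> fst c. snd c z \<in> V}, \<lambda>z. \<psi> (snd c z))"
  shows "d \<in> A" "snd d ` fst d = Y" "\<And>y. y \<in> Y \<Longrightarrow> chart_inv d y = chart_inv c (\<theta> y)"
proof -
  have VY: "\<psi> v \<in> Y" "\<theta> (\<psi> v) = v" if "v \<in> V" for v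
    using h that by (auto simp: homeomorphism_def)
  have YV: "\<theta> y \<in> V" "\<psi> (\<theta> y) = y" if "y \<in> Y" for y
    using h that by (auto simp: homeomorphism_def)
  have ch: "continuous_on Y \<theta>" "continuous_on V \<psi>" using h by (auto simp: homeomorphism_def)
  let ?P = "{z \<in> fst c. snd c z \<in> V}"
  have P: "open ?P" using open_vimage_chart c Y by blast
  have im: "(\<lambda>z. \<psi> (snd c z)) ` ?P = Y"
  proof
    show "Y \<subseteq> (\<lambda>z. \<psi> (snd c z)) ` ?P"
    proof
      fix y assume y: "y \<in> Y"
      then have "\<theta> y \<in> snd c ` fst c" using YV Y by blast
      then obtain z where "z \<in> fst c" "\<theta> y = snd c z" by blast
      then show "y \<in> (\<lambda>z. \<psi> (snd c z)) ` ?P" using YV[OF y] by (auto simp: image_iff intro!: bexI[of _ z])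
    qed
  qed (use VY in auto)
  then show "snd d ` fst d = Y" by (simp add: d_def)
  have cont: "continuous_on ?P (\<lambda>z. \<psi> (snd c z))"
    by (rule continuous_on_compose2[OF ch(2) continuous_on_subset[OF chart_continuous[OF c]]]) auto
  have cont': "continuous_on ((\<lambda>z. \<psi> (snd c z)) ` ?P) (\<lambda>y. chart_inv c (\<theta> y))"
    unfolding im using Y YV
    by (intro continuous_on_compose2[OF chart_inv_continuous[OF c] ch(1)]) auto
  have inv: "chart_inv c (\<theta> (\<psi> (snd c z))) = z" if "z \<in> ?P" for z
    using that c by (auto simp: VY chart_inv_left)
  note isc = is_chartI[OF P _ cont cont' inv, unfolded im, OF Y(1), folded d_def]
  show ci: "chart_inv d y = chart_inv c (\<theta> y)" if "y \<in> Y" for y using isc(2)[OF _ that] by blast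
  show "d \<in> A"
  proof (rule maximal)
    show "is_chart d" using isc(1) by blast
    fix e assume e: "e \<in> A"
    let ?O = "snd d ` (fst d \<inter> fst e)"
    have O: "?O = {y \<in> Y. \<theta> y \<in> snd c ` (fst c \<inter> fst e)}"
    proof
      show "?O \<subseteq> {y \<in> Y. \<theta> y \<in> snd c ` (fst c \<inter> fst e)}"
        by (auto simp: d_def VY)
      show "{y \<in> Y. \<theta> y \<in> snd c ` (fst c \<inter> fst e)} \<subseteq> ?O"
      proof
        fix y assume "y \<in> {y \<in> Y. \<theta> y \<in> snd c ` (fst c \<inter> fst e)}"
        then obtain z where "y \<in> Y" "z \<in> fst c" "z \<in> fst e" "\<theta> y = snd c z" by auto
        then show "y \<in> ?O" using YV[of y] by (auto simp: d_def image_iff intro!: bexI[of _ z])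
      qed
    qed
    have "open (Y \<inter> \<theta> -` (snd c ` (fst c \<inter> fst e)))"
      using h by (intro continuous_open_preimage open_image_Int open_dom c e Y) (auto simp: homeomorphism_def)
    then have oO: "open ?O" unfolding O by (simp add: vimage_def Int_def)
    have "smooth_on ?O (\<lambda>y. snd e (chart_inv c (\<theta> y)))"
      by (intro smooth_on_compose[OF oO _ _ smooth_on_subset[OF s(1)] smooth_trans[OF c e]]
         open_image_Int open_dom c e) (auto simp: O)
    then show "smooth_transition d e"
      unfolding smooth_transition_def o_def
      by (subst smooth_on_cong[OF oO]) (auto simp: O ci)
    let ?O' = "snd e ` (fst e \<inter> fst d)"
    have oO': "open ?O'" using isc(1) by (intro open_image_Int e) (simp add: is_chart_def)
    have "smooth_on ?O' (\<lambda>y. \<psi> (snd c (chart_inv e y)))"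
      by (intro smooth_on_compose[OF oO' _ _ smooth_on_subset[OF smooth_trans[OF e c]] s(2)] Y)
        (auto simp: d_def chart_inv_left e)
    then show "smooth_transition e d"
      by (simp add: smooth_transition_def o_def d_def)
  qed
qed

text \<open>Since the Jacobian is the identity, tensors at x have the same components in c and d.
  The radius stays free below a bound because \<open>normal_form\<close> later shrinks the ball
  until a quadratic metric has the right signature on it.\<close>

lemma ex_chart_with_parametrization:
  fixes \<theta> :: "real^'n \<Rightarrow> real^'n"
  assumes c: "c \<in> charts_at A x" and W: "open W" "x \<in> W"
    and \<theta>: "smooth_on UNIV \<theta>" "\<theta> 0 = snd c x" "\<And>i a. pd i (\<lambda>y. \<theta> y $ a) 0 = (if a = i then 1 else 0)"
  shows "\<exists>e0>0. \<forall>e. 0 < e \<and> e \<le> e0 \<longrightarrow> (\<exists>d\<in>charts_at A x. snd d x = 0 \<and> snd d ` fst d = ball 0 e \<and>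
    fst d \<subseteq> fst c \<inter> W \<and> (\<forall>y\<in>ball 0 e. chart_inv d y = chart_inv c (\<theta> y) \<and> \<theta> y \<in> snd c ` (fst c \<inter> W)) \<and>
    jac d c x = mat 1)"
proof -
  note m = charts_atD[OF c]
  have id: "frechet_derivative \<theta> (at 0) = id"
  proof
    fix v
    have diff: "\<theta> differentiable (at 0)" using smooth_on_differentiable[OF \<theta>(1)] by simp
    have "frechet_derivative \<theta> (at 0) v $ a = v $ a" for a
      by (simp add: frechet_derivative_eq_pd[OF diff] pd_vec_nth[OF diff] \<theta>(3) if_distrib cong: if_cong)
    then show "frechet_derivative \<theta> (at 0) v = id v" by (simp add: vec_eq_iff)
  qed
  obtain Y V \<psi> where Y: "open Y" "0 \<in> Y" "open V" "homeomorphism Y V \<theta> \<psi>" "smooth_on V \<psi>"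
    using smooth_inverse[OF open_UNIV \<theta>(1) UNIV_I id] by metis
  have YV: "\<psi> (\<theta> y) = y" if "y \<in> Y" for y using Y(4) that by (auto simp: homeomorphism_def)
  let ?O = "snd c ` (fst c \<inter> W)"
  have oO: "open ?O" using open_image_Int m W by blast
  have "open (Y \<inter> \<theta> -` ?O)"
    using Y(4) by (intro continuous_open_preimage oO Y) (auto simp: homeomorphism_def)
  moreover have "0 \<in> Y \<inter> \<theta> -` ?O" using Y m W \<theta> by auto
  ultimately obtain e0 where e0: "e0 > 0" "ball 0 e0 \<subseteq> Y \<inter> \<theta> -` ?O"
    using open_contains_ball by blast
  have "\<exists>d\<in>charts_at A x. snd d x = 0 \<and> snd d ` fst d = ball 0 e \<and>
    fst d \<subseteq> fst c \<inter> W \<and> (\<forall>y\<in>ball 0 e. chart_inv d y = chart_inv c (\<theta> y) \<and> \<theta> y \<in> ?O) \<and>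
    jac d c x = mat 1" if e: "0 < e" "e \<le> e0" for e
  proof -
    let ?B = "ball (0::real^'n) e"
    have "?B \<subseteq> ball 0 e0" using e by auto
    then have B: "?B \<subseteq> Y" "\<theta> ` ?B \<subseteq> ?O" using e0 by blast+
    have h: "homeomorphism ?B (\<theta> ` ?B) \<theta> \<psi>"
      using homeomorphism_of_subsets[OF Y(4) B(1) _ refl] Y(4) B(1) by (auto simp: homeomorphism_def)
    have \<theta>B: "\<theta> ` ?B \<subseteq> V" using B(1) Y(4) by (auto simp: homeomorphism_def)
    have oB: "open (\<theta> ` ?B)"
    proof -
      have "openin (top_of_set Y) ?B" using B(1) by (simp add: open_subset)
      from homeomorphism_imp_open_map[OF Y(4) this] show ?thesis
        using openin_open_eq[OF Y(3)] by blast
    qed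
    define d where "d = ({z \<in> fst c. snd c z \<in> \<theta> ` ?B}, \<lambda>z. \<psi> (snd c z))"
    have "\<theta> ` ?B \<subseteq> snd c ` fst c" using B by blast
    note r = chart_reparametrization[OF m(1) open_ball oB this h
        smooth_on_subset[OF \<theta>(1) subset_UNIV] smooth_on_subset[OF Y(5) \<theta>B], folded d_def]
    have xd: "x \<in> fst d" using e \<theta>(2) m by (auto simp: d_def image_iff intro!: bexI[of _ 0])
    have dx: "snd d x = 0" using YV[OF Y(2)] \<theta>(2) by (simp add: d_def)
    have d: "d \<in> charts_at A x" using r xd by (simp add: charts_at_def)
    have sub: "fst d \<subseteq> fst c \<inter> W"
    proof
      fix z assume "z \<in> fst d"
      then have "z \<in> fst c" "snd c z \<in> ?O" using B(2) by (auto simp: d_def)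
      then obtain w where w: "w \<in> fst c \<inter> W" "snd c z = snd c w" by auto
      then have "z = w" by (metis IntD1 \<open>z \<in> fst c\<close> chart_inv_left m(1))
      then show "z \<in> fst c \<inter> W" using w by simp
    qed
    have "jac d c x $ a $ i = (mat 1 :: real^'n^'n) $ a $ i" for a i
    proof -
      have "jac d c x $ a $ i = pd i (\<lambda>y. \<theta> y $ a) 0"
        unfolding jac_nth[OF d c] dx
      proof (rule pd_cong[OF open_ball])
        show "(0::real^'n) \<in> ball 0 e" using e by simp
        fix y :: "real^'n" assume y: "y \<in> ball 0 e"
        have "\<theta> y \<in> snd c ` fst c" using B y by blast
        then show "snd c (chart_inv d y) $ a = \<theta> y $ a"
          using r(3)[OF y] chart_inv_right m by simp
      qed
      then show ?thesis by (simp add: \<theta>(3) mat_def)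
    qed
    then have "jac d c x = mat 1" by (simp add: vec_eq_iff)
    then show ?thesis using d dx r sub B by (intro bexI[of _ d]) auto
  qed
  then show ?thesis using e0(1) by blast
qed

section \<open>Charts pulled back along diffeomorphisms\<close>

lemma diffeo_inv:
  assumes "diffeo A U V \<tau>"
  shows "z \<in> U \<Longrightarrow> inv_into U \<tau> (\<tau> z) = z" "w \<in> V \<Longrightarrow> \<tau> (inv_into U \<tau> w) = w"
    "z \<in> U \<Longrightarrow> \<tau> z \<in> V" "w \<in> V \<Longrightarrow> inv_into U \<tau> w \<in> U"
  using assms unfolding diffeo_def homeomorphism_def by auto

text \<open>Direct images read a tensor in the pulled back chart, so they make sense only if that
  chart is in the atlas. This again rests on maximality.\<close>

lemma pull_chart:
  assumes \<tau>: "diffeo A U V \<tau>" and d: "d \<in> A"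
  shows "pull_chart U \<tau> d \<in> A"
    "snd (pull_chart U \<tau> d) ` fst (pull_chart U \<tau> d) = snd d ` (fst d \<inter> V)"
    "\<And>y. y \<in> snd d ` (fst d \<inter> V) \<Longrightarrow> chart_inv (pull_chart U \<tau> d) y = inv_into U \<tau> (chart_inv d y)"
proof -
  note di = diffeo_inv[OF \<tau>]
  have h: "open U" "open V" "continuous_on U \<tau>" "continuous_on V (inv_into U \<tau>)"
    using \<tau> by (auto simp: diffeo_def homeomorphism_def)
  let ?P = "{z \<in> U. \<tau> z \<in> fst d}" and ?\<phi> = "\<lambda>z. snd d (\<tau> z)"
  have pc: "pull_chart U \<tau> d = (?P, ?\<phi>)" by (simp add: pull_chart_def o_def)
  have "open (U \<inter> \<tau> -` fst d)" by (intro continuous_open_preimage open_dom h d)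
  then have P: "open ?P" by (simp add: vimage_def Int_def)
  have im: "?\<phi> ` ?P = snd d ` (fst d \<inter> V)"
  proof
    show "snd d ` (fst d \<inter> V) \<subseteq> ?\<phi> ` ?P"
    proof
      fix y assume "y \<in> snd d ` (fst d \<inter> V)"
      then obtain z where z: "z \<in> fst d" "z \<in> V" "y = snd d z" by blast
      then show "y \<in> ?\<phi> ` ?P" using di(2,4)[OF z(2)] by (auto intro!: image_eqI[of _ _ "inv_into U \<tau> z"])
    qed
  qed (use di in auto)
  show im': "snd (pull_chart U \<tau> d) ` fst (pull_chart U \<tau> d) = snd d ` (fst d \<inter> V)"
    using im by (simp add: pc)
  have cont: "continuous_on ?P ?\<phi>"
    using h by (intro continuous_on_compose2[OF chart_continuous[OF d]]) (auto intro: continuous_on_subset)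
  have cont': "continuous_on (?\<phi> ` ?P) (\<lambda>y. inv_into U \<tau> (chart_inv d y))"
    unfolding im
    by (intro continuous_on_compose2[OF h(4)] continuous_on_subset[OF chart_inv_continuous[OF d]])
      (auto simp: chart_inv_left d)
  have inv: "inv_into U \<tau> (chart_inv d (?\<phi> z)) = z" if "z \<in> ?P" for z
    using that by (auto simp: chart_inv_left d di)
  note isc = is_chartI[OF P _ cont cont' inv, unfolded im, folded pc, OF open_image_Int[OF d h(2)]]
  show ci: "chart_inv (pull_chart U \<tau> d) y = inv_into U \<tau> (chart_inv d y)" if "y \<in> snd d ` (fst d \<inter> V)" for y
    using isc(2)[OF _ that] by blast
  show "pull_chart U \<tau> d \<in> A"
  proof (rule maximal)
    show "is_chart (pull_chart U \<tau> d)" using isc(1) by blast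
    fix e assume e: "e \<in> A"
    let ?O = "snd d ` {z \<in> fst d \<inter> V. inv_into U \<tau> z \<in> fst e}"
    have O: "snd (pull_chart U \<tau> d) ` (fst (pull_chart U \<tau> d) \<inter> fst e) = ?O"
    proof
      show "snd (pull_chart U \<tau> d) ` (fst (pull_chart U \<tau> d) \<inter> fst e) \<subseteq> ?O"
        unfolding pc using di by auto
      show "?O \<subseteq> snd (pull_chart U \<tau> d) ` (fst (pull_chart U \<tau> d) \<inter> fst e)"
      proof
        fix y assume "y \<in> ?O"
        then obtain z where z: "z \<in> fst d" "z \<in> V" "inv_into U \<tau> z \<in> fst e" "y = snd d z" by blast
        then show "y \<in> snd (pull_chart U \<tau> d) ` (fst (pull_chart U \<tau> d) \<inter> fst e)"
          unfolding pc using di(2,4)[OF z(2)] by (auto intro!: image_eqI[of _ _ "inv_into U \<tau> z"])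
      qed
    qed
    have "open (V \<inter> inv_into U \<tau> -` fst e)" by (intro continuous_open_preimage open_dom h e)
    then have "open (snd d ` (fst d \<inter> (V \<inter> inv_into U \<tau> -` fst e)))" by (rule open_image_Int[OF d])
    then have oO: "open ?O" by (simp add: vimage_def Int_def conj_ac)
    have "smooth_on ?O (snd e \<circ> inv_into U \<tau> \<circ> chart_inv d)"
      using \<tau> d e by (simp add: diffeo_def)
    then show "smooth_transition (pull_chart U \<tau> d) e"
      unfolding smooth_transition_def O
      by (subst smooth_on_cong[OF oO]) (auto simp: ci)
    have "snd e ` (fst e \<inter> fst (pull_chart U \<tau> d)) = snd e ` {z \<in> fst e \<inter> U. \<tau> z \<in> fst d}"
      by (auto simp: pc)
    moreover have "smooth_on (snd e ` {z \<in> fst e \<inter> U. \<tau> z \<in> fst d}) (snd d \<circ> \<tau> \<circ> chart_inv e)"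
      using \<tau> d e by (simp add: diffeo_def)
    ultimately show "smooth_transition e (pull_chart U \<tau> d)"
      by (simp add: smooth_transition_def pc o_def)
  qed
qed

lemma pull_chart_at:
  assumes "diffeo A U V \<tau>" "x \<in> U" "c \<in> charts_at A (\<tau> x)"
  shows "pull_chart U \<tau> c \<in> charts_at A x"
  using pull_chart(1)[OF assms(1)] assms by (auto simp: charts_at_def pull_chart_def)

lemma jac_pull_chart:
  assumes \<tau>: "diffeo A U V \<tau>" and x: "x \<in> U" and c: "c \<in> charts_at A (\<tau> x)" and d: "d \<in> charts_at A (\<tau> x)"
  shows "jac (pull_chart U \<tau> c) (pull_chart U \<tau> d) x = jac c d (\<tau> x)"
proof -
  have mem: "pull_chart U \<tau> e \<in> charts_at A x" if "e \<in> charts_at A (\<tau> x)" for e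
    using pull_chart_at[OF \<tau> x that] .
  note m = charts_atD[OF c] charts_atD[OF d]
  note di = diffeo_inv[OF \<tau>]
  let ?O = "snd c ` (fst c \<inter> V)"
  have O: "open ?O" "snd c (\<tau> x) \<in> ?O"
    using \<tau> m x di by (auto intro!: open_image_Int simp: diffeo_def)
  have "pd i (\<lambda>y. snd (pull_chart U \<tau> d) (chart_inv (pull_chart U \<tau> c) y) $ a) (snd c (\<tau> x)) =
     pd i (\<lambda>y. snd d (chart_inv c y) $ a) (snd c (\<tau> x))" for a i
  proof (rule pd_cong[OF O])
    fix y assume y: "y \<in> ?O"
    then have "\<tau> (chart_inv (pull_chart U \<tau> c) y) = chart_inv c y"
      unfolding pull_chart(3)[OF \<tau> m(1) y] using m di by (auto simp: chart_inv_left)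
    then show "snd (pull_chart U \<tau> d) (chart_inv (pull_chart U \<tau> c) y) $ a = snd d (chart_inv c y) $ a"
      by (simp add: pull_chart_def)
  qed
  moreover have "snd (pull_chart U \<tau> c) x = snd c (\<tau> x)" by (simp add: pull_chart_def)
  ultimately show "jac (pull_chart U \<tau> c) (pull_chart U \<tau> d) x = jac c d (\<tau> x)"
    by (simp add: vec_eq_iff[where 'a="real^'n"] vec_eq_iff[where 'a=real and x="x$i" for x i]
       jac_nth[OF mem[OF c] mem[OF d]] jac_nth[OF c d])
qed

text \<open>The diffeomorphism is affine in the coordinates of c' and c, with linear part L. Taking
  for L a congruence between two matrices of the same signature matches the values of two metrics;
  taking L orthogonal for gx preserves gx.\<close>

lemma ex_linear_diffeo:
  fixes L :: "real^'n^'n"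
  assumes c: "c \<in> charts_at A x" and c': "c' \<in> charts_at A x'" and L: "invertible L"
  obtains U V \<tau> where "diffeo A U V \<tau>" "x' \<in> U" "\<tau> x' = x" "jac c' (pull_chart U \<tau> c) x' = L"
proof -
  note m = charts_atD[OF c] and m' = charts_atD[OF c']
  obtain L' where L': "L ** L' = mat 1" "L' ** L = mat 1" using L by (auto simp: invertible_def)
  define f where "f w = snd c x + L *v (w - snd c' x')" for w
  define g where "g w = snd c' x' + L' *v (w - snd c x)" for w
  have fg: "f (g w) = w" "g (f w) = w" for w
    by (simp_all add: f_def g_def matrix_vector_mul_assoc L')
  have s: "smooth_on UNIV f" "smooth_on UNIV g"
    unfolding f_def g_def
    by (intro smooth_on_add smooth_on_const open_UNIV smooth_on_bounded_linear[OF matrix_vector_mul_bounded_linear]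
       smooth_on_diff smooth_on_id)+
  have cont: "continuous_on UNIV f" "continuous_on UNIV g"
    using s by (auto intro: smooth_on_continuous_on)
  define U where "U = {z \<in> fst c'. snd c' z \<in> f -` (snd c ` fst c)}"
  define V where "V = {z \<in> fst c. snd c z \<in> g -` (snd c' ` fst c')}"
  define \<tau> where "\<tau> z = chart_inv c (f (snd c' z))" for z
  define \<sigma> where "\<sigma> z = chart_inv c' (g (snd c z))" for z
  have oU: "open U" unfolding U_def
    by (intro open_vimage_chart m' open_vimage open_image m cont)
  have oV: "open V" unfolding V_def
    by (intro open_vimage_chart m' open_vimage open_image m cont)
  have \<tau>: "\<tau> z \<in> V" "\<sigma> (\<tau> z) = z" "snd c (\<tau> z) = f (snd c' z)" if "z \<in> U" for z
    using that m m' by (auto simp: U_def V_def \<tau>_def \<sigma>_def chart_inv_left chart_inv_right chart_inv_mem fg)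
  have \<sigma>: "\<sigma> z \<in> U" "\<tau> (\<sigma> z) = z" "snd c' (\<sigma> z) = g (snd c z)" if "z \<in> V" for z
    using that m m' by (auto simp: U_def V_def \<tau>_def \<sigma>_def chart_inv_left chart_inv_right chart_inv_mem fg)
  have inv: "inv_into U \<tau> z = \<sigma> z" if "z \<in> V" for z
    by (metis \<sigma>(1,2) \<tau>(2) inj_onI inv_into_f_f that)
  have c\<tau>: "continuous_on U \<tau>" unfolding \<tau>_def
    by (intro continuous_on_compose2[OF chart_inv_continuous[OF m(1)]] continuous_on_compose2[OF cont(1)]
       continuous_on_subset[OF chart_continuous[OF m'(1)]]) (auto simp: U_def)
  have c\<sigma>: "continuous_on V \<sigma>" unfolding \<sigma>_def
    by (intro continuous_on_compose2[OF chart_inv_continuous[OF m'(1)]] continuous_on_compose2[OF cont(2)]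
       continuous_on_subset[OF chart_continuous[OF m(1)]]) (auto simp: V_def)
  have "homeomorphism U V \<tau> \<sigma>"
    using \<tau> \<sigma> c\<tau> c\<sigma> by (auto simp: homeomorphism_def image_iff) metis+
  then have h: "homeomorphism U V \<tau> (inv_into U \<tau>)"
    by (rule homeomorphism_cong) (auto simp: inv)
  \<comment> \<open>Stated for arbitrary charts and maps, so that it covers both \<tau> and its
    inverse.\<close>
  have smooth: "smooth_on (snd e ` {z \<in> fst e \<inter> U. \<tau> z \<in> fst d}) (\<lambda>y. snd d (chart_inv c (f (snd c' (chart_inv e y)))))
     \<and> open (snd e ` {z \<in> fst e \<inter> U. \<tau> z \<in> fst d})"
    if "e \<in> A" "d \<in> A" "c \<in> A" "c' \<in> A" "open U" "continuous_on U \<tau>" "smooth_on UNIV f"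
      "U \<subseteq> fst c'" "\<And>z. z \<in> U \<Longrightarrow> \<tau> z \<in> fst c" "\<And>z. z \<in> U \<Longrightarrow> snd c (\<tau> z) = f (snd c' z)"
    for c c' d e :: "('x,'n) chart" and U \<tau> f
  proof -
    have "open (U \<inter> \<tau> -` fst d)" by (intro continuous_open_preimage open_dom that)
    then have "open (snd e ` (fst e \<inter> (U \<inter> \<tau> -` fst d)))" by (intro open_image_Int that)
    moreover have "fst e \<inter> (U \<inter> \<tau> -` fst d) = {z \<in> fst e \<inter> U. \<tau> z \<in> fst d}" by auto
    ultimately have o: "open (snd e ` {z \<in> fst e \<inter> U. \<tau> z \<in> fst d})" by simp
    have "smooth_on (snd e ` {z \<in> fst e \<inter> U. \<tau> z \<in> fst d}) (\<lambda>y. snd c' (chart_inv e y))"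
      by (rule smooth_on_subset[OF smooth_trans]) (use that in auto)
    then have 1: "smooth_on (snd e ` {z \<in> fst e \<inter> U. \<tau> z \<in> fst d}) (\<lambda>y. f (snd c' (chart_inv e y)))"
      by (intro smooth_on_compose[OF o open_UNIV _ _ that(7)]) auto
    have "smooth_on (snd e ` {z \<in> fst e \<inter> U. \<tau> z \<in> fst d}) (\<lambda>y. snd d (chart_inv c (f (snd c' (chart_inv e y)))))"
    proof (rule smooth_on_compose[OF o _ _ 1 smooth_trans[OF that(3,2)]])
      show "open (snd c ` (fst c \<inter> fst d))" by (intro open_image_Int open_dom that)
      show "(\<lambda>y. f (snd c' (chart_inv e y))) ` snd e ` {z \<in> fst e \<inter> U. \<tau> z \<in> fst d} \<subseteq> snd c ` (fst c \<inter> fst d)"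
      proof clarsimp
        fix z assume z: "z \<in> fst e" "z \<in> U" "\<tau> z \<in> fst d"
        have "f (snd c' (chart_inv e (snd e z))) = snd c (\<tau> z)" using z that by (simp add: chart_inv_left)
        then show "f (snd c' (chart_inv e (snd e z))) \<in> snd c ` (fst c \<inter> fst d)"
          using z that(9)[of z] by blast
      qed
    qed
    then show ?thesis using o by blast
  qed
  have diff: "diffeo A U V \<tau>"
    unfolding diffeo_def
  proof (intro conjI ballI oU oV h)
    fix e d assume ed: "e \<in> A" "d \<in> A"
    have "smooth_on (snd e ` {z \<in> fst e \<inter> U. \<tau> z \<in> fst d}) (\<lambda>y. snd d (chart_inv c (f (snd c' (chart_inv e y)))))"
      by (rule smooth[THEN conjunct1]) (use ed m m' oU c\<tau> s \<tau> in \<open>auto simp: U_def V_def\<close>)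
    then show "smooth_on (snd e ` {z \<in> fst e \<inter> U. \<tau> z \<in> fst d}) (snd d \<circ> \<tau> \<circ> chart_inv e)"
      by (simp add: o_def \<tau>_def)
    have eq: "{z \<in> fst d \<inter> V. inv_into U \<tau> z \<in> fst e} = {z \<in> fst d \<inter> V. \<sigma> z \<in> fst e}"
      using inv by auto
    have *: "smooth_on (snd d ` {z \<in> fst d \<inter> V. \<sigma> z \<in> fst e}) (\<lambda>y. snd e (chart_inv c' (g (snd c (chart_inv d y)))))
      \<and> open (snd d ` {z \<in> fst d \<inter> V. \<sigma> z \<in> fst e})"
      by (rule smooth) (use ed m m' oV c\<sigma> s \<sigma> in \<open>auto simp: U_def V_def\<close>)
    have "(snd e \<circ> inv_into U \<tau> \<circ> chart_inv d) y = snd e (chart_inv c' (g (snd c (chart_inv d y))))"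
      if "y \<in> snd d ` {z \<in> fst d \<inter> V. \<sigma> z \<in> fst e}" for y
      using that ed by (auto simp: chart_inv_left inv \<sigma>_def)
    then show "smooth_on (snd d ` {z \<in> fst d \<inter> V. inv_into U \<tau> z \<in> fst e}) (snd e \<circ> inv_into U \<tau> \<circ> chart_inv d)"
      unfolding eq by (subst smooth_on_cong[OF *[THEN conjunct2]]) (use * in auto)
  qed
  have fx: "f (snd c' x') = snd c x" by (simp add: f_def)
  have xU: "x' \<in> U" using m m' fx by (auto simp: U_def)
  have \<tau>x: "\<tau> x' = x" by (simp add: \<tau>_def fx chart_inv_left m)
  have pc: "pull_chart U \<tau> c \<in> charts_at A x'"
    using pull_chart_at[OF diff xU] c \<tau>x by simp
  have "jac c' (pull_chart U \<tau> c) x' $ a $ i = L $ a $ i" for a i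
  proof -
    have "jac c' (pull_chart U \<tau> c) x' $ a $ i = pd i (\<lambda>y. f y $ a) (snd c' x')"
      unfolding jac_nth[OF c' pc]
    proof (rule pd_cong[where S="snd c' ` (fst c' \<inter> U)"])
      show "open (snd c' ` (fst c' \<inter> U))" by (intro open_image_Int m' oU)
      show "snd c' x' \<in> snd c' ` (fst c' \<inter> U)" using m' xU by blast
      fix y assume "y \<in> snd c' ` (fst c' \<inter> U)"
      then show "snd (pull_chart U \<tau> c) (chart_inv c' y) $ a = f y $ a"
        using m' \<tau>(3) by (auto simp: pull_chart_def chart_inv_left)
    qed
    also have "\<dots> = L $ a $ i"
    proof -
      have "(f has_derivative (\<lambda>v. L *v v)) (at (snd c' x'))"
        unfolding f_def
        by (auto intro!: derivative_eq_intros bounded_linear.has_derivative[OF matrix_vector_mul_bounded_linear]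
          simp: matrix_vector_mult_diff_distrib)
      from bounded_linear.has_derivative[OF bounded_linear_vec_nth this]
      have "((\<lambda>y. f y $ a) has_derivative (\<lambda>v. (L *v v) $ a)) (at (snd c' x'))" .
      then show ?thesis
        by (simp add: has_derivative_imp_pd matrix_vector_mult_def axis_def if_distrib cong: if_cong)
    qed
    finally show ?thesis .
  qed
  then have "jac c' (pull_chart U \<tau> c) x' = L" by (simp add: vec_eq_iff)
  then show thesis using that diff xU \<tau>x by blast
qed

end

subsection \<open>Symmetric matrices of a fixed signature\<close>

lemma bounded_bilinear_matrix_mult:
  "bounded_bilinear ((**) :: real^'n::finite^'m::finite \<Rightarrow> real^'p::finite^'n \<Rightarrow> real^'p^'m)"
proof -
  have "bilinear ((**) :: real^'n^'m \<Rightarrow> real^'p^'n \<Rightarrow> real^'p^'m)"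
    by (simp add: bilinear_def linear_iff vec_eq_iff matrix_matrix_mult_def sum_distrib_left
        algebra_simps sum.distrib)
  then show ?thesis by (simp add: bilinear_conv_bounded_bilinear)
qed

lemma bounded_linear_transpose:
  "bounded_linear (transpose :: real^'n::finite^'m::finite \<Rightarrow> real^'m^'n)"
  by (auto simp: linear_conv_bounded_linear[symmetric] linear_iff transpose_def vec_eq_iff)

lemmas matrix_continuous_intros =
  bounded_bilinear.continuous_on[OF bounded_bilinear_matrix_mult]
  bounded_linear.continuous_on[OF bounded_linear_transpose]

definition sign_matrix :: "'n set \<Rightarrow> real^'n^'n::finite" where
  "sign_matrix K = (\<chi> i j. if i = j then (if i \<in> K then 1 else - 1) else 0)"

definition sign_entry :: "'n set \<Rightarrow> 'n \<Rightarrow> real" where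
  "sign_entry K i = (if i \<in> K then 1 else - 1)"

lemma sign_entry_square: "sign_entry K i * sign_entry K i = 1"
  by (simp add: sign_entry_def)

lemma sign_matrix_nth: "sign_matrix K $ i $ j = (if i = j then sign_entry K i else 0)"
  by (simp add: sign_matrix_def sign_entry_def)

lemma sign_matrix_square: "sign_matrix K ** sign_matrix K = mat 1"
  by (auto simp: vec_eq_iff sign_matrix_nth matrix_matrix_mult_def mat_def sign_entry_square
      if_distrib[where f="\<lambda>x. x * y" for y] cong: if_cong)

lemma transpose_sign_matrix: "transpose (sign_matrix K) = sign_matrix K"
  by (auto simp: vec_eq_iff sign_matrix_nth transpose_def)

lemma has_signature_iff:
  "has_signature r B \<longleftrightarrow> (\<exists>(P :: real^'n^'n::finite) K. invertible P \<and> card K = r \<and> transpose P ** B ** P = sign_matrix K)"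
  by (simp add: has_signature_def sign_matrix_def)

lemma has_signatureI:
  fixes B P :: "real^'n^'n::finite"
  shows "invertible P \<Longrightarrow> card K = r \<Longrightarrow> transpose P ** B ** P = sign_matrix K \<Longrightarrow> has_signature r B"
  by (auto simp: has_signature_iff)

lemma has_signatureE:
  fixes B :: "real^'n^'n::finite"
  assumes "has_signature r B"
  obtains P :: "real^'n^'n" and K where "invertible P" "card K = r" "B = transpose P ** sign_matrix K ** P"
proof -
  obtain P :: "real^'n^'n" and K where P: "invertible P" "card K = r" "transpose P ** B ** P = sign_matrix K"
    using assms by (auto simp: has_signature_iff)
  obtain Q :: "real^'n^'n" where Q: "P ** Q = mat 1" "Q ** P = mat 1" using P by (auto simp: invertible_def)
  have Q': "transpose Q ** transpose P = mat 1"
    by (simp add: Q flip: matrix_transpose_mul)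
  have "transpose Q ** (transpose P ** B ** P) ** Q = (transpose Q ** transpose P) ** B ** (P ** Q)"
    by (simp add: matrix_mul_assoc)
  also have "\<dots> = B" by (simp add: Q Q')
  finally have "B = transpose Q ** sign_matrix K ** Q" by (simp add: P)
  moreover have "invertible Q" using Q by (auto simp: invertible_def)
  ultimately show thesis using that P by blast
qed

lemma has_signature_congruent:
  fixes B L :: "real^'n^'n::finite"
  assumes "has_signature r B" "invertible L"
  shows "has_signature r (transpose L ** B ** L)"
proof -
  obtain P :: "real^'n^'n" and K where P: "invertible P" "card K = r" "transpose P ** B ** P = sign_matrix K"
    using assms by (auto simp: has_signature_iff)
  obtain M :: "real^'n^'n" where M: "L ** M = mat 1" "M ** L = mat 1" using assms by (auto simp: invertible_def)
  have M': "transpose M ** transpose L = mat 1" by (simp add: M flip: matrix_transpose_mul)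
  have "transpose (M ** P) ** (transpose L ** B ** L) ** (M ** P) =
    transpose P ** (transpose M ** transpose L) ** B ** (L ** M) ** P"
    by (simp add: matrix_transpose_mul matrix_mul_assoc)
  also have "\<dots> = sign_matrix K" by (simp add: M M' P)
  finally show ?thesis
    using P M invertible_mult[of M P] by (intro has_signatureI[of "M ** P" K]) (auto simp: invertible_def[of M])
qed

lemma has_signature_symmetric: "has_signature r B \<Longrightarrow> transpose B = B"
  by (erule has_signatureE) (simp add: matrix_transpose_mul transpose_sign_matrix matrix_mul_assoc del: transpose_iff)

lemma has_signature_invertible: "has_signature r B \<Longrightarrow> invertible B"
proof (erule has_signatureE)
  fix P :: "real^'a^'a" and K assume P: "invertible P" "B = transpose P ** sign_matrix K ** P"
  have "invertible (sign_matrix K)" using sign_matrix_square[of K] by (auto simp: invertible_def)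
  then show "invertible B" unfolding P(2) using P(1) by (intro invertible_mult transpose_invertible)
qed

text \<open>The witness is the matrix of a permutation \<pi> that carries K' onto K, glued from a
  bijection of the two sets and one of their complements.\<close>

lemma sign_matrix_congruent:
  assumes "card K = card (K' :: 'n::finite set)"
  obtains L :: "real^'n^'n" where "invertible L" "sign_matrix K' = transpose L ** sign_matrix K ** L"
proof -
  have f: "finite S" for S :: "'n set" by simp
  obtain f where f: "bij_betw f K' K" using finite_same_card_bij[OF f f] assms by metis
  have "card (- K') = card (- K)" using assms by (simp add: Compl_eq_Diff_UNIV card_Diff_subset)
  then obtain g where g: "bij_betw g (- K') (- K)"
    using finite_same_card_bij[of "-K'" "-K"] by auto
  define \<pi> where "\<pi> i = (if i \<in> K' then f i else g i)" for i
  have \<pi>K: "\<pi> i \<in> K \<longleftrightarrow> i \<in> K'" for i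
    using f g by (auto simp: \<pi>_def bij_betw_def)
  have \<pi>: "\<pi> i = \<pi> j \<longleftrightarrow> i = j" for i j
  proof
    assume *: "\<pi> i = \<pi> j"
    then have "i \<in> K' \<longleftrightarrow> j \<in> K'" using \<pi>K by metis
    then show "i = j" using * f g by (cases "i \<in> K'") (auto simp: \<pi>_def bij_betw_def dest: inj_onD)
  qed simp
  define L :: "real^'n^'n" where "L = (\<chi> i j. if i = \<pi> j then 1 else 0)"
  have "sign_matrix K' = transpose L ** sign_matrix K ** L"
    using \<pi>K by (auto simp: vec_eq_iff L_def matrix_matrix_mult_def transpose_def sign_matrix_nth sign_entry_def[of _ "\<pi> i" for i] sign_entry_def
        if_distrib[where f="\<lambda>x. x * y" for y] if_distrib[where f="\<lambda>x. y * x" for y] \<pi> cong: if_cong)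
  moreover have "transpose L ** L = mat 1"
    by (auto simp: vec_eq_iff L_def matrix_matrix_mult_def transpose_def mat_def
        if_distrib[where f="\<lambda>x. x * y" for y] \<pi> cong: if_cong)
  then have "invertible L" using invertible_left_inverse by blast
  ultimately show thesis using that by blast
qed

lemma same_signature_congruent:
  fixes B B' :: "real^'n^'n::finite"
  assumes "has_signature r B" "has_signature r B'"
  obtains L :: "real^'n^'n" where "invertible L" "B' = transpose L ** B ** L"
proof -
  obtain P :: "real^'n^'n" and K where P: "invertible P" "card K = r" "transpose P ** B ** P = sign_matrix K"
    using assms by (auto simp: has_signature_iff)
  obtain P' :: "real^'n^'n" and K' where P': "invertible P'" "card K' = r" "B' = transpose P' ** sign_matrix K' ** P'"
    using assms by (auto elim: has_signatureE)
  obtain L :: "real^'n^'n" where L: "invertible L" "sign_matrix K' = transpose L ** sign_matrix K ** L"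
    using sign_matrix_congruent P P' by metis
  have "B' = transpose (P ** L ** P') ** B ** (P ** L ** P')"
    unfolding P'(3) L(2) P(3)[symmetric] by (simp add: matrix_transpose_mul matrix_mul_assoc)
  moreover have "invertible (P ** L ** P')" using P P' L by (simp add: invertible_mult)
  ultimately show thesis using that by blast
qed

lemma matrix_square_root:
  fixes W :: "(real^'n^'n::finite) set"
  assumes "open W" "mat 1 \<in> W"
  obtains U V where "open V" "mat 1 \<in> V" "U \<subseteq> W" "inj_on (\<lambda>R. R ** R) U"
    "\<And>Z. Z \<in> V \<Longrightarrow> \<exists>R\<in>U. R ** R = Z" "open U" "mat 1 \<in> U"
proof -
  let ?f = "\<lambda>R :: real^'n^'n. R ** R"
  define f' where "f' R = Blinfun (\<lambda>H :: real^'n^'n. R ** H + H ** R)" for R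
  have bl: "bounded_linear (\<lambda>H :: real^'n^'n. R ** H + H ** R)" for R
    by (intro bounded_linear_add bounded_bilinear.bounded_linear_right[OF bounded_bilinear_matrix_mult]
       bounded_bilinear.bounded_linear_left[OF bounded_bilinear_matrix_mult])
  have f'_apply: "blinfun_apply (f' R) = (\<lambda>H. R ** H + H ** R)" for R
    unfolding f'_def by (rule bounded_linear_Blinfun_apply[OF bl])
  have D: "(?f has_derivative blinfun_apply (f' R)) (at R)" for R
    unfolding f'_apply
    by (rule bounded_bilinear.FDERIV[OF bounded_bilinear_matrix_mult]) (auto intro: derivative_intros)
  have cont: "continuous_on W f'"
    by (rule continuous_on_blinfun_componentwise)
      (auto simp: f'_apply intro!: continuous_intros matrix_continuous_intros)
  \<comment> \<open>At the identity the derivative of squaring is doubling, which is inverted by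
    1/2.\<close>
  have inv: "((1/2) *\<^sub>R (id_blinfun :: (real^'n^'n) \<Rightarrow>\<^sub>L (real^'n^'n))) o\<^sub>L f' (mat 1) = id_blinfun"
    by (rule blinfun_eqI) (simp add: f'_apply blinfun.scaleR_left scaleR_2[symmetric])
  obtain U V g where U: "open U" "U \<subseteq> W" "mat 1 \<in> U" "open V" "mat 1 \<in> V" "homeomorphism U V ?f g"
  proof (rule inverse_function_theorem[OF assms(1) D cont assms(2) inv])
    fix U V g assume "open U" "U \<subseteq> W" "mat 1 \<in> U" "open V" "mat 1 ** mat 1 \<in> V" "homeomorphism U V ?f g"
    then show thesis using that[of U V g] by simp
  qed
  show thesis
  proof
    show "inj_on ?f U" using U(6) by (intro inj_on_inverseI[of _ g]) (simp add: homeomorphism_def)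
    show "\<exists>R\<in>U. R ** R = Z" if "Z \<in> V" for Z
      using U(6) that by (intro bexI[of _ "g Z"]) (auto simp: homeomorphism_def)
  qed (use U in auto)
qed

text \<open>A symmetric \<open>S\<close> near \<open>D = sign_matrix K\<close> is \<open>transpose R ** D ** R\<close> for the square root \<open>R\<close> of
  \<open>D ** S\<close> near the identity: \<open>D ** transpose R ** D\<close> is another such square root, hence equals \<open>R\<close>.\<close>

lemma has_signature_open:
  fixes B :: "real^'n^'n::finite"
  assumes "has_signature r B"
  obtains N where "open N" "B \<in> N" "\<And>B'. B' \<in> N \<Longrightarrow> transpose B' = B' \<Longrightarrow> has_signature r B'"
proof -
  obtain P :: "real^'n^'n" and K where P: "invertible P" "card K = r" "transpose P ** B ** P = sign_matrix K"
    using assms by (auto simp: has_signature_iff)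
  define D where "D = sign_matrix K"
  have D: "D ** D = mat 1" "transpose D = D" by (simp_all add: D_def sign_matrix_square transpose_sign_matrix)
  have o1: "open ((\<lambda>R :: real^'n^'n. det R) -` (- {0}))"
    by (intro open_vimage open_Compl smooth_on_continuous_on smooth_on_det smooth_on_id) auto
  have m1: "(mat 1 :: real^'n^'n) \<in> (\<lambda>R. det R) -` (- {0})" by (simp add: det_I)
  obtain U0 V0 where 0: "open V0" "mat 1 \<in> V0" "U0 \<subseteq> (\<lambda>R :: real^'n^'n. det R) -` (- {0})" "inj_on (\<lambda>R. R ** R) U0"
    "\<And>Z. Z \<in> V0 \<Longrightarrow> \<exists>R\<in>U0. R ** R = Z" "open U0" "mat 1 \<in> U0"
    by (rule matrix_square_root[OF o1 m1]) blast
  \<comment> \<open>Both R and the other square root \<open>?t R\<close> have to lie in U0, where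
    squaring is injective. Hence a second use of \<open>matrix_square_root\<close>, inside the set
    of those R for which both do.\<close>
  let ?t = "\<lambda>R. D ** transpose R ** D"
  have o2: "open (U0 \<inter> ?t -` U0)"
    by (intro open_Int open_vimage 0 matrix_continuous_intros continuous_intros)
  have m2: "mat 1 \<in> U0 \<inter> ?t -` U0" using 0 D by (simp add: transpose_mat)
  obtain U V where U: "open V" "mat 1 \<in> V" "U \<subseteq> U0 \<inter> ?t -` U0" "inj_on (\<lambda>R. R ** R) U"
    "\<And>Z. Z \<in> V \<Longrightarrow> \<exists>R\<in>U. R ** R = Z"
    by (rule matrix_square_root[OF o2 m2]) blast
  let ?Z = "\<lambda>B'. D ** (transpose P ** B' ** P)"
  show thesis
  proof
    show "open (?Z -` V)"
      by (intro open_vimage U matrix_continuous_intros continuous_intros)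
    show "B \<in> ?Z -` V" using U D by (simp add: P D_def[symmetric])
    fix B' assume B': "B' \<in> ?Z -` V" "transpose B' = B'"
    define S where "S = transpose P ** B' ** P"
    have S: "transpose S = S" by (simp add: S_def matrix_transpose_mul B' matrix_mul_assoc)
    obtain R where R: "R \<in> U" "R ** R = D ** S" using U(5)[of "D ** S"] B' by (auto simp: S_def)
    have "?t R ** ?t R = D ** transpose R ** (D ** D) ** transpose R ** D" by (simp add: matrix_mul_assoc)
    also have "\<dots> = D ** transpose (R ** R) ** D" unfolding D by (simp add: matrix_transpose_mul matrix_mul_assoc)
    also have "\<dots> = D ** S ** (D ** D)" unfolding R(2) by (simp add: matrix_transpose_mul S D(2) matrix_mul_assoc)
    also have "\<dots> = R ** R" unfolding D R by simp
    finally have sq: "?t R ** ?t R = R ** R" .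
    have "R \<in> U0" "?t R \<in> U0" using R(1) U(3) by auto
    then have tR: "?t R = R" using inj_onD[OF 0(4) sq] by blast
    have "D ** R = D ** ?t R" unfolding tR ..
    also have "\<dots> = (D ** D) ** transpose R ** D" by (simp add: matrix_mul_assoc)
    finally have DR: "D ** R = transpose R ** D" by (simp add: D)
    have "transpose R ** D ** R = D ** (R ** R)" by (simp add: DR[symmetric] matrix_mul_assoc)
    also have "\<dots> = (D ** D) ** S" by (simp add: R matrix_mul_assoc)
    finally have "transpose R ** sign_matrix K ** R = S" by (simp add: D D_def[symmetric])
    moreover have "invertible R" using \<open>R \<in> U0\<close> 0(3) by (auto simp: invertible_det_nz)
    moreover have "has_signature r (sign_matrix K)"
      using P(2) by (intro has_signatureI[of "mat 1"]) (auto simp: transpose_mat invertible_def intro: exI[of _ "mat 1"])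
    ultimately have sS: "has_signature r S" using has_signature_congruent by metis
    obtain Q :: "real^'n^'n" where Q: "P ** Q = mat 1" "Q ** P = mat 1" using P by (auto simp: invertible_def)
    have Q': "transpose Q ** transpose P = mat 1" by (simp add: Q flip: matrix_transpose_mul)
    have "transpose Q ** S ** Q = (transpose Q ** transpose P) ** B' ** (P ** Q)"
      by (simp add: S_def matrix_mul_assoc)
    then have "B' = transpose Q ** S ** Q" by (simp add: Q Q')
    moreover have "invertible Q" using Q by (auto simp: invertible_def)
    ultimately show "has_signature r B'" using has_signature_congruent sS by metis
  qed
qed

subsection \<open>The linear action on tensors\<close>

lemma lists_length_Suc: "{I. length I = Suc k} = (\<lambda>(i, I). i # I) ` (UNIV \<times> {I. length I = k})"
  by (auto simp: length_Suc_conv image_iff)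

lemma finite_lists_length [simp]: "finite {I :: 'n::finite list. length I = k}"
  using finite_lists_length_eq[of "UNIV :: 'n set" k] by simp

lemma sum_lists_Suc:
  fixes F :: "'n::finite list \<Rightarrow> 'b::comm_monoid_add"
  shows "(\<Sum>I\<in>{I. length I = Suc k}. F I) = (\<Sum>i\<in>UNIV. \<Sum>I\<in>{I. length I = k}. F (i # I))"
proof -
  have "inj_on (\<lambda>(i, I). i # I) (UNIV \<times> {I :: 'n list. length I = k})" by (auto simp: inj_on_def)
  then show ?thesis
    unfolding lists_length_Suc by (simp add: sum.reindex sum.cartesian_product case_prod_beta')
qed

lemma lin_act_0: "lin_act 0 Q t J = t []"
  by (simp add: lin_act_def)

lemma lin_act_Suc:
  "lin_act (Suc k) Q t (j # J) = (\<Sum>i\<in>UNIV. Q $ j $ i * lin_act k Q (\<lambda>I. t (i # I)) J)"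
  unfolding lin_act_def sum_lists_Suc
  by (simp add: prod.lessThan_Suc_shift sum_distrib_left mult.assoc del: prod.lessThan_Suc)

lemma lin_act_cong:
  "(\<And>I. length I = k \<Longrightarrow> t I = t' I) \<Longrightarrow> lin_act k Q t J = lin_act k Q t' J"
  unfolding lin_act_def by (rule sum.cong) auto

lemma lin_act_sum:
  "lin_act k Q (\<lambda>I. \<Sum>i\<in>S. c i * t i I) J = (\<Sum>i\<in>S. c i * lin_act k Q (t i) J)"
proof -
  have "lin_act k Q (\<lambda>I. \<Sum>i\<in>S. c i * t i I) J =
    (\<Sum>I\<in>{I. length I = k}. \<Sum>i\<in>S. (\<Prod>r<k. Q $ (J ! r) $ (I ! r)) * (c i * t i I))"
    by (simp add: lin_act_def sum_distrib_left)
  also have "\<dots> = (\<Sum>i\<in>S. c i * lin_act k Q (t i) J)"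
    unfolding lin_act_def sum_distrib_left by (subst sum.swap) (simp add: mult_ac)
  finally show ?thesis .
qed

lemma lin_act_mult:
  "length J = k \<Longrightarrow> lin_act k P (lin_act k Q t) J = lin_act k (P ** Q) t J"
proof (induction k arbitrary: t J)
  case 0
  then show ?case by (simp add: lin_act_0)
next
  case (Suc k)
  then obtain j J' where J: "J = j # J'" "length J' = k" by (auto simp: length_Suc_conv)
  have "lin_act (Suc k) P (lin_act (Suc k) Q t) J =
    (\<Sum>i\<in>UNIV. P $ j $ i * lin_act k P (\<lambda>I. \<Sum>l\<in>UNIV. Q $ i $ l * lin_act k Q (\<lambda>I. t (l # I)) I) J')"
    by (simp add: J lin_act_Suc)
  also have "\<dots> = (\<Sum>i\<in>UNIV. P $ j $ i * (\<Sum>l\<in>UNIV. Q $ i $ l * lin_act k (P ** Q) (\<lambda>I. t (l # I)) J'))"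
    unfolding lin_act_sum by (simp add: Suc.IH J)
  also have "\<dots> = (\<Sum>l\<in>UNIV. \<Sum>i\<in>UNIV. P $ j $ i * (Q $ i $ l * lin_act k (P ** Q) (\<lambda>I. t (l # I)) J'))"
    unfolding sum_distrib_left by (rule sum.swap)
  also have "\<dots> = lin_act (Suc k) (P ** Q) t J"
    by (simp add: J lin_act_Suc matrix_matrix_mult_def sum_distrib_right mult.assoc)
  finally show ?case .
qed

lemma lin_act_id: "length J = k \<Longrightarrow> lin_act k (mat 1) t J = t J"
proof (induction k arbitrary: t J)
  case 0
  then show ?case by (simp add: lin_act_0)
next
  case (Suc k)
  then obtain j J' where J: "J = j # J'" "length J' = k" by (auto simp: length_Suc_conv)
  then show ?case
    using Suc.IH by (simp add: lin_act_Suc mat_def if_distrib[where f="\<lambda>x. x * y" for y] cong: if_cong)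
qed

lemma lin_act_append:
  "length J = k \<Longrightarrow> lin_act (k + l) Q t (J @ J') = lin_act k Q (\<lambda>I. lin_act l Q (\<lambda>I'. t (I @ I')) J') J"
proof (induction k arbitrary: t J)
  case 0
  then show ?case by (simp add: lin_act_0)
next
  case (Suc k)
  then obtain j J0 where J: "J = j # J0" "length J0 = k" by (auto simp: length_Suc_conv)
  then show ?case using Suc.IH[of J0] by (simp add: lin_act_Suc)
qed

lemma lin_act_4:
  "lin_act 4 Q t [a, b, e, f] = (\<Sum>i\<in>UNIV. \<Sum>j\<in>UNIV. \<Sum>k\<in>UNIV. \<Sum>l\<in>UNIV.
     Q $ a $ i * Q $ b $ j * Q $ e $ k * Q $ f $ l * t [i, j, k, l])"
  by (simp add: numeral_eq_Suc lin_act_Suc lin_act_0 sum_distrib_left mult.assoc)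

lemma length_4E:
  assumes "length I = 4"
  obtains a b e f where "I = [a, b, e, f]"
  using assms by (auto simp: numeral_eq_Suc length_Suc_conv)

subsection \<open>Functions vanishing to second order\<close>

lemma smooth_pd2_add:
  assumes "open S" "smooth_on S f" "smooth_on S g" "y \<in> S"
  shows "pd k (\<lambda>x. f x + g x) y = pd k f y + pd k g y"
    "pd l (pd k (\<lambda>x. f x + g x)) y = pd l (pd k f) y + pd l (pd k g) y"
proof -
  have 1: "pd k (\<lambda>x. f x + g x) z = pd k f z + pd k g z" if "z \<in> S" for z
    using assms that smooth_on_differentiable by (intro pd_add) auto
  then show "pd k (\<lambda>x. f x + g x) y = pd k f y + pd k g y" using assms by blast
  have "pd l (pd k (\<lambda>x. f x + g x)) y = pd l (\<lambda>z. pd k f z + pd k g z) y"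
    using 1 by (intro pd_cong[OF assms(1,4)])
  then show "pd l (pd k (\<lambda>x. f x + g x)) y = pd l (pd k f) y + pd l (pd k g) y"
    using assms by (simp add: pd_add smooth_on_differentiable[OF smooth_on_pd])
qed

lemma smooth_pd2_sum:
  fixes f :: "'i \<Rightarrow> real^'n::finite \<Rightarrow> real"
  assumes "open S" "\<And>i. i \<in> I \<Longrightarrow> smooth_on S (f i)" "y \<in> S"
  shows "pd l (pd k (\<lambda>x. \<Sum>i\<in>I. f i x)) y = (\<Sum>i\<in>I. pd l (pd k (f i)) y)"
proof -
  have "pd l (pd k (\<lambda>x. \<Sum>i\<in>I. f i x)) y = pd l (\<lambda>z. \<Sum>i\<in>I. pd k (f i) z) y"
    using assms by (intro pd_cong[OF assms(1,3)] pd_sum) (auto intro: smooth_on_differentiable)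
  also have "\<dots> = (\<Sum>i\<in>I. pd l (pd k (f i)) y)"
    using assms by (intro pd_sum) (auto intro!: smooth_on_differentiable[OF smooth_on_pd])
  finally show ?thesis .
qed

lemma smooth_pd2_mult:
  fixes f g :: "real^'n::finite \<Rightarrow> real"
  assumes "open S" "smooth_on S f" "smooth_on S g" "y \<in> S"
  shows "pd l (pd k (\<lambda>x. f x * g x)) y =
    f y * pd l (pd k g) y + pd l f y * pd k g y + pd k f y * pd l g y + pd l (pd k f) y * g y"
proof -
  have d: "f differentiable at y" "g differentiable at y" "pd k f differentiable at y" "pd k g differentiable at y"
    using assms by (auto intro: smooth_on_differentiable smooth_on_differentiable[OF smooth_on_pd])
  have "pd l (pd k (\<lambda>x. f x * g x)) y = pd l (\<lambda>z. f z * pd k g z + pd k f z * g z) y"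
    using assms by (intro pd_cong[OF assms(1,4)] pd_mult) (auto intro: smooth_on_differentiable)
  then show ?thesis by (simp add: d pd_add pd_mult differentiable_mult)
qed

text \<open>The condition that the 1-jet of u at y is zero. Second derivatives of such functions
  transform like tensors: under products and changes of variables, all terms with derivatives of the
  factors or of the Jacobian drop out. This underlies the affine structure on the fibres of the
  2-jets.\<close>

definition vanishes2 :: "(real^'n::finite \<Rightarrow> real) \<Rightarrow> real^'n \<Rightarrow> bool" where
  "vanishes2 u y \<longleftrightarrow> u y = 0 \<and> (\<forall>k. pd k u y = 0)"

lemma vanishes2_mult:
  assumes "open S" "smooth_on S f" "smooth_on S u" "y \<in> S" "vanishes2 u y"
  shows "vanishes2 (\<lambda>x. f x * u x) y" "pd l (pd k (\<lambda>x. f x * u x)) y = f y * pd l (pd k u) y"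
proof -
  have "f differentiable at y" "u differentiable at y" using assms by (auto intro: smooth_on_differentiable)
  then show "vanishes2 (\<lambda>x. f x * u x) y"
    using assms(5) by (simp add: vanishes2_def pd_mult)
  show "pd l (pd k (\<lambda>x. f x * u x)) y = f y * pd l (pd k u) y"
    using assms(5) by (simp add: smooth_pd2_mult[OF assms(1-4)] vanishes2_def)
qed

lemma vanishes2_sum:
  assumes "open S" "\<And>i. i \<in> I \<Longrightarrow> smooth_on S (f i)" "y \<in> S" "\<And>i. i \<in> I \<Longrightarrow> vanishes2 (f i) y"
  shows "vanishes2 (\<lambda>x. \<Sum>i\<in>I. f i x) y"
proof -
  have "pd k (\<lambda>x. \<Sum>i\<in>I. f i x) y = (\<Sum>i\<in>I. pd k (f i) y)" for k
    using assms by (intro pd_sum) (auto intro: smooth_on_differentiable)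
  then show ?thesis using assms(4) by (simp add: vanishes2_def)
qed

lemma vanishes2_compose:
  fixes \<tau> :: "real^'n::finite \<Rightarrow> real^'m::finite"
  assumes S: "open S" "smooth_on S \<tau>" "y \<in> S" and T: "open T" "smooth_on T u" "\<tau> ` S \<subseteq> T"
    and v: "vanishes2 u (\<tau> y)"
  shows "vanishes2 (\<lambda>x. u (\<tau> x)) y"
    "pd l (pd k (\<lambda>x. u (\<tau> x))) y =
      (\<Sum>e\<in>UNIV. \<Sum>f\<in>UNIV. pd f (pd e u) (\<tau> y) * pd k (\<lambda>x. \<tau> x $ e) y * pd l (\<lambda>x. \<tau> x $ f) y)"
proof -
  have 1: "pd k (\<lambda>x. F (\<tau> x)) z = (\<Sum>e\<in>UNIV. pd e F (\<tau> z) * pd k (\<lambda>x. \<tau> x $ e) z)"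
    if "z \<in> S" "smooth_on T F" for z k F
    using S T that by (intro pd_compose) (auto intro: smooth_on_differentiable)
  show "vanishes2 (\<lambda>x. u (\<tau> x)) y" using v S(3) T(2) by (simp add: vanishes2_def 1)
  have s: "smooth_on S (\<lambda>z. pd e u (\<tau> z))" for e
    using smooth_on_compose[OF S(1) T(1,3) S(2) smooth_on_pd[OF T(2)]] .
  have s': "smooth_on S (pd k (\<lambda>x. \<tau> x $ e))" for e k
    by (intro smooth_on_pd smooth_on_vec_nth S)
  have "pd l (pd k (\<lambda>x. u (\<tau> x))) y = pd l (\<lambda>z. \<Sum>e\<in>UNIV. pd e u (\<tau> z) * pd k (\<lambda>x. \<tau> x $ e) z) y"
    using 1 T(2) by (intro pd_cong[OF S(1,3)]) auto
  also have "\<dots> = (\<Sum>e\<in>UNIV. pd l (\<lambda>z. pd e u (\<tau> z) * pd k (\<lambda>x. \<tau> x $ e) z) y)"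
    by (intro pd_sum smooth_on_differentiable[OF smooth_on_mult S(3)] S s s')
  also have "\<dots> = (\<Sum>e\<in>UNIV. pd l (\<lambda>z. pd e u (\<tau> z)) y * pd k (\<lambda>x. \<tau> x $ e) y)"
  proof (rule sum.cong)
    fix e
    have "pd l (\<lambda>z. pd e u (\<tau> z) * pd k (\<lambda>x. \<tau> x $ e) z) y =
      pd e u (\<tau> y) * pd l (pd k (\<lambda>x. \<tau> x $ e)) y + pd l (\<lambda>z. pd e u (\<tau> z)) y * pd k (\<lambda>x. \<tau> x $ e) y"
      by (intro pd_mult smooth_on_differentiable[OF s S(3)] smooth_on_differentiable[OF s' S(3)])
    then show "pd l (\<lambda>z. pd e u (\<tau> z) * pd k (\<lambda>x. \<tau> x $ e) z) y =
      pd l (\<lambda>z. pd e u (\<tau> z)) y * pd k (\<lambda>x. \<tau> x $ e) y"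
      using v by (simp add: vanishes2_def)
  qed simp
  also have "\<dots> = (\<Sum>e\<in>UNIV. \<Sum>f\<in>UNIV. pd f (pd e u) (\<tau> y) * pd k (\<lambda>x. \<tau> x $ e) y * pd l (\<lambda>x. \<tau> x $ f) y)"
    by (simp add: 1[OF S(3) smooth_on_pd[OF T(2)]] sum_distrib_right sum_distrib_left mult_ac)
  finally show "pd l (pd k (\<lambda>x. u (\<tau> x))) y =
      (\<Sum>e\<in>UNIV. \<Sum>f\<in>UNIV. pd f (pd e u) (\<tau> y) * pd k (\<lambda>x. \<tau> x $ e) y * pd l (\<lambda>x. \<tau> x $ f) y)" .
qed

text \<open>The factor 1/2 here and 1/6 in \<open>cubic\<close> make symmetric coefficients equal to
  the second and third partial derivatives respectively.\<close>

definition quad :: "('n::finite \<Rightarrow> 'n \<Rightarrow> real) \<Rightarrow> real^'n \<Rightarrow> real^'n \<Rightarrow> real" where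
  "quad h z0 z = (\<Sum>k\<in>UNIV. \<Sum>l\<in>UNIV. h k l * (z - z0) $ k * (z - z0) $ l) / 2"

definition cubic :: "('n::finite \<Rightarrow> 'n \<Rightarrow> 'n \<Rightarrow> real) \<Rightarrow> real^'n \<Rightarrow> real^'n \<Rightarrow> real" where
  "cubic u z0 z = (\<Sum>k\<in>UNIV. \<Sum>l\<in>UNIV. \<Sum>m\<in>UNIV. u k l m * (z - z0) $ k * (z - z0) $ l * (z - z0) $ m) / 6"

lemma smooth_quad: "open S \<Longrightarrow> smooth_on S (quad h z0)"
  unfolding quad_def divide_inverse
  by (intro smooth_on_mult smooth_on_sum smooth_on_const smooth_on_vec_nth smooth_on_diff smooth_on_id)

lemma smooth_cubic: "open S \<Longrightarrow> smooth_on S (cubic u z0)"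
  unfolding cubic_def divide_inverse
  by (intro smooth_on_mult smooth_on_sum smooth_on_const smooth_on_vec_nth smooth_on_diff smooth_on_id)

lemma has_derivative_diff_nth:
  "((\<lambda>z. (z - z0) $ k) has_derivative (\<lambda>v. v $ k)) (at (z :: real^'n::finite))"
  by (intro bounded_linear.has_derivative[OF bounded_linear_vec_nth]) (auto intro!: derivative_eq_intros)

lemma pd_linear:
  fixes h :: "'n::finite \<Rightarrow> real"
  shows "pd k (\<lambda>z. \<Sum>l\<in>UNIV. h l * (z - z0) $ l) z = h k"
proof -
  have "((\<lambda>z. \<Sum>l\<in>UNIV. h l * (z - z0) $ l) has_derivative (\<lambda>v. \<Sum>l\<in>UNIV. h l * v $ l)) (at z)"
    by (intro has_derivative_sum has_derivative_mult_right has_derivative_diff_nth)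
  then show ?thesis by (simp add: has_derivative_imp_pd axis_def if_distrib cong: if_cong)
qed

lemma pd_quad:
  assumes "\<And>k l. h k l = h l k"
  shows "pd k (quad h z0) z = (\<Sum>l\<in>UNIV. h k l * (z - z0) $ l)"
proof -
  have "(quad h z0 has_derivative (\<lambda>v. (\<Sum>k\<in>UNIV. \<Sum>l\<in>UNIV.
     (h k l * (z - z0) $ k) * v $ l + (h k l * v $ k) * (z - z0) $ l) / 2)) (at z)"
    unfolding quad_def divide_inverse
    by (intro has_derivative_mult_left has_derivative_sum has_derivative_mult has_derivative_diff_nth
       has_derivative_mult_right)
  then have "pd k (quad h z0) z = ((\<Sum>a\<in>UNIV. h a k * (z - z0) $ a) + (\<Sum>l\<in>UNIV. h k l * (z - z0) $ l)) / 2"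
    by (simp add: has_derivative_imp_pd axis_def if_distrib[where f="\<lambda>x. y * x" for y]
       if_distrib[where f="\<lambda>x. x * y" for y] sum.distrib sum.delta' cong: if_cong)
      (simp add: sum.swap[of "\<lambda>a b. if a = k then _ a b else 0"] sum.delta cong: if_cong)
  then show ?thesis using assms by simp
qed

lemma pd2_quad:
  assumes "\<And>k l. h k l = h l k"
  shows "pd l (pd k (quad h z0)) z = h k l"
  using pd_linear[of l "h k" z0 z] by (simp add: pd_quad[OF assms] cong: pd_cong[OF open_UNIV])

lemma quad_0: "quad h z0 z0 = 0" "(\<And>k l. h k l = h l k) \<Longrightarrow> pd k (quad h z0) z0 = 0"
  by (simp_all add: quad_def pd_quad)

lemma pd_cubic:
  assumes "\<And>k l m. u k l m = u l k m" "\<And>k l m. u k l m = u k m l"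
  shows "pd k (cubic u z0) z = quad (u k) z0 z"
proof -
  define w where "w = z - z0"
  have "(cubic u z0 has_derivative (\<lambda>v. (\<Sum>k\<in>UNIV. \<Sum>l\<in>UNIV. \<Sum>m\<in>UNIV.
     (u k l m * (z - z0) $ k * (z - z0) $ l) * v $ m +
     ((u k l m * (z - z0) $ k) * v $ l + (u k l m * v $ k) * (z - z0) $ l) * (z - z0) $ m) / 6)) (at z)"
    unfolding cubic_def divide_inverse
    by (intro has_derivative_mult_left has_derivative_sum has_derivative_mult has_derivative_diff_nth
       has_derivative_mult_right)
  then have "pd k (cubic u z0) z = (\<Sum>a\<in>UNIV. \<Sum>b\<in>UNIV. \<Sum>c\<in>UNIV.
     (u a b c * w $ a * w $ b) * axis k 1 $ c +
     (u a b c * w $ a) * axis k 1 $ b * w $ c + (u a b c * axis k 1 $ a) * w $ b * w $ c) / 6"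
    by (simp add: has_derivative_imp_pd w_def algebra_simps)
  \<comment> \<open>Split according to which of the three factors is differentiated. By symmetry of
    u the three sums agree, and 3/6 is the factor 1/2 of \<open>quad\<close>.\<close>
  also have "\<dots> = ((\<Sum>a\<in>UNIV. \<Sum>b\<in>UNIV. \<Sum>c\<in>UNIV. (u a b c * w $ a * w $ b) * axis k 1 $ c) +
     (\<Sum>a\<in>UNIV. \<Sum>b\<in>UNIV. \<Sum>c\<in>UNIV. (u a b c * w $ a) * axis k 1 $ b * w $ c) +
     (\<Sum>a\<in>UNIV. \<Sum>b\<in>UNIV. \<Sum>c\<in>UNIV. (u a b c * axis k 1 $ a) * w $ b * w $ c)) / 6"
    by (simp add: sum.distrib)
  also have "(\<Sum>a\<in>UNIV. \<Sum>b\<in>UNIV. \<Sum>c\<in>UNIV. (u a b c * w $ a * w $ b) * axis k 1 $ c) =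
    (\<Sum>a\<in>UNIV. \<Sum>b\<in>UNIV. u k a b * w $ a * w $ b)"
    using assms by (simp add: axis_def if_distrib[where f="\<lambda>x. y * x" for y] cong: if_cong)
  also have "(\<Sum>a\<in>UNIV. \<Sum>b\<in>UNIV. \<Sum>c\<in>UNIV. (u a b c * w $ a) * axis k 1 $ b * w $ c) =
    (\<Sum>a\<in>UNIV. \<Sum>c\<in>UNIV. \<Sum>b\<in>UNIV. (u a b c * w $ a) * axis k 1 $ b * w $ c)"
    by (intro sum.cong refl sum.swap)
  also have "\<dots> = (\<Sum>a\<in>UNIV. \<Sum>b\<in>UNIV. u k a b * w $ a * w $ b)"
    using assms(1) by (simp add: axis_def if_distrib[where f="\<lambda>x. y * x" for y]
      if_distrib[where f="\<lambda>x. x * y" for y] cong: if_cong)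
  also have "(\<Sum>a\<in>UNIV. \<Sum>b\<in>UNIV. \<Sum>c\<in>UNIV. (u a b c * axis k 1 $ a) * w $ b * w $ c) =
    (\<Sum>b\<in>UNIV. \<Sum>a\<in>UNIV. \<Sum>c\<in>UNIV. (u a b c * axis k 1 $ a) * w $ b * w $ c)"
    by (rule sum.swap)
  also have "\<dots> = (\<Sum>b\<in>UNIV. \<Sum>c\<in>UNIV. \<Sum>a\<in>UNIV. (u a b c * axis k 1 $ a) * w $ b * w $ c)"
    by (intro sum.cong refl sum.swap)
  also have "\<dots> = (\<Sum>a\<in>UNIV. \<Sum>b\<in>UNIV. u k a b * w $ a * w $ b)"
    by (simp add: axis_def if_distrib[where f="\<lambda>x. y * x" for y]
      if_distrib[where f="\<lambda>x. x * y" for y] cong: if_cong)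
  finally show ?thesis by (simp add: quad_def w_def)
qed

lemma cubic_0:
  assumes "\<And>k l m. u k l m = u l k m" "\<And>k l m. u k l m = u k m l"
  shows "cubic u z0 z0 = 0" "pd k (cubic u z0) z0 = 0" "pd l (pd k (cubic u z0)) z0 = 0"
    "pd m (pd l (pd k (cubic u z0))) z = u k l m"
proof -
  have e: "pd k (cubic u z0) = quad (u k) z0" for k by (intro ext pd_cubic assms)
  show "cubic u z0 z0 = 0" by (simp add: cubic_def)
  show "pd k (cubic u z0) z0 = 0" by (simp add: e quad_0)
  show "pd l (pd k (cubic u z0)) z0 = 0" unfolding e by (rule quad_0) (rule assms)
  show "pd m (pd l (pd k (cubic u z0))) z = u k l m" unfolding e by (rule pd2_quad) (rule assms)
qed

declare split_paired_All [simp del] split_paired_Ex [simp del]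

context smooth_manifold
begin

subsection \<open>Tensors and metrics from their components in one chart\<close>

definition cotensor_of :: "('x, 'n) chart \<Rightarrow> nat \<Rightarrow> 'x \<Rightarrow> ('n list \<Rightarrow> real) \<Rightarrow> ('x, 'n) tensor" where
  "cotensor_of c k x h e I =
     (if e \<in> charts_at A x \<and> length I = k then lin_act k (transpose (jac e c x)) h I else 0)"

lemma cotensor_of_self:
  "c \<in> charts_at A x \<Longrightarrow> length I = k \<Longrightarrow> cotensor_of c k x h c I = h I"
  by (simp add: cotensor_of_def jac_self lin_act_id)

lemma cotensor_of_mem:
  assumes c: "c \<in> charts_at A x"
  shows "cotensor_of c k x h \<in> cotensors A k x"
proof -
  have "cotensor_of c k x h e J = lin_act k (transpose (jac e d x)) (cotensor_of c k x h d) J"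
    if e: "e \<in> charts_at A x" and d: "d \<in> charts_at A x" and J: "length J = k" for e d J
  proof -
    have "lin_act k (transpose (jac e d x)) (cotensor_of c k x h d) J =
       lin_act k (transpose (jac e d x)) (lin_act k (transpose (jac d c x)) h) J"
      by (rule lin_act_cong) (simp add: cotensor_of_def d)
    also have "\<dots> = cotensor_of c k x h e J"
      using e J by (simp add: lin_act_mult cotensor_of_def jac_cocycle[OF e d c] flip: matrix_transpose_mul)
    finally show ?thesis by simp
  qed
  then show ?thesis by (auto simp: cotensors_def supported_at_def cotensor_of_def)
qed

lemma cotensor_transform:
  assumes "t \<in> cotensors A k x" "c \<in> charts_at A x" "d \<in> charts_at A x" "length J = k"
  shows "t d J = lin_act k (transpose (jac d c x)) (t c) J"
  using assms by (simp add: cotensors_def)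

lemma cotensor_zero:
  "t \<in> cotensors A k x \<Longrightarrow> c \<notin> charts_at A x \<or> length I \<noteq> k \<Longrightarrow> t c I = 0"
  unfolding cotensors_def supported_at_def by blast

lemma tensor_zero:
  "t \<in> tensors A k x \<Longrightarrow> c \<notin> charts_at A x \<or> length I \<noteq> k \<Longrightarrow> t c I = 0"
  unfolding tensors_def supported_at_def by blast

lemma cotensor_eqI:
  assumes "t \<in> cotensors A k x" "t' \<in> cotensors A k x" "c \<in> charts_at A x"
    "\<And>I. length I = k \<Longrightarrow> t c I = t' c I"
  shows "t = t'"
proof (intro ext)
  fix d I
  show "t d I = t' d I"
  proof (cases "d \<in> charts_at A x \<and> length I = k")
    case True
    then show ?thesis
      using cotensor_transform[OF assms(1,3)] cotensor_transform[OF assms(2,3)] assms(4)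
      by (simp cong: lin_act_cong)
  next
    case False
    then show ?thesis using cotensor_zero[OF assms(1)] cotensor_zero[OF assms(2)] by simp
  qed
qed

lemma tensor_transform:
  assumes "t \<in> tensors A k x" "c \<in> charts_at A x" "d \<in> charts_at A x" "length J = k"
  shows "t d J = lin_act k (jac c d x) (t c) J"
  using assms by (simp add: tensors_def)

lemma tensor_eqI:
  assumes "t \<in> tensors A k x" "t' \<in> tensors A k x" "c \<in> charts_at A x"
    "\<And>I. length I = k \<Longrightarrow> t c I = t' c I"
  shows "t = t'"
proof (intro ext)
  fix d I
  show "t d I = t' d I"
  proof (cases "d \<in> charts_at A x \<and> length I = k")
    case True
    then show ?thesis
      using tensor_transform[OF assms(1,3)] tensor_transform[OF assms(2,3)] assms(4)
      by (simp cong: lin_act_cong)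
  next
    case False
    then show ?thesis using tensor_zero[OF assms(1)] tensor_zero[OF assms(2)] by simp
  qed
qed

lemma metric_transform:
  assumes "B \<in> metrics_at A r x" "c \<in> charts_at A x" "d \<in> charts_at A x"
  shows "B d = transpose (jac d c x) ** B c ** jac d c x"
  using assms unfolding metrics_at_def by blast

lemma metric_zero: "B \<in> metrics_at A r x \<Longrightarrow> c \<notin> charts_at A x \<Longrightarrow> B c = 0"
  unfolding metrics_at_def by blast

lemma metrics_at_eqI:
  assumes "B \<in> metrics_at A r x" "B' \<in> metrics_at A r x" "c \<in> charts_at A x" "B c = B' c"
  shows "B = B'"
proof
  fix d show "B d = B' d"
  proof (cases "d \<in> charts_at A x")
    case True
    then show ?thesis using metric_transform[OF assms(1,3)] metric_transform[OF assms(2,3)] assms(4) by simp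
  next
    case False
    then show ?thesis using metric_zero[OF assms(1)] metric_zero[OF assms(2)] by simp
  qed
qed

lemma metrics_at_signature: "B \<in> metrics_at A r x \<Longrightarrow> c \<in> charts_at A x \<Longrightarrow> has_signature r (B c)"
  unfolding metrics_at_def by blast

definition metric_of :: "('x, 'n) chart \<Rightarrow> (real^'n \<Rightarrow> real^'n^'n) \<Rightarrow> ('x, 'n) metric" where
  "metric_of c G z d = (if z \<in> fst c \<and> d \<in> charts_at A z
     then transpose (jac d c z) ** G (snd c z) ** jac d c z else 0)"

lemma smooth_on_congruence:
  assumes "open S" "smooth_on S L" "smooth_on S B"
  shows "smooth_on S (\<lambda>y. transpose (L y :: real^'n^'n) ** (B y :: real^'n^'n) ** L y)"
  using assms
  by (simp add: smooth_on_vec_iff[OF assms(1), where 'b=real] smooth_on_vec_iff[OF assms(1), where 'b="real^'n"]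
     matrix_matrix_mult_def transpose_def smooth_on_sum smooth_on_mult)

lemma metric_of:
  assumes c: "c \<in> A" and V: "open V" "V \<subseteq> snd c ` fst c" and G: "smooth_on V G"
    and sig: "\<And>z. z \<in> V \<Longrightarrow> has_signature r (G z)"
  shows "metric_on A r {z \<in> fst c. snd c z \<in> V} (metric_of c G)"
    "\<And>z. z \<in> V \<Longrightarrow> metric_coords (metric_of c G) c z = G z"
proof -
  let ?W = "{z \<in> fst c. snd c z \<in> V}"
  have W: "open ?W" by (rule open_vimage_chart[OF c V(1)])
  have at: "metric_of c G x \<in> metrics_at A r x" if x: "x \<in> ?W" for x
  proof -
    have cx: "c \<in> charts_at A x" using x c by (simp add: charts_at_def)
    have "metric_of c G x e = transpose (jac e d x) ** metric_of c G x d ** jac e d x"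
      if e: "e \<in> charts_at A x" and d: "d \<in> charts_at A x" for e d
      using e d x by (simp add: metric_of_def jac_cocycle[OF e d cx] matrix_transpose_mul matrix_mul_assoc)
    moreover have "has_signature r (metric_of c G x e)" if "e \<in> charts_at A x" for e
      using x that has_signature_congruent[OF sig jac_invertible[OF that cx]] by (simp add: metric_of_def)
    moreover have "metric_of c G x e = 0" if "e \<notin> charts_at A x" for e
      using that by (simp add: metric_of_def)
    ultimately show ?thesis unfolding metrics_at_def mem_Collect_eq by blast
  qed
  have "smooth_on (snd d ` (fst d \<inter> ?W)) (metric_coords (metric_of c G) d)" if d: "d \<in> A" for d
  proof -
    let ?O = "snd d ` (fst d \<inter> ?W)"
    have O: "open ?O" by (intro open_image_Int d W)
    have "smooth_on ?O (\<lambda>y. transpose (jac d c (chart_inv d y)) ** G (snd c (chart_inv d y)) ** jac d c (chart_inv d y))"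
    proof (intro smooth_on_congruence O)
      show "smooth_on ?O (\<lambda>y. jac d c (chart_inv d y))"
        by (rule smooth_on_subset[OF jac_smooth[OF d c]]) auto
      show "smooth_on ?O (\<lambda>y. G (snd c (chart_inv d y)))"
        by (rule smooth_on_compose[OF O V(1) _ smooth_on_subset[OF smooth_trans[OF d c]] G])
          (use d in \<open>auto simp: chart_inv_left\<close>)
    qed
    moreover have "metric_coords (metric_of c G) d y =
       transpose (jac d c (chart_inv d y)) ** G (snd c (chart_inv d y)) ** jac d c (chart_inv d y)" if "y \<in> ?O" for y
      using that d by (auto simp: metric_coords_def metric_of_def charts_at_def chart_inv_left)
    ultimately show ?thesis
      using smooth_on_cong[OF O, of "metric_coords (metric_of c G) d"] by simp
  qed
  then show "metric_on A r ?W (metric_of c G)" using W at by (simp add: metric_on_def)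
  fix z assume z: "z \<in> V"
  then have "chart_inv c z \<in> fst c" "snd c (chart_inv c z) = z"
    using V c chart_inv_mem chart_inv_right by blast+
  then show "metric_coords (metric_of c G) c z = G z"
    using c jac_self[of c "chart_inv c z"] by (simp add: metric_coords_def metric_of_def charts_at_def)
qed

lemma metric_coords_smooth:
  "metric_on A r W g \<Longrightarrow> c \<in> A \<Longrightarrow> smooth_on (snd c ` (fst c \<inter> W)) (metric_coords g c)"
  by (simp add: metric_on_def)

lemma metric_coords_signature:
  assumes "metric_on A r W g" "c \<in> A" "z \<in> snd c ` (fst c \<inter> W)"
  shows "has_signature r (metric_coords g c z)"
proof -
  obtain x where x: "x \<in> fst c" "x \<in> W" "z = snd c x" using assms(3) by blast
  then have "g x \<in> metrics_at A r x" "c \<in> charts_at A x"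
    using assms by (auto simp: metric_on_def charts_at_def)
  then show ?thesis using metrics_at_signature x assms(2) by (simp add: metric_coords_def chart_inv_left)
qed

lemma metric_coords_at:
  "c \<in> charts_at A x \<Longrightarrow> metric_coords g c (snd c x) = g x c"
  by (simp add: metric_coords_def chart_inv_left charts_at_def)

text \<open>P vanishes at the point, so by continuity and \<open>has_signature_open\<close> the
  perturbed symmetric matrix keeps the signature on a neighbourhood V; the new metric lives on the
  part of the chart over V.\<close>

lemma metric_perturbation:
  fixes P :: "real^'n \<Rightarrow> real^'n^'n"
  assumes g: "metric_on A r W g" "x \<in> W" and c: "c \<in> charts_at A x"
    and P: "smooth_on UNIV P" "P (snd c x) = 0" "\<And>z. transpose (P z) = P z"
  obtains W' g' V where "metric_on A r W' g'" "x \<in> W'" "open V" "snd c x \<in> V" "V \<subseteq> snd c ` (fst c \<inter> W)"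
    "W' = {z \<in> fst c. snd c z \<in> V}"
    "\<And>z. z \<in> V \<Longrightarrow> metric_coords g' c z = metric_coords g c z + P z"
proof -
  note m = charts_atD[OF c]
  let ?O = "snd c ` (fst c \<inter> W)"
  let ?G = "\<lambda>z. metric_coords g c z + P z"
  have W: "open W" using g by (simp add: metric_on_def)
  have O: "open ?O" by (rule open_image_Int[OF m(1) W])
  have xO: "snd c x \<in> ?O" using m g by auto
  have G: "smooth_on ?O ?G"
    by (intro smooth_on_add[OF O] metric_coords_smooth[OF g(1) m(1)] smooth_on_subset[OF P(1)]) auto
  obtain N where N: "open N" "metric_coords g c (snd c x) \<in> N"
      "\<And>B'. B' \<in> N \<Longrightarrow> transpose B' = B' \<Longrightarrow> has_signature r B'"
    by (rule has_signature_open[OF metric_coords_signature[OF g(1) m(1) xO]]) blast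
  define V where "V = ?O \<inter> ?G -` N"
  have V: "open V" unfolding V_def
    by (rule continuous_open_preimage[OF smooth_on_continuous_on[OF G] O N(1)])
  have VO: "V \<subseteq> ?O" by (auto simp: V_def)
  have xV: "snd c x \<in> V" using xO N(2) P(2) by (simp add: V_def)
  have sig: "has_signature r (?G z)" if "z \<in> V" for z
  proof (rule N(3))
    show "?G z \<in> N" using that by (simp add: V_def)
    have "transpose (metric_coords g c z) = metric_coords g c z"
      using that VO by (intro has_signature_symmetric[of r] metric_coords_signature[OF g(1) m(1)]) auto
    then show "transpose (?G z) = ?G z"
      using linear_add[OF bounded_linear.linear[OF bounded_linear_transpose], of "metric_coords g c z" "P z"] P(3)
      by simp
  qed
  have VO': "V \<subseteq> snd c ` fst c" using VO by auto
  note mo = metric_of[OF m(1) V VO' smooth_on_subset[OF G VO] sig]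
  show thesis
    by (rule that[OF mo(1) _ V xV VO refl]) (use m xV mo in auto)
qed

subsection \<open>Jets of metrics\<close>

lemma jet2_snd:
  assumes "c \<in> charts_at A x"
  shows "snd (jet2 A g x) c = (metric_coords g c (snd c x),
        \<chi> i j k. pd k (\<lambda>z. metric_coords g c z $ i $ j) (snd c x),
        \<chi> i j k l. pd l (pd k (\<lambda>z. metric_coords g c z $ i $ j)) (snd c x))"
  using assms by (simp add: jet2_def)

lemma fst_jet2 [simp]: "fst (jet2 A g x) = x"
  by (simp add: jet2_def)

lemma jet_value_jet2: "g x \<in> metrics_at A r x \<Longrightarrow> jet_value (jet2 A g x) = g x"
  using metric_zero by (intro ext) (auto simp: jet_value_def jet2_def metric_coords_at)

lemma J2ME:
  assumes "j \<in> J2M A r"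
  obtains W g where "j = jet2 A g (fst j)" "metric_on A r W g" "fst j \<in> W"
  using assms by (auto simp: J2M_def)

lemma J2MI: "metric_on A r W g \<Longrightarrow> x \<in> W \<Longrightarrow> jet2 A g x \<in> J2M A r"
  by (auto simp: J2M_def)

lemma metric_coords_transform:
  assumes g: "metric_on A r W g" and c: "c \<in> A" and d: "d \<in> A" and y: "y \<in> snd d ` (fst d \<inter> (fst c \<inter> W))"
  shows "metric_coords g d y $ i $ j = (\<Sum>a\<in>UNIV. \<Sum>b\<in>UNIV.
    (jac d c (chart_inv d y) $ a $ i * jac d c (chart_inv d y) $ b $ j) * metric_coords g c (snd c (chart_inv d y)) $ a $ b)"
proof -
  obtain z where z: "z \<in> fst d" "z \<in> fst c" "z \<in> W" "y = snd d z" using y by blast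
  have dz: "chart_inv d y = z" using z d by (simp add: chart_inv_left)
  have cz: "c \<in> charts_at A z" "d \<in> charts_at A z" using c d z by (auto simp: charts_at_def)
  have gz: "g z \<in> metrics_at A r z" using g z by (simp add: metric_on_def)
  have "metric_coords g d y $ i $ j = (transpose (jac d c z) ** g z c ** jac d c z) $ i $ j"
    using metric_transform[OF gz cz] by (simp add: metric_coords_def dz)
  also have "\<dots> = (\<Sum>b\<in>UNIV. \<Sum>a\<in>UNIV. (jac d c z $ a $ i * jac d c z $ b $ j) * g z c $ a $ b)"
    by (simp add: matrix_matrix_mult_def transpose_def sum_distrib_right sum_distrib_left mult_ac)
  also have "\<dots> = (\<Sum>a\<in>UNIV. \<Sum>b\<in>UNIV. (jac d c z $ a $ i * jac d c z $ b $ j) * g z c $ a $ b)"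
    by (rule sum.swap)
  finally show ?thesis by (simp add: dz metric_coords_at[OF cz(1)])
qed

text \<open>The relation between the jets has to hold in every chart, but is known in c only. The
  difference of the two metrics has zero 1-jet at x, so in another chart its first derivatives
  vanish too and its second derivatives are those in c transformed as a cotensor, like H.\<close>

lemma jet2_perturbation:
  assumes g: "metric_on A r W g" "x \<in> W" and g': "metric_on A r W' g'" "x \<in> W'"
    and c: "c \<in> charts_at A x" and H: "H \<in> cotensors A 4 x"
    and eq: "metric_coords g' c (snd c x) = metric_coords g c (snd c x)"
      "\<And>i j k. pd k (\<lambda>z. metric_coords g' c z $ i $ j) (snd c x) = pd k (\<lambda>z. metric_coords g c z $ i $ j) (snd c x)"
      "\<And>i j k l. pd l (pd k (\<lambda>z. metric_coords g' c z $ i $ j)) (snd c x) =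
         pd l (pd k (\<lambda>z. metric_coords g c z $ i $ j)) (snd c x) + H c [i, j, k, l]"
  shows "jet2 A g' x = jet_add (jet2 A g x) H"
proof -
  have "snd (jet2 A g' x) d = snd (jet_add (jet2 A g x) H) d" for d
  proof (cases "d \<in> charts_at A x")
    case False
    then have "H d I = 0" for I using cotensor_zero[OF H] by simp
    then show ?thesis using False
      by (simp add: jet2_def jet_add_def zero_prod_def) (simp add: vec_eq_iff)
  next
    case d: True
    note m = charts_atD[OF c] charts_atD[OF d]
    define \<tau> where "\<tau> y = snd c (chart_inv d y)" for y
    define R where "R = snd d ` (fst d \<inter> (fst c \<inter> (W \<inter> W')))"
    define T where "T = snd c ` (fst c \<inter> (W \<inter> W'))"
    have W: "open W" "open W'" using g g' by (auto simp: metric_on_def)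
    have R: "open R" unfolding R_def by (intro open_image_Int open_Int open_dom W m)
    have T: "open T" unfolding T_def by (intro open_image_Int open_Int open_dom W m)
    have xO: "snd d x \<in> R" using m g g' by (auto simp: R_def)
    have \<tau>R: "\<tau> ` R \<subseteq> T" using m by (auto simp: R_def T_def \<tau>_def chart_inv_left)
    have \<tau>x: "\<tau> (snd d x) = snd c x" using m by (simp add: \<tau>_def chart_inv_left)
    have s\<tau>: "smooth_on R \<tau>" unfolding \<tau>_def
      by (rule smooth_on_subset[OF smooth_trans[of d c]]) (use m in \<open>auto simp: R_def\<close>)
    define A' where "A' a i y = jac d c (chart_inv d y) $ a $ i" for a i y
    have sA: "smooth_on R (A' a i)" for a i
    proof -
      have "smooth_on R (\<lambda>y. jac d c (chart_inv d y))"
        by (rule smooth_on_subset[OF jac_smooth[of d c]]) (use m in \<open>auto simp: R_def\<close>)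
      then show ?thesis unfolding A'_def by (intro smooth_on_vec_nth R)
    qed
    define u where "u a b z = metric_coords g' c z $ a $ b - metric_coords g c z $ a $ b" for a b z
    have sG: "smooth_on T (\<lambda>z. metric_coords g c z $ a $ b)" "smooth_on T (\<lambda>z. metric_coords g' c z $ a $ b)" for a b
    proof -
      have "smooth_on T (metric_coords g c)"
        by (rule smooth_on_subset[OF metric_coords_smooth[OF g(1) m(1)]]) (auto simp: T_def)
      moreover have "smooth_on T (metric_coords g' c)"
        by (rule smooth_on_subset[OF metric_coords_smooth[OF g'(1) m(1)]]) (auto simp: T_def)
      ultimately show "smooth_on T (\<lambda>z. metric_coords g c z $ a $ b)" "smooth_on T (\<lambda>z. metric_coords g' c z $ a $ b)"
        by (auto intro!: smooth_on_vec_nth T)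
    qed
    have su: "smooth_on T (u a b)" for a b
      unfolding u_def by (intro smooth_on_diff T sG)
    have xT: "snd c x \<in> T" using m g g' by (auto simp: T_def)
    have vu: "vanishes2 (u a b) (\<tau> (snd d x))" for a b
      unfolding vanishes2_def \<tau>x
    proof (intro conjI allI)
      show "u a b (snd c x) = 0" by (simp add: u_def eq)
      fix k
      have "pd k (u a b) (snd c x) = pd k (\<lambda>z. metric_coords g' c z $ a $ b) (snd c x) - pd k (\<lambda>z. metric_coords g c z $ a $ b) (snd c x)"
        unfolding u_def by (intro pd_diff smooth_on_differentiable[OF sG(1) xT] smooth_on_differentiable[OF sG(2) xT])
      then show "pd k (u a b) (snd c x) = 0" by (simp add: eq)
    qed
    have u2: "pd l (pd k (u a b)) (snd c x) = H c [a, b, k, l]" for a b k l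
    proof -
      have "pd l (pd k (\<lambda>z. u a b z + metric_coords g c z $ a $ b)) (snd c x) =
        pd l (pd k (u a b)) (snd c x) + pd l (pd k (\<lambda>z. metric_coords g c z $ a $ b)) (snd c x)"
        by (rule smooth_pd2_add[OF T su sG(1) xT])
      then show ?thesis using eq(3)[of l k a b] by (simp add: u_def)
    qed
    \<comment> \<open>The difference of the two metrics in the coordinates of d: u composed with the
      transition map and multiplied by two Jacobian entries.\<close>
    define v where "v i j y = (\<Sum>a\<in>UNIV. \<Sum>b\<in>UNIV. (A' a i y * A' b j y) * u a b (\<tau> y))" for i j y
    have su\<tau>: "smooth_on R (\<lambda>y. u a b (\<tau> y))" for a b
      by (rule smooth_on_compose[OF R T \<tau>R s\<tau> su])
    have sAA: "smooth_on R (\<lambda>y. A' a i y * A' b j y)" for a b i j by (intro smooth_on_mult sA R)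
    have st: "smooth_on R (\<lambda>y. (A' a i y * A' b j y) * u a b (\<tau> y))" for a b i j by (intro smooth_on_mult sAA su\<tau> R)
    note vc = vanishes2_compose[OF R s\<tau> xO T su \<tau>R vu]
    note vm = vanishes2_mult[OF R sAA su\<tau> xO vc(1)]
    have sv: "smooth_on R (v i j)" for i j
      unfolding v_def by (intro smooth_on_sum R st)
    have vv: "vanishes2 (v i j) (snd d x)" for i j
      unfolding v_def by (intro vanishes2_sum[OF R _ xO] smooth_on_sum R vm(1) st)
    have v2: "pd l (pd k (v i j)) (snd d x) = H d [i, j, k, l]" for i j k l
    proof -
      have "pd l (pd k (v i j)) (snd d x) = (\<Sum>a\<in>UNIV. \<Sum>b\<in>UNIV. (A' a i (snd d x) * A' b j (snd d x)) *
        (\<Sum>e\<in>UNIV. \<Sum>f\<in>UNIV. H c [a, b, e, f] * pd k (\<lambda>y. \<tau> y $ e) (snd d x) * pd l (\<lambda>y. \<tau> y $ f) (snd d x)))"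
      proof -
        have "pd l (pd k (v i j)) (snd d x) = (\<Sum>a\<in>UNIV. pd l (pd k (\<lambda>y. \<Sum>b\<in>UNIV. (A' a i y * A' b j y) * u a b (\<tau> y))) (snd d x))"
          unfolding v_def by (rule smooth_pd2_sum[OF R _ xO]) (intro smooth_on_sum R st)
        also have "\<dots> = (\<Sum>a\<in>UNIV. \<Sum>b\<in>UNIV. pd l (pd k (\<lambda>y. (A' a i y * A' b j y) * u a b (\<tau> y))) (snd d x))"
          by (intro sum.cong refl smooth_pd2_sum[OF R st xO])
        finally show ?thesis by (simp add: vm(2) vc(2) \<tau>x u2)
      qed
      also have "\<dots> = (\<Sum>a\<in>UNIV. \<Sum>b\<in>UNIV. \<Sum>e\<in>UNIV. \<Sum>f\<in>UNIV.
         jac d c x $ a $ i * jac d c x $ b $ j * jac d c x $ e $ k * jac d c x $ f $ l * H c [a, b, e, f])"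
        using m by (simp add: A'_def \<tau>_def chart_inv_left sum_distrib_left mult_ac flip: jac_nth[OF d c])
      also have "\<dots> = H d [i, j, k, l]"
        using cotensor_transform[OF H c d, of "[i, j, k, l]"] by (simp add: lin_act_4 transpose_def)
      finally show ?thesis .
    qed
    have G': "metric_coords g' d y $ i $ j = metric_coords g d y $ i $ j + v i j y" if "y \<in> R" for i j y
    proof -
      have y: "y \<in> snd d ` (fst d \<inter> (fst c \<inter> W))" "y \<in> snd d ` (fst d \<inter> (fst c \<inter> W'))"
        using that by (auto simp: R_def)
      show ?thesis
        unfolding metric_coords_transform[OF g(1) m(1) m(3) y(1)] metric_coords_transform[OF g'(1) m(1) m(3) y(2)]
        by (simp add: v_def u_def A'_def \<tau>_def algebra_simps sum.distrib sum_subtractf)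
    qed
    have sGd: "smooth_on R (\<lambda>z. metric_coords g d z $ i $ j)" for i j
    proof -
      have "smooth_on R (metric_coords g d)"
        by (rule smooth_on_subset[OF metric_coords_smooth[OF g(1) m(3)]]) (auto simp: R_def)
      then show ?thesis by (intro smooth_on_vec_nth R)
    qed
    have 0: "metric_coords g' d (snd d x) = metric_coords g d (snd d x)"
      using G'[OF xO] vv by (simp add: vec_eq_iff vanishes2_def)
    have 1: "pd k (\<lambda>z. metric_coords g' d z $ i $ j) (snd d x) = pd k (\<lambda>z. metric_coords g d z $ i $ j) (snd d x)" for i j k
    proof -
      have "pd k (\<lambda>z. metric_coords g' d z $ i $ j) (snd d x) = pd k (\<lambda>z. metric_coords g d z $ i $ j + v i j z) (snd d x)"
        using G' by (intro pd_cong[OF R xO])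
      then show ?thesis using vv by (simp add: smooth_pd2_add[OF R sGd sv xO] vanishes2_def)
    qed
    have 2: "pd l (pd k (\<lambda>z. metric_coords g' d z $ i $ j)) (snd d x) =
        pd l (pd k (\<lambda>z. metric_coords g d z $ i $ j)) (snd d x) + H d [i, j, k, l]" for i j k l
    proof -
      have "pd l (pd k (\<lambda>z. metric_coords g' d z $ i $ j)) (snd d x) =
        pd l (pd k (\<lambda>z. metric_coords g d z $ i $ j + v i j z)) (snd d x)"
        using G' by (intro pd_cong[OF R xO] pd_cong[OF R])
      then show ?thesis by (simp add: smooth_pd2_add[OF R sGd sv xO] v2)
    qed
    show ?thesis
      using 0 1 2 by (simp add: jet_add_def jet2_snd[OF d]) (simp add: vec_eq_iff)
  qed
  then show ?thesis by (simp add: prod_eq_iff jet_add_def fun_eq_iff)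
qed

lemma jet_add_0: "jet_add j (\<lambda>c I. 0) = j"
  by (simp add: jet_add_def prod_eq_iff fun_eq_iff) (simp add: vec_eq_iff)

lemma jet_add_add: "jet_add (jet_add j H) H' = jet_add j (\<lambda>c I. H c I + H' c I)"
  by (simp add: jet_add_def prod_eq_iff fun_eq_iff) (simp add: vec_eq_iff)

lemma fst_jet_add [simp]: "fst (jet_add j H) = fst j"
  by (simp add: jet_add_def)

lemma jet_value_jet_add [simp]: "jet_value (jet_add j H) = jet_value j"
  by (simp add: jet_value_def jet_add_def fun_eq_iff)

lemma zero_cotensor: "(\<lambda>c I. 0) \<in> cotensors A k x"
  by (auto simp: cotensors_def supported_at_def lin_act_def)

text \<open>The case H = 0 of \<open>jet2_perturbation\<close>: it suffices to compare jets in a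
  single chart.\<close>

lemma jet2_eqI:
  assumes g: "metric_on A r W g" "x \<in> W" and g': "metric_on A r W' g'" "x \<in> W'"
    and c: "c \<in> charts_at A x" and "snd (jet2 A g' x) c = snd (jet2 A g x) c"
  shows "jet2 A g' x = jet2 A g x"
proof -
  from assms(6) have e: "metric_coords g' c (snd c x) = metric_coords g c (snd c x)"
    "(\<chi> i j k. pd k (\<lambda>z. metric_coords g' c z $ i $ j) (snd c x)) =
     (\<chi> i j k. pd k (\<lambda>z. metric_coords g c z $ i $ j) (snd c x))"
    "(\<chi> i j k l. pd l (pd k (\<lambda>z. metric_coords g' c z $ i $ j)) (snd c x)) =
     (\<chi> i j k l. pd l (pd k (\<lambda>z. metric_coords g c z $ i $ j)) (snd c x))"
    unfolding jet2_snd[OF c] by (simp_all only: prod.inject)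
  have "jet2 A g' x = jet_add (jet2 A g x) (\<lambda>c I. 0)"
  proof (rule jet2_perturbation[OF g g' c zero_cotensor e(1)])
    show "pd k (\<lambda>z. metric_coords g' c z $ i $ j) (snd c x) = pd k (\<lambda>z. metric_coords g c z $ i $ j) (snd c x)" for i j k
      using arg_cong[OF e(2), of "\<lambda>v. v $ i $ j $ k"] by simp
    show "pd l (pd k (\<lambda>z. metric_coords g' c z $ i $ j)) (snd c x) =
      pd l (pd k (\<lambda>z. metric_coords g c z $ i $ j)) (snd c x) + 0" for i j k l
      using arg_cong[OF e(3), of "\<lambda>v. v $ i $ j $ k $ l"] by simp
  qed
  then show ?thesis by (simp add: jet_add_0)
qed

lemma S22_cotensor: "H \<in> S22 A x \<Longrightarrow> H \<in> cotensors A 4 x"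
  by (simp add: S22_def)

lemma S22_sym:
  assumes "H \<in> S22 A x"
  shows "H c [b, a, e, f] = H c [a, b, e, f]" "H c [a, b, f, e] = H c [a, b, e, f]"
  using assms by (auto simp: S22_def)

lemma lin_comb_cotensor:
  assumes "H \<in> cotensors A k x" "H' \<in> cotensors A k x"
  shows "(\<lambda>c I. H c I + s * H' c I) \<in> cotensors A k x"
proof -
  have "lin_act k Q (\<lambda>I. H c I + s * H' c I) J = lin_act k Q (H c) J + s * lin_act k Q (H' c) J" for Q c J
    by (simp add: lin_act_def algebra_simps sum.distrib sum_distrib_left)
  then show ?thesis using assms by (auto simp: cotensors_def supported_at_def)
qed

lemma lin_comb_S22:
  assumes "H \<in> S22 A x" "H' \<in> S22 A x"
  shows "(\<lambda>c I. H c I + s * H' c I) \<in> S22 A x"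
  using lin_comb_cotensor[of H 4 x H' s] assms by (auto simp: S22_def)

lemma zero_S22: "(\<lambda>c I. 0) \<in> S22 A x"
  by (simp add: S22_def zero_cotensor)

lemma scale_S22: "H \<in> S22 A x \<Longrightarrow> (\<lambda>c I. s * H c I) \<in> S22 A x"
  using lin_comb_S22[OF zero_S22, of H x s] by simp

text \<open>The translated jet is realized by adding to a representing metric the quadratic
  functions whose second derivatives at x are the components of H in a chart.\<close>

lemma jet_add_mem:
  assumes j: "j \<in> J2M A r" and H: "H \<in> S22 A (fst j)"
  shows "jet_add j H \<in> J2M A r"
proof -
  obtain W g where g: "j = jet2 A g (fst j)" "metric_on A r W g" "fst j \<in> W" using j by (rule J2ME)
  define x where "x = fst j"
  obtain c where c: "c \<in> charts_at A x" using ex_chart_at by blast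
  note m = charts_atD[OF c]
  note sym = S22_sym[OF H[folded x_def]]
  define q where "q i j = quad (\<lambda>k l. H c [i, j, k, l]) (snd c x)" for i j
  define P where "P z = (\<chi> i j. q i j z)" for z
  have P1: "smooth_on UNIV P" unfolding P_def q_def
    by (simp add: smooth_on_vec_iff smooth_quad)
  have P2: "P (snd c x) = 0" by (simp add: P_def q_def vec_eq_iff quad_0)
  have P3: "transpose (P z) = P z" for z
    by (simp add: P_def q_def vec_eq_iff transpose_def sym(1))
  obtain W' g' V where g': "metric_on A r W' g'" "x \<in> W'" "open V" "snd c x \<in> V" "V \<subseteq> snd c ` (fst c \<inter> W)"
    and G': "\<And>z. z \<in> V \<Longrightarrow> metric_coords g' c z = metric_coords g c z + P z"
    by (rule metric_perturbation[OF g(2,3)[folded x_def] c P1 P2 P3]) blast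
  have sG: "smooth_on V (\<lambda>z. metric_coords g c z $ i $ j)" for i j
    by (intro smooth_on_vec_nth g' smooth_on_subset[OF metric_coords_smooth[OF g(2) m(1)] g'(5)])
  have sq: "smooth_on V (q i j)" for i j unfolding q_def by (intro smooth_quad g')
  have G'q: "metric_coords g' c z $ i $ j = metric_coords g c z $ i $ j + q i j z" if "z \<in> V" for z i j
    using G'[OF that] by (simp add: P_def)
  have "jet2 A g' x = jet_add (jet2 A g x) H"
  proof (rule jet2_perturbation[OF g(2,3)[folded x_def] g'(1,2) c S22_cotensor[OF H[folded x_def]]])
    show "metric_coords g' c (snd c x) = metric_coords g c (snd c x)"
      using G' g' P2 by simp
    fix i j k l
    have "pd k (\<lambda>z. metric_coords g' c z $ i $ j) (snd c x) = pd k (\<lambda>z. metric_coords g c z $ i $ j + q i j z) (snd c x)"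
      by (intro pd_cong[OF g'(3,4)] G'q)
    then show "pd k (\<lambda>z. metric_coords g' c z $ i $ j) (snd c x) = pd k (\<lambda>z. metric_coords g c z $ i $ j) (snd c x)"
      using smooth_pd2_add[OF g'(3) sG sq g'(4), of k i j i j] quad_0(2)[of "\<lambda>k l. H c [i, j, k, l]" k "snd c x"] sym
      by (simp add: q_def)
    have "pd l (pd k (\<lambda>z. metric_coords g' c z $ i $ j)) (snd c x) = pd l (pd k (\<lambda>z. metric_coords g c z $ i $ j + q i j z)) (snd c x)"
      by (intro pd_cong[OF g'(3,4)] pd_cong[OF g'(3)] G'q)
    then show "pd l (pd k (\<lambda>z. metric_coords g' c z $ i $ j)) (snd c x) =
         pd l (pd k (\<lambda>z. metric_coords g c z $ i $ j)) (snd c x) + H c [i, j, k, l]"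
      using smooth_pd2_add(2)[OF g'(3) sG sq g'(4), of l k i j i j] pd2_quad[of "\<lambda>k l. H c [i, j, k, l]" l k "snd c x"] sym
      by (simp add: q_def)
  qed
  then show ?thesis using J2MI[OF g'(1,2)] g(1) by (simp add: x_def)
qed

lemma ex_jet:
  assumes "gx \<in> metrics_at A r x"
  shows "\<exists>j\<in>J2M A r. fst j = x \<and> jet_value j = gx"
proof -
  obtain c where c: "c \<in> charts_at A x" using ex_chart_at by blast
  note m = charts_atD[OF c]
  note mo = metric_of[OF m(1) open_image[OF m(1)] order.refl smooth_on_const, of r "gx c"]
  have sig: "has_signature r (gx c)" by (rule metrics_at_signature[OF assms c])
  let ?g = "metric_of c (\<lambda>_. gx c)" and ?W = "{z \<in> fst c. snd c z \<in> snd c ` fst c}"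
  have g: "metric_on A r ?W ?g" "x \<in> ?W" using mo(1) sig m by auto
  have gx: "?g x \<in> metrics_at A r x" using g unfolding metric_on_def by blast
  have "?g x c = gx c"
    using mo(2)[of "snd c x"] sig m metric_coords_at[OF c, of ?g] by simp
  then have "?g x = gx" by (rule metrics_at_eqI[OF gx assms c])
  then show ?thesis using J2MI[OF g] jet_value_jet2[of ?g, OF gx] by (intro bexI[of _ "jet2 A ?g x"]) auto
qed

end

section \<open>Index symmetries and normal tensors\<close>

lemma lin_act_swap:
  "lin_act 4 Q t [b, a, e, f] = lin_act 4 Q (\<lambda>I. t [I ! 1, I ! 0, I ! 2, I ! 3]) [a, b, e, f]"
  "lin_act 4 Q t [a, e, b, f] = lin_act 4 Q (\<lambda>I. t [I ! 0, I ! 2, I ! 1, I ! 3]) [a, b, e, f]"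
  "lin_act 4 Q t [a, b, f, e] = lin_act 4 Q (\<lambda>I. t [I ! 0, I ! 1, I ! 3, I ! 2]) [a, b, e, f]"
proof -
  have "lin_act 4 Q t [b, a, e, f] = (\<Sum>j\<in>UNIV. \<Sum>i\<in>UNIV. \<Sum>k\<in>UNIV. \<Sum>l\<in>UNIV.
     Q $ b $ i * Q $ a $ j * Q $ e $ k * Q $ f $ l * t [i, j, k, l])"
    unfolding lin_act_4 by (rule sum.swap)
  then show "lin_act 4 Q t [b, a, e, f] = lin_act 4 Q (\<lambda>I. t [I ! 1, I ! 0, I ! 2, I ! 3]) [a, b, e, f]"
    by (simp add: lin_act_4 mult_ac)
  have "lin_act 4 Q t [a, e, b, f] = (\<Sum>i\<in>UNIV. \<Sum>k\<in>UNIV. \<Sum>j\<in>UNIV. \<Sum>l\<in>UNIV.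
     Q $ a $ i * Q $ e $ j * Q $ b $ k * Q $ f $ l * t [i, j, k, l])"
    unfolding lin_act_4 by (intro sum.cong refl sum.swap)
  then show "lin_act 4 Q t [a, e, b, f] = lin_act 4 Q (\<lambda>I. t [I ! 0, I ! 2, I ! 1, I ! 3]) [a, b, e, f]"
    by (simp add: lin_act_4 mult_ac)
  have "lin_act 4 Q t [a, b, f, e] = (\<Sum>i\<in>UNIV. \<Sum>j\<in>UNIV. \<Sum>l\<in>UNIV. \<Sum>k\<in>UNIV.
     Q $ a $ i * Q $ b $ j * Q $ f $ k * Q $ e $ l * t [i, j, k, l])"
    unfolding lin_act_4 by (intro sum.cong refl sum.swap)
  then show "lin_act 4 Q t [a, b, f, e] = lin_act 4 Q (\<lambda>I. t [I ! 0, I ! 1, I ! 3, I ! 2]) [a, b, e, f]"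
    by (simp add: lin_act_4 mult_ac)
qed

lemma lin_act_4_cong:
  "(\<And>i j k l. t [i, j, k, l] = t' [i, j, k, l]) \<Longrightarrow> lin_act 4 Q t J = lin_act 4 Q t' J"
  by (rule lin_act_cong) (metis length_4E)

lemma lin_act_add3:
  "lin_act k Q t1 J + lin_act k Q t2 J + lin_act k Q t3 J = lin_act k Q (\<lambda>I. t1 I + t2 I + t3 I) J"
  by (simp add: lin_act_def sum.distrib algebra_simps)

text \<open>The projection, on tensors with the symmetries of \<open>S22\<close>, onto the normal tensors whose
  kernel is spanned by the second derivatives of \<open>B i a * \<xi> a, j + B j a * \<xi> a, i\<close> with \<open>\<xi>\<close> cubic,
  i.e. by the effect of a cubic change of coordinates.\<close>

definition normal_part :: "('n list \<Rightarrow> real) \<Rightarrow> 'n list \<Rightarrow> real" where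
  "normal_part M I = (let i = I ! 0; j = I ! 1; k = I ! 2; l = I ! 3 in
     (M [i, j, k, l] + M [k, l, i, j]) / 3 - (M [i, k, j, l] + M [i, l, j, k] + M [j, k, i, l] + M [j, l, i, k]) / 6)"

lemma normal_part_4: "normal_part M [i, j, k, l] = (M [i, j, k, l] + M [k, l, i, j]) / 3 -
    (M [i, k, j, l] + M [i, l, j, k] + M [j, k, i, l] + M [j, l, i, k]) / 6"
  by (simp add: normal_part_def)

lemma normal_part_sym:
  assumes "\<And>i j k l. M [j, i, k, l] = M [i, j, k, l]" "\<And>i j k l. M [i, j, l, k] = M [i, j, k, l]"
  shows "normal_part M [j, i, k, l] = normal_part M [i, j, k, l]"
    "normal_part M [i, j, l, k] = normal_part M [i, j, k, l]"
    "normal_part M [i, j, k, l] + normal_part M [i, k, j, l] + normal_part M [i, l, j, k] = 0"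
  unfolding normal_part_4
    using assms(1)[of i j k l] assms(1)[of i k j l] assms(1)[of i l j k] assms(1)[of j k i l]
    assms(1)[of j l i k] assms(1)[of k l i j] assms(2)[of i j k l] assms(2)[of i k j l] assms(2)[of i l j k]
    assms(2)[of j k i l] assms(2)[of j l i k] assms(2)[of k l i j]
    assms(1)[of i k l j] assms(1)[of i l k j] assms(1)[of j k l i] assms(1)[of j l k i] assms(1)[of k l j i]
  by (simp_all add: field_simps)

text \<open>Contracting the cyclic identity with three copies of v gives 3 X = 0 for the first sum.
  In the second, the cyclic identity over j, l, m yields twice the sum plus an instance of the
  first. These are the contractions met by the geodesic equation along a ray through the
  origin.\<close>

lemma normal_contraction:
  fixes v :: "'n::finite \<Rightarrow> real"
  assumes s1: "\<And>i j k l. N [j, i, k, l] = N [i, j, k, l]" and s2: "\<And>i j k l. N [i, j, l, k] = N [i, j, k, l]"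
    and cyc: "\<And>i j k l. N [i, j, k, l] + N [i, k, j, l] + N [i, l, j, k] = 0"
  shows "(\<Sum>j\<in>UNIV. \<Sum>k\<in>UNIV. \<Sum>l\<in>UNIV. N [i, j, k, l] * v j * v k * v l) = 0"
    "(\<Sum>i\<in>UNIV. \<Sum>j\<in>UNIV. \<Sum>m\<in>UNIV. N [i, j, l, m] * v i * v j * v m) = 0"
proof -
  show 1: "(\<Sum>j\<in>UNIV. \<Sum>k\<in>UNIV. \<Sum>l\<in>UNIV. N [i, j, k, l] * v j * v k * v l) = 0" for i
  proof -
    let ?X = "\<Sum>j\<in>UNIV. \<Sum>k\<in>UNIV. \<Sum>l\<in>UNIV. N [i, j, k, l] * v j * v k * v l"
    have 2: "(\<Sum>j\<in>UNIV. \<Sum>k\<in>UNIV. \<Sum>l\<in>UNIV. N [i, k, j, l] * v j * v k * v l) = ?X"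
      by (subst sum.swap) (simp add: mult_ac)
    have "(\<Sum>j\<in>UNIV. \<Sum>k\<in>UNIV. \<Sum>l\<in>UNIV. N [i, l, j, k] * v j * v k * v l) =
      (\<Sum>j\<in>UNIV. \<Sum>l\<in>UNIV. \<Sum>k\<in>UNIV. N [i, l, j, k] * v j * v k * v l)"
      by (intro sum.cong refl sum.swap)
    also have "\<dots> = ?X" using 2 by (simp add: mult_ac)
    finally have 3: "(\<Sum>j\<in>UNIV. \<Sum>k\<in>UNIV. \<Sum>l\<in>UNIV. N [i, l, j, k] * v j * v k * v l) = ?X" .
    have "?X + ?X + ?X = ?X + (\<Sum>j\<in>UNIV. \<Sum>k\<in>UNIV. \<Sum>l\<in>UNIV. N [i, k, j, l] * v j * v k * v l) +
      (\<Sum>j\<in>UNIV. \<Sum>k\<in>UNIV. \<Sum>l\<in>UNIV. N [i, l, j, k] * v j * v k * v l)"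
      using 2 3 by simp
    also have "\<dots> = (\<Sum>j\<in>UNIV. \<Sum>k\<in>UNIV. \<Sum>l\<in>UNIV. (N [i, j, k, l] + N [i, k, j, l] + N [i, l, j, k]) * v j * v k * v l)"
      by (simp add: sum.distrib algebra_simps)
    finally show "?X = 0" unfolding cyc by simp
  qed
  show "(\<Sum>i\<in>UNIV. \<Sum>j\<in>UNIV. \<Sum>m\<in>UNIV. N [i, j, l, m] * v i * v j * v m) = 0"
  proof -
    let ?X = "\<Sum>i\<in>UNIV. \<Sum>j\<in>UNIV. \<Sum>m\<in>UNIV. N [i, j, l, m] * v i * v j * v m"
    have 2: "(\<Sum>i\<in>UNIV. \<Sum>j\<in>UNIV. \<Sum>m\<in>UNIV. N [i, m, l, j] * v i * v j * v m) = ?X"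
    proof -
      have "(\<Sum>i\<in>UNIV. \<Sum>j\<in>UNIV. \<Sum>m\<in>UNIV. N [i, m, l, j] * v i * v j * v m) =
        (\<Sum>i\<in>UNIV. \<Sum>m\<in>UNIV. \<Sum>j\<in>UNIV. N [i, m, l, j] * v i * v j * v m)"
        by (intro sum.cong refl sum.swap)
      then show ?thesis by (simp add: mult_ac)
    qed
    have 3: "(\<Sum>i\<in>UNIV. \<Sum>j\<in>UNIV. \<Sum>m\<in>UNIV. N [i, l, j, m] * v i * v j * v m) = 0"
      using 1[of l] by (simp add: s1[of l])
    have "N [i, j, l, m] + N [i, m, l, j] + N [i, l, j, m] = 0" for i j m
      using cyc[of i j l m] s2[of i m l j] by simp
    then have "(\<Sum>i\<in>UNIV. \<Sum>j\<in>UNIV. \<Sum>m\<in>UNIV. (N [i, j, l, m] + N [i, m, l, j] + N [i, l, j, m]) * v i * v j * v m) = 0"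
      by simp
    then have "?X + ?X + 0 = 0"
      using 2 3 by (simp add: sum.distrib algebra_simps)
    then show "?X = 0" by simp
  qed
qed

lemma matrix_inverse_solution:
  fixes B :: "real^'n^'n::finite"
  assumes "invertible B"
  obtains q where "\<And>h i. (\<Sum>b\<in>UNIV. B $ i $ b * q h b) = h i"
proof -
  obtain C :: "real^'n^'n" where C: "B ** C = mat 1" using assms by (auto simp: invertible_def)
  define q where "q h = (\<lambda>b. (C *v (\<chi> i. h i)) $ b)" for h
  have "(\<Sum>b\<in>UNIV. B $ i $ b * q h b) = (B *v (C *v (\<chi> i. h i))) $ i" for h i
    by (simp add: q_def matrix_vector_mult_def)
  then have "(\<Sum>b\<in>UNIV. B $ i $ b * q h b) = h i" for h i
    by (simp add: matrix_vector_mul_assoc C)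
  then show thesis using that by blast
qed

lemma sum_delta_mult:
  fixes F :: "'n::finite \<Rightarrow> real"
  shows "(\<Sum>a\<in>UNIV. (if a = i then 1 else 0) * F a) = F i"
    "(\<Sum>a\<in>UNIV. F a * (if a = i then 1 else 0)) = F i"
  by (simp_all add: if_distrib[where f="\<lambda>x. x * y" for y] if_distrib[where f="\<lambda>x. y * x" for y] cong: if_cong)

context smooth_manifold
begin

lemma S22I:
  assumes H: "H \<in> cotensors A 4 x" and c: "c \<in> charts_at A x"
    and s: "\<And>a b e f. H c [b, a, e, f] = H c [a, b, e, f]" "\<And>a b e f. H c [a, b, f, e] = H c [a, b, e, f]"
  shows "H \<in> S22 A x"
proof -
  have "H d [a, b, e, f] = H d [b, a, e, f] \<and> H d [a, b, e, f] = H d [a, b, f, e]" for d a b e f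
  proof (cases "d \<in> charts_at A x")
    case True
    note t = cotensor_transform[OF H c True]
    have "H d [b, a, e, f] = H d [a, b, e, f]"
      using s by (simp add: t lin_act_swap(1)[of _ _ b a]) (rule lin_act_4_cong, simp)
    moreover have "H d [a, b, f, e] = H d [a, b, e, f]"
      using s by (simp add: t lin_act_swap(3)[of _ _ a b f e]) (rule lin_act_4_cong, simp)
    ultimately show ?thesis by simp
  next
    case False
    then show ?thesis using cotensor_zero[OF H] by simp
  qed
  then show ?thesis using H by (simp add: S22_def)
qed

lemma normal_tensorI:
  assumes H: "H \<in> cotensors A 4 x" and c: "c \<in> charts_at A x"
    and s: "\<And>a b e f. H c [b, a, e, f] = H c [a, b, e, f]" "\<And>a b e f. H c [a, b, f, e] = H c [a, b, e, f]"
    and cyc: "\<And>a b e f. H c [a, b, e, f] + H c [a, e, b, f] + H c [a, f, b, e] = 0"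
  shows "H \<in> normal_tensors A x"
proof -
  have S: "H \<in> S22 A x" by (rule S22I[OF H c s])
  have cyc': "H d [a, b, e, f] + H d [a, e, b, f] + H d [a, f, b, e] = 0" for d a b e f
  proof (cases "d \<in> charts_at A x")
    case True
    let ?L = "\<lambda>t J. lin_act 4 (transpose (jac d c x)) t J"
    have t: "H d J = ?L (H c) J" if "length J = 4" for J
      using cotensor_transform[OF H c True that] .
    have "H d [a, b, e, f] + H d [a, e, b, f] + H d [a, f, b, e] =
      ?L (H c) [a, b, e, f] + ?L (\<lambda>I. H c [I ! 0, I ! 2, I ! 1, I ! 3]) [a, b, e, f] +
      ?L (\<lambda>I. H c [I ! 0, I ! 3, I ! 1, I ! 2]) [a, b, e, f]"
    proof -
      have "?L (H c) [a, f, b, e] = ?L (\<lambda>I. H c [I ! 0, I ! 2, I ! 1, I ! 3]) [a, b, f, e]"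
        by (rule lin_act_swap(2))
      also have "\<dots> = ?L (\<lambda>I. H c [I ! 0, I ! 3, I ! 1, I ! 2]) [a, b, e, f]"
        by (subst lin_act_swap(3)) simp
      finally show ?thesis by (simp add: t lin_act_swap(2)[of _ _ a e b f])
    qed
    also have "\<dots> = ?L (\<lambda>I. 0) [a, b, e, f]"
      unfolding lin_act_add3 by (rule lin_act_4_cong) (simp add: cyc)
    also have "\<dots> = 0" by (simp add: lin_act_def)
    finally show ?thesis .
  next
    case False
    then show ?thesis using cotensor_zero[OF H] by simp
  qed
  \<comment> \<open>By symmetry in the last two indices, \<open>symmetrize3\<close> is twice the
    cyclic sum.\<close>
  have "symmetrize3 (\<lambda>b e f. H d [a, b, e, f]) b e f = 0" for d a b e f
    using cyc'[of d a b e f] S22_sym(2)[OF S, of d a] by (simp add: symmetrize3_def)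
  then show ?thesis using S by (simp add: normal_tensors_def)
qed

subsection \<open>Normal form of a jet\<close>

lemma metric_coords_reparametrized:
  assumes g: "metric_on A r W g" and c: "c \<in> A" and d: "d \<in> A"
    and img: "snd d ` fst d = ball 0 e" "fst d \<subseteq> fst c \<inter> W"
    and \<theta>: "\<And>y. y \<in> ball 0 e \<Longrightarrow> chart_inv d y = chart_inv c (\<theta> y)"
      "\<And>y. y \<in> ball 0 e \<Longrightarrow> \<theta> y \<in> snd c ` (fst c \<inter> W)"
    and y: "y \<in> ball 0 e"
  shows "metric_coords g d y $ i $ j = (\<Sum>a\<in>UNIV. \<Sum>b\<in>UNIV.
    (pd i (\<lambda>y. \<theta> y $ a) y * pd j (\<lambda>y. \<theta> y $ b) y) * metric_coords g c (\<theta> y) $ a $ b)"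
proof -
  obtain z where z: "z \<in> fst d" "y = snd d z" using y img by blast
  then have zc: "z \<in> fst c" "z \<in> W" using img by auto
  have dz: "chart_inv d y = z" using z d by (simp add: chart_inv_left)
  have cz: "c \<in> charts_at A z" "d \<in> charts_at A z" using c d z zc by (auto simp: charts_at_def)
  have \<theta>c: "snd c (chart_inv d y) = \<theta> y" if "y \<in> ball 0 e" for y
  proof -
    have "\<theta> y \<in> snd c ` fst c" using \<theta>(2)[OF that] by blast
    then show ?thesis using \<theta>(1)[OF that] chart_inv_right[OF c] by simp
  qed
  have "jac d c z $ a $ i = pd i (\<lambda>y. \<theta> y $ a) y" for a i
    unfolding jac_nth[OF cz(2,1)] z(2)[symmetric]
    by (rule pd_cong[OF open_ball y]) (simp add: \<theta>c)
  moreover have "y \<in> snd d ` (fst d \<inter> (fst c \<inter> W))" using z zc by blast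
  ultimately show ?thesis
    using metric_coords_transform[OF g c d, of y i j] by (simp add: dz \<theta>c[OF y, unfolded dz])
qed

text \<open>The Jacobian of \<theta> is the identity plus the derivative of p, and is the identity
  at the origin. Hence first derivatives of the new metric feel only the quadratic part of p. If
  that part and the first derivatives of G vanish, no product of first order terms survives, and the
  second derivatives feel only the cubic part of p.\<close>

lemma reparametrized_derivatives:
  fixes G G' :: "real^'n \<Rightarrow> real^'n^'n" and p :: "'n \<Rightarrow> real^'n \<Rightarrow> real"
  assumes e: "0 < e" and sG: "open T" "smooth_on T G" and \<theta>T: "\<And>y. y \<in> ball 0 e \<Longrightarrow> \<theta> y \<in> T"
    and \<theta>: "\<And>y. \<theta> y = (\<chi> a. z0 $ a + y $ a + p a y)"
    and p: "\<And>a. smooth_on UNIV (p a)" "\<And>a. p a 0 = 0" "\<And>a i. pd i (p a) 0 = 0"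
    and G': "\<And>y i j. y \<in> ball 0 e \<Longrightarrow> G' y $ i $ j = (\<Sum>a\<in>UNIV. \<Sum>b\<in>UNIV.
      (pd i (\<lambda>y. \<theta> y $ a) y * pd j (\<lambda>y. \<theta> y $ b) y) * G (\<theta> y) $ a $ b)"
  shows "pd k (\<lambda>y. G' y $ i $ j) 0 = pd k (\<lambda>z. G z $ i $ j) z0 +
      (\<Sum>b\<in>UNIV. pd k (pd j (p b)) 0 * G z0 $ i $ b) + (\<Sum>a\<in>UNIV. pd k (pd i (p a)) 0 * G z0 $ a $ j)"
    "(\<And>a i k. pd k (pd i (p a)) 0 = 0) \<Longrightarrow> (\<And>a b k. pd k (\<lambda>z. G z $ a $ b) z0 = 0) \<Longrightarrow>
      pd l (pd k (\<lambda>y. G' y $ i $ j)) 0 = pd l (pd k (\<lambda>z. G z $ i $ j)) z0 +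
      (\<Sum>b\<in>UNIV. pd l (pd k (pd j (p b))) 0 * G z0 $ i $ b) + (\<Sum>a\<in>UNIV. pd l (pd k (pd i (p a))) 0 * G z0 $ a $ j)"
proof -
  let ?B = "ball (0::real^'n) e"
  have B: "open ?B" "0 \<in> ?B" using e by auto
  define D where "D a i y = (if a = i then 1 else 0) + pd i (p a) y" for a i and y :: "real^'n"
  have sp: "smooth_on ?B (p a)" for a by (rule smooth_on_subset[OF p(1)]) simp
  have \<theta>0: "\<theta> 0 = z0" by (simp add: \<theta> p vec_eq_iff)
  have s\<theta>: "smooth_on ?B \<theta>"
    unfolding \<theta> smooth_on_vec_iff[OF B(1)] vec_lambda_beta
    by (intro allI smooth_on_add B smooth_on_const smooth_on_vec_nth smooth_on_id sp)
  have D: "pd i (\<lambda>y. \<theta> y $ a) y = D a i y" for a i y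
  proof -
    have dp: "p a differentiable at y" by (rule smooth_on_differentiable[OF p(1)]) simp
    have dl: "((\<lambda>y. z0 $ a + y $ a) has_derivative (\<lambda>v. v $ a)) (at y)"
      by (auto intro!: derivative_eq_intros bounded_linear.has_derivative[OF bounded_linear_vec_nth])
    have "pd i (\<lambda>y. z0 $ a + y $ a) y = (if a = i then 1 else 0)"
      by (simp add: has_derivative_imp_pd[OF dl] axis_def)
    then show ?thesis
      using pd_add[OF differentiableI[OF dl] dp, of i] by (simp add: \<theta> D_def)
  qed
  have sD: "smooth_on ?B (D a i)" for a i
    unfolding D_def by (intro smooth_on_add B smooth_on_const smooth_on_pd sp)
  have D0: "D a i 0 = (if a = i then 1 else 0)" for a i by (simp add: D_def p)
  have pdp: "pd i (p a) differentiable at y" for i a y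
    by (rule smooth_on_differentiable[OF smooth_on_pd[OF p(1)]]) simp
  have D1: "pd k (D a i) y = pd k (pd i (p a)) y" for a i k y
    unfolding D_def by (simp add: pd_add pdp)
  have D1': "pd k (D a i) = pd k (pd i (p a))" for a i k by (rule ext) (rule D1)
  define F where "F a b y = G (\<theta> y) $ a $ b" for a b y
  have sGab: "smooth_on T (\<lambda>z. G z $ a $ b)" for a b by (intro smooth_on_vec_nth sG)
  have \<theta>B: "\<theta> ` ?B \<subseteq> T" using \<theta>T by auto
  have sF: "smooth_on ?B (F a b)" for a b
    unfolding F_def by (rule smooth_on_compose[OF B(1) sG(1) \<theta>B s\<theta> sGab])
  have zT: "z0 \<in> T" using \<theta>T[OF B(2)] \<theta>0 by simp
  have F0: "F a b 0 = G z0 $ a $ b" for a b by (simp add: F_def \<theta>0)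
  have F1: "pd k (F a b) 0 = pd k (\<lambda>z. G z $ a $ b) z0" for a b k
    unfolding F_def
    by (subst pd_compose[OF smooth_on_differentiable[OF s\<theta> B(2)]])
      (auto simp: \<theta>0 D D0 sum_delta_mult intro: smooth_on_differentiable[OF sGab zT])
  have sDD: "smooth_on ?B (\<lambda>y. D a i y * D b j y)" for a b i j by (intro smooth_on_mult B sD)
  have st: "smooth_on ?B (\<lambda>y. (D a i y * D b j y) * F a b y)" for a b i j by (intro smooth_on_mult B sDD sF)
  note d0 = smooth_on_differentiable[OF _ B(2)]
  have DD1: "pd k (\<lambda>y. D a i y * D b j y) 0 = D a i 0 * pd k (D b j) 0 + pd k (D a i) 0 * D b j 0" for a b i j k
    by (intro pd_mult d0[OF sD])
  have t1: "pd k (\<lambda>y. (D a i y * D b j y) * F a b y) 0 = (D a i 0 * D b j 0) * pd k (F a b) 0 +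
    (D a i 0 * pd k (D b j) 0 + pd k (D a i) 0 * D b j 0) * F a b 0" for a b i j k
    using pd_mult[OF d0[OF sDD] d0[OF sF], of k a i b j a b] by (simp only: DD1)
  have G'F: "G' y $ i $ j = (\<Sum>a\<in>UNIV. \<Sum>b\<in>UNIV. (D a i y * D b j y) * F a b y)" if "y \<in> ?B" for y i j
    using G'[OF that] by (simp add: D F_def)
  have "pd k (\<lambda>y. G' y $ i $ j) 0 = pd k (\<lambda>y. \<Sum>a\<in>UNIV. \<Sum>b\<in>UNIV. (D a i y * D b j y) * F a b y) 0"
    by (rule pd_cong[OF B G'F])
  also have "\<dots> = (\<Sum>a\<in>UNIV. \<Sum>b\<in>UNIV. pd k (\<lambda>y. (D a i y * D b j y) * F a b y) 0)"
    by (subst pd_sum, intro d0 smooth_on_sum B st) (simp add: pd_sum d0[OF st])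
  also have "\<dots> = (\<Sum>a\<in>UNIV. \<Sum>b\<in>UNIV. (D a i 0 * D b j 0) * pd k (F a b) 0) +
     (\<Sum>a\<in>UNIV. \<Sum>b\<in>UNIV. D a i 0 * (pd k (D b j) 0 * F a b 0)) +
     (\<Sum>a\<in>UNIV. \<Sum>b\<in>UNIV. D b j 0 * (pd k (D a i) 0 * F a b 0))"
    unfolding t1 by (simp add: algebra_simps sum.distrib)
  also have "\<dots> = pd k (F i j) 0 + (\<Sum>b\<in>UNIV. pd k (D b j) 0 * F i b 0) + (\<Sum>a\<in>UNIV. pd k (D a i) 0 * F a j 0)"
    unfolding D0 mult.assoc sum_distrib_left[symmetric] sum_delta_mult ..
  finally show "pd k (\<lambda>y. G' y $ i $ j) 0 = pd k (\<lambda>z. G z $ i $ j) z0 +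
      (\<Sum>b\<in>UNIV. pd k (pd j (p b)) 0 * G z0 $ i $ b) + (\<Sum>a\<in>UNIV. pd k (pd i (p a)) 0 * G z0 $ a $ j)"
    by (simp add: F1 F0 D1)
  assume p2: "\<And>a i k. pd k (pd i (p a)) 0 = 0" and G1: "\<And>a b k. pd k (\<lambda>z. G z $ a $ b) z0 = 0"
  have F2: "pd l (pd k (F a b)) 0 = pd l (pd k (\<lambda>z. G z $ a $ b)) z0" for a b k l
  proof -
    \<comment> \<open>Subtracting the value at z0 gives a function with zero 1-jet there, so that
      \<open>vanishes2_compose\<close> applies.\<close>
    define u where "u z = G z $ a $ b + (- G z0 $ a $ b)" for z
    have su: "smooth_on T u" unfolding u_def by (intro smooth_on_add sG(1) sGab smooth_on_const)
    have u1: "pd k u z = pd k (\<lambda>z. G z $ a $ b) z" if "z \<in> T" for z k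
      unfolding u_def by (subst pd_add) (auto intro: smooth_on_differentiable[OF sGab that])
    have "vanishes2 u (\<theta> 0)" using u1[OF zT] by (simp add: vanishes2_def \<theta>0 G1) (simp add: u_def)
    from vanishes2_compose(2)[OF B(1) s\<theta> B(2) sG(1) su \<theta>B this, of l k]
    have "pd l (pd k (\<lambda>y. u (\<theta> y))) 0 = pd l (pd k u) z0"
      unfolding D D0 \<theta>0 by (simp add: sum_delta_mult)
    moreover have "pd l (pd k u) z0 = pd l (pd k (\<lambda>z. G z $ a $ b)) z0"
      by (rule pd_cong[OF sG(1) zT u1])
    moreover have "pd k (\<lambda>y. u (\<theta> y)) y = pd k (F a b) y" if "y \<in> ?B" for y
      unfolding u_def F_def[symmetric] by (subst pd_add) (auto intro: smooth_on_differentiable[OF sF that])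
    then have "pd l (pd k (\<lambda>y. u (\<theta> y))) 0 = pd l (pd k (F a b)) 0"
      by (rule pd_cong[OF B])
    ultimately show ?thesis by simp
  qed
  have DD2: "pd l (pd k (\<lambda>y. D a i y * D b j y)) 0 =
    D a i 0 * pd l (pd k (D b j)) 0 + pd l (pd k (D a i)) 0 * D b j 0" for a b i j k l
    using smooth_pd2_mult[OF B(1) sD sD B(2)] by (simp add: D1 p2)
  have t2: "pd l (pd k (\<lambda>y. (D a i y * D b j y) * F a b y)) 0 = (D a i 0 * D b j 0) * pd l (pd k (F a b)) 0 +
    (D a i 0 * pd l (pd k (D b j)) 0 + pd l (pd k (D a i)) 0 * D b j 0) * F a b 0" for a b i j k l
    using smooth_pd2_mult[OF B(1) sDD sF B(2)] by (simp add: DD1 DD2 D1 p2)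
  have "pd l (pd k (\<lambda>y. G' y $ i $ j)) 0 = pd l (pd k (\<lambda>y. \<Sum>a\<in>UNIV. \<Sum>b\<in>UNIV. (D a i y * D b j y) * F a b y)) 0"
    by (intro pd_cong[OF B] pd_cong[OF B(1)] G'F)
  also have "\<dots> = (\<Sum>a\<in>UNIV. pd l (pd k (\<lambda>y. \<Sum>b\<in>UNIV. (D a i y * D b j y) * F a b y)) 0)"
    by (rule smooth_pd2_sum[OF B(1) _ B(2)]) (intro smooth_on_sum B st)
  also have "\<dots> = (\<Sum>a\<in>UNIV. \<Sum>b\<in>UNIV. pd l (pd k (\<lambda>y. (D a i y * D b j y) * F a b y)) 0)"
    by (intro sum.cong refl smooth_pd2_sum[OF B(1) st B(2)])
  also have "\<dots> = (\<Sum>a\<in>UNIV. \<Sum>b\<in>UNIV. (D a i 0 * D b j 0) * pd l (pd k (F a b)) 0) +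
     (\<Sum>a\<in>UNIV. \<Sum>b\<in>UNIV. D a i 0 * (pd l (pd k (D b j)) 0 * F a b 0)) +
     (\<Sum>a\<in>UNIV. \<Sum>b\<in>UNIV. D b j 0 * (pd l (pd k (D a i)) 0 * F a b 0))"
    unfolding t2 by (simp add: algebra_simps sum.distrib)
  also have "\<dots> = pd l (pd k (F i j)) 0 + (\<Sum>b\<in>UNIV. pd l (pd k (D b j)) 0 * F i b 0) + (\<Sum>a\<in>UNIV. pd l (pd k (D a i)) 0 * F a j 0)"
    unfolding D0 mult.assoc sum_distrib_left[symmetric] sum_delta_mult ..
  finally show "pd l (pd k (\<lambda>y. G' y $ i $ j)) 0 = pd l (pd k (\<lambda>z. G z $ i $ j)) z0 +
      (\<Sum>b\<in>UNIV. pd l (pd k (pd j (p b))) 0 * G z0 $ i $ b) + (\<Sum>a\<in>UNIV. pd l (pd k (pd i (p a))) 0 * G z0 $ a $ j)"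
    by (simp add: F2 F0 D1')
qed

text \<open>One predicate for two uses: the unconditional clause on first derivatives serves the
  quadratic change, and the implication serves the cubic change, made once the first derivatives are
  gone.\<close>

definition reparametrized_at ::
  "('x, 'n) metric \<Rightarrow> 'x \<Rightarrow> ('x, 'n) chart \<Rightarrow> ('n \<Rightarrow> real^'n \<Rightarrow> real) \<Rightarrow> real \<Rightarrow> ('x, 'n) chart \<Rightarrow> bool" where
  "reparametrized_at g x c p e d \<longleftrightarrow> snd d x = 0 \<and> snd d ` fst d = ball 0 e \<and> jac d c x = mat 1 \<and>
    (\<forall>i j k. pd k (\<lambda>y. metric_coords g d y $ i $ j) 0 = pd k (\<lambda>z. metric_coords g c z $ i $ j) (snd c x) +
      (\<Sum>b\<in>UNIV. pd k (pd j (p b)) 0 * g x c $ i $ b) + (\<Sum>a\<in>UNIV. pd k (pd i (p a)) 0 * g x c $ a $ j)) \<and>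
    ((\<forall>a i k. pd k (pd i (p a)) 0 = 0) \<and> (\<forall>a b k. pd k (\<lambda>z. metric_coords g c z $ a $ b) (snd c x) = 0) \<longrightarrow>
      (\<forall>i j k l. pd l (pd k (\<lambda>y. metric_coords g d y $ i $ j)) 0 = pd l (pd k (\<lambda>z. metric_coords g c z $ i $ j)) (snd c x) +
      (\<Sum>b\<in>UNIV. pd l (pd k (pd j (p b))) 0 * g x c $ i $ b) + (\<Sum>a\<in>UNIV. pd l (pd k (pd i (p a))) 0 * g x c $ a $ j)))"

lemma ex_reparametrized_chart:
  fixes p :: "'n \<Rightarrow> real^'n \<Rightarrow> real"
  assumes g: "metric_on A r W g" "x \<in> W" and c: "c \<in> charts_at A x"
    and p: "\<And>a. smooth_on UNIV (p a)" "\<And>a. p a 0 = 0" "\<And>a i. pd i (p a) 0 = 0"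
  shows "\<exists>e0>0. \<forall>e. 0 < e \<and> e \<le> e0 \<longrightarrow> (\<exists>d\<in>charts_at A x. reparametrized_at g x c p e d)"
proof -
  note m = charts_atD[OF c]
  define \<theta> where "\<theta> y = (\<chi> a. snd c x $ a + y $ a + p a y)" for y
  have W: "open W" using g by (simp add: metric_on_def)
  have s\<theta>: "smooth_on UNIV \<theta>"
    unfolding \<theta>_def smooth_on_vec_iff[OF open_UNIV] vec_lambda_beta
    by (intro allI smooth_on_add open_UNIV smooth_on_const smooth_on_vec_nth smooth_on_id p)
  have \<theta>0: "\<theta> 0 = snd c x" by (simp add: \<theta>_def p vec_eq_iff)
  have D: "pd i (\<lambda>y. \<theta> y $ a) 0 = (if a = i then 1 else 0)" for i a
  proof -
    have dp: "p a differentiable at 0" by (rule smooth_on_differentiable[OF p(1)]) simp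
    have dl: "((\<lambda>y. snd c x $ a + y $ a) has_derivative (\<lambda>v. v $ a)) (at 0)"
      by (auto intro!: derivative_eq_intros bounded_linear.has_derivative[OF bounded_linear_vec_nth])
    have "pd i (\<lambda>y. snd c x $ a + y $ a) 0 = (if a = i then 1 else 0)"
      by (simp add: has_derivative_imp_pd[OF dl] axis_def)
    then show ?thesis
      using pd_add[OF differentiableI[OF dl] dp, of i] by (simp add: \<theta>_def p)
  qed
  let ?T = "snd c ` (fst c \<inter> W)"
  have T: "open ?T" by (rule open_image_Int[OF m(1) W])
  obtain e0 where e0: "e0 > 0" and ex: "\<And>e. 0 < e \<and> e \<le> e0 \<Longrightarrow> (\<exists>d\<in>charts_at A x. snd d x = 0 \<and> snd d ` fst d = ball 0 e \<and>
    fst d \<subseteq> fst c \<inter> W \<and> (\<forall>y\<in>ball 0 e. chart_inv d y = chart_inv c (\<theta> y) \<and> \<theta> y \<in> ?T) \<and>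
    jac d c x = mat 1)"
    using ex_chart_with_parametrization[OF c W g(2) s\<theta> \<theta>0 D] by blast
  show ?thesis
  proof (intro exI[of _ e0] conjI allI impI e0)
    fix e :: real assume e: "0 < e \<and> e \<le> e0"
    from ex[OF e] obtain d where d: "d \<in> charts_at A x" "snd d x = 0" "snd d ` fst d = ball 0 e"
      "fst d \<subseteq> fst c \<inter> W" and \<theta>d: "\<And>y. y \<in> ball 0 e \<Longrightarrow> chart_inv d y = chart_inv c (\<theta> y)"
      "\<And>y. y \<in> ball 0 e \<Longrightarrow> \<theta> y \<in> ?T" and j: "jac d c x = mat 1" by blast
    have G': "metric_coords g d y $ i $ j = (\<Sum>a\<in>UNIV. \<Sum>b\<in>UNIV.
      (pd i (\<lambda>y. \<theta> y $ a) y * pd j (\<lambda>y. \<theta> y $ b) y) * metric_coords g c (\<theta> y) $ a $ b)" if "y \<in> ball 0 e" for y i j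
      by (rule metric_coords_reparametrized[OF g(1) m(1) charts_atD(1)[OF d(1)] d(3,4) \<theta>d that])
    note rd = reparametrized_derivatives[OF conjunct1[OF e] T metric_coords_smooth[OF g(1) m(1)] \<theta>d(2) \<theta>_def p G',
      unfolded metric_coords_at[OF c]]
    show "\<exists>d\<in>charts_at A x. reparametrized_at g x c p e d"
      unfolding reparametrized_at_def using d j rd by (intro bexI[of _ d]) auto
  qed
qed

lemma metric_coords_nth_sym:
  assumes "metric_on A r W g" "c \<in> A" "z \<in> snd c ` (fst c \<inter> W)"
  shows "metric_coords g c z $ i $ j = metric_coords g c z $ j $ i"
  using has_signature_symmetric[OF metric_coords_signature[OF assms]]
  by (simp add: vec_eq_iff transpose_def)

lemma metric_derivatives_sym:
  assumes g: "metric_on A r W g" "x \<in> W" and c: "c \<in> charts_at A x"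
  shows "pd k (\<lambda>z. metric_coords g c z $ j $ i) (snd c x) = pd k (\<lambda>z. metric_coords g c z $ i $ j) (snd c x)"
    "pd l (pd k (\<lambda>z. metric_coords g c z $ j $ i)) (snd c x) = pd l (pd k (\<lambda>z. metric_coords g c z $ i $ j)) (snd c x)"
    "pd l (pd k (\<lambda>z. metric_coords g c z $ i $ j)) (snd c x) = pd k (pd l (\<lambda>z. metric_coords g c z $ i $ j)) (snd c x)"
proof -
  note m = charts_atD[OF c]
  let ?T = "snd c ` (fst c \<inter> W)"
  have W: "open W" using g by (simp add: metric_on_def)
  have T: "open ?T" "snd c x \<in> ?T" using open_image_Int[OF m(1) W] m g by auto
  note s = metric_coords_nth_sym[OF g(1) m(1)]
  show "pd k (\<lambda>z. metric_coords g c z $ j $ i) (snd c x) = pd k (\<lambda>z. metric_coords g c z $ i $ j) (snd c x)"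
    by (rule pd_cong[OF T s])
  show "pd l (pd k (\<lambda>z. metric_coords g c z $ j $ i)) (snd c x) = pd l (pd k (\<lambda>z. metric_coords g c z $ i $ j)) (snd c x)"
    by (intro pd_cong[OF T] pd_cong[OF T(1)] s)
  have "smooth_on ?T (\<lambda>z. metric_coords g c z $ i $ j)"
    by (intro smooth_on_vec_nth T metric_coords_smooth[OF g(1) m(1)])
  then show "pd l (pd k (\<lambda>z. metric_coords g c z $ i $ j)) (snd c x) = pd k (pd l (\<lambda>z. metric_coords g c z $ i $ j)) (snd c x)"
    by (rule pd_commute[OF T(1) _ T(2)])
qed

lemma ex_chart_first_derivatives_zero:
  assumes g: "metric_on A r W g" "x \<in> W" and c: "c \<in> charts_at A x"
  obtains d where "d \<in> charts_at A x" "snd d x = 0" "jac d c x = mat 1"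
    "\<And>i j k. pd k (\<lambda>y. metric_coords g d y $ i $ j) 0 = 0"
proof -
  have gx: "g x \<in> metrics_at A r x" using g by (simp add: metric_on_def)
  note sg = metrics_at_signature[OF gx c]
  have Bs: "g x c $ a $ b = g x c $ b $ a" for a b
    using has_signature_symmetric[OF sg] by (simp add: vec_eq_iff transpose_def)
  obtain q where q: "\<And>h i. (\<Sum>b\<in>UNIV. g x c $ i $ b * q h b) = h i"
    by (rule matrix_inverse_solution[OF has_signature_invertible[OF sg]]) blast
  have q': "(\<Sum>b\<in>UNIV. q h b * g x c $ i $ b) = h i" for h i
    using q[of i h] by (simp add: mult.commute)
  have q'': "(\<Sum>a\<in>UNIV. q h a * g x c $ a $ j) = h j" for h j
    using q'[of h j] by (simp add: Bs[of j])
  define P where "P i j k = pd k (\<lambda>z. metric_coords g c z $ i $ j) (snd c x)" for i j k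
  have Ps: "P j i k = P i j k" for i j k unfolding P_def by (rule metric_derivatives_sym[OF g c])
  \<comment> \<open>As P i j k is the k-th derivative of the component ij, h is minus the
    Christoffel symbol of the first kind at x. Raising its index with the inverse of gx gives Q,
    minus the Christoffel symbol itself: the classical quadratic change that kills the first
    derivatives.\<close>
  define h where "h j k i = - (P i j k + P i k j - P j k i) / 2" for i j k
  define Q where "Q a j k = q (h j k) a" for a j k
  have hs: "h j k = h k j" for j k by (rule ext) (simp add: h_def Ps)
  then have Qs: "Q a j k = Q a k j" for a j k by (simp add: Q_def)
  have p: "smooth_on UNIV (quad (Q a) 0)" "quad (Q a) 0 0 = 0" "pd i (quad (Q a) 0) 0 = 0" for a i
    using Qs by (simp_all add: smooth_quad quad_0)
  obtain e0 d0 where "d0 \<in> charts_at A x" "reparametrized_at g x c (\<lambda>a. quad (Q a) 0) e0 d0"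
    using ex_reparametrized_chart[where p="\<lambda>a. quad (Q a) 0", OF g c p] by blast
  then obtain d where d: "d \<in> charts_at A x" "snd d x = 0" "jac d c x = mat 1"
    and D: "\<And>i j k. pd k (\<lambda>y. metric_coords g d y $ i $ j) 0 = P i j k +
      (\<Sum>b\<in>UNIV. pd k (pd j (quad (Q b) 0)) 0 * g x c $ i $ b) + (\<Sum>a\<in>UNIV. pd k (pd i (quad (Q a) 0)) 0 * g x c $ a $ j)"
    unfolding P_def reparametrized_at_def by blast
  have "pd k (\<lambda>y. metric_coords g d y $ i $ j) 0 = 0" for i j k
  proof -
    have "pd k (pd j (quad (Q b) 0)) 0 = Q b j k" for b j k by (rule pd2_quad) (rule Qs)
    then have "pd k (\<lambda>y. metric_coords g d y $ i $ j) 0 = P i j k +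
      (\<Sum>b\<in>UNIV. q (h j k) b * g x c $ i $ b) + (\<Sum>a\<in>UNIV. q (h i k) a * g x c $ a $ j)"
      by (simp add: D Q_def)
    then show ?thesis using Ps[of j i k] Ps[of i k j] Ps[of j k i] unfolding q' q'' by (simp add: h_def field_simps)
  qed
  then show thesis using that d by blast
qed

lemma ex_chart_normal_second_derivatives:
  assumes g: "metric_on A r W g" "x \<in> W" and c: "c \<in> charts_at A x"
    and P0: "\<And>a b k. pd k (\<lambda>z. metric_coords g c z $ a $ b) (snd c x) = 0"
    and M: "\<And>i j k l. M [i, j, k, l] = pd l (pd k (\<lambda>z. metric_coords g c z $ i $ j)) (snd c x)"
  shows "\<exists>e0>0. \<forall>e. 0 < e \<and> e \<le> e0 \<longrightarrow> (\<exists>d\<in>charts_at A x. snd d x = 0 \<and> snd d ` fst d = ball 0 e \<and>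
    jac d c x = mat 1 \<and> (\<forall>i j k. pd k (\<lambda>y. metric_coords g d y $ i $ j) 0 = 0) \<and>
    (\<forall>i j k l. pd l (pd k (\<lambda>y. metric_coords g d y $ i $ j)) 0 = normal_part M [i, j, k, l]))"
proof -
  have gx: "g x \<in> metrics_at A r x" using g by (simp add: metric_on_def)
  note sg = metrics_at_signature[OF gx c]
  have Bs: "g x c $ a $ b = g x c $ b $ a" for a b
    using has_signature_symmetric[OF sg] by (simp add: vec_eq_iff transpose_def)
  obtain q where q: "\<And>h i. (\<Sum>b\<in>UNIV. g x c $ i $ b * q h b) = h i"
    by (rule matrix_inverse_solution[OF has_signature_invertible[OF sg]]) blast
  have q': "(\<Sum>b\<in>UNIV. q h b * g x c $ i $ b) = h i" for h i
    using q[of i h] by (simp add: mult.commute)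
  have q'': "(\<Sum>a\<in>UNIV. q h a * g x c $ a $ j) = h j" for h j
    using q'[of h j] by (simp add: Bs[of j])
  have Ms1: "M [j, i, k, l] = M [i, j, k, l]" for i j k l unfolding M by (rule metric_derivatives_sym[OF g c])
  have Ms2: "M [i, j, l, k] = M [i, j, k, l]" for i j k l unfolding M by (rule metric_derivatives_sym[OF g c])
  \<comment> \<open>The cubic coefficients with lowered index. Write h_i for
    \<open>h j k l i\<close> and S_i for M ijkl + M ikjl + M iljk. The new second derivatives are M
    ijkl + h_i + h_j; their cyclic sums over j, k, l vanish iff S_i + 2 h_i + t = 0, where t is the
    sum of h over the four choices of the distinguished index. Adding the four equations gives t =
    -(S_i + S_j + S_k + S_l) / 6, and with it this h.\<close>
  define h where "h j k l i = - (M [i, j, k, l] + M [i, k, j, l] + M [i, l, j, k]) / 3 +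
    (M [k, l, i, j] + M [j, l, i, k] + M [j, k, i, l]) / 6" for i j k l
  define C where "C a j k l = q (h j k l) a" for a j k l
  have hs: "h j k l = h k j l" "h j k l = h j l k" for j k l
  proof -
    show "h j k l = h k j l"
      by (rule ext) (simp add: h_def Ms1[of j k] Ms2[of _ _ j k] Ms2[of _ _ l j] Ms2[of _ _ l k] algebra_simps)
    show "h j k l = h j l k"
      by (rule ext) (simp add: h_def Ms1[of k l] Ms2[of _ _ k l] algebra_simps)
  qed
  then have Cs: "C a k l m = C a l k m" "C a k l m = C a k m l" for a k l m by (simp_all add: C_def)
  note c0 = cubic_0[of "C a" for a, OF Cs]
  have p: "smooth_on UNIV (cubic (C a) 0)" "cubic (C a) 0 0 = 0" "pd i (cubic (C a) 0) 0 = 0" for a i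
    using c0 by (simp_all add: smooth_cubic)
  obtain e0 where "e0 > 0" and e: "\<And>e. 0 < e \<and> e \<le> e0 \<Longrightarrow> \<exists>d\<in>charts_at A x. reparametrized_at g x c (\<lambda>a. cubic (C a) 0) e d"
    using ex_reparametrized_chart[where p="\<lambda>a. cubic (C a) 0", OF g c p] by blast
  show ?thesis
  proof (intro exI[of _ e0] conjI allI impI \<open>e0 > 0\<close>)
    fix e1 :: real assume e1: "0 < e1 \<and> e1 \<le> e0"
    from e[OF e1] obtain d where d: "d \<in> charts_at A x" "snd d x = 0" "snd d ` fst d = ball 0 e1" "jac d c x = mat 1"
      and D: "\<And>i j k. pd k (\<lambda>y. metric_coords g d y $ i $ j) 0 = 0"
      and D2: "\<And>i j k l. pd l (pd k (\<lambda>y. metric_coords g d y $ i $ j)) 0 = M [i, j, k, l] +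
      (\<Sum>b\<in>UNIV. C b j k l * g x c $ i $ b) + (\<Sum>a\<in>UNIV. C a i k l * g x c $ a $ j)"
      by (auto simp: P0 c0 M reparametrized_at_def)
    have "pd l (pd k (\<lambda>y. metric_coords g d y $ i $ j)) 0 = normal_part M [i, j, k, l]" for i j k l
    proof -
      have "pd l (pd k (\<lambda>y. metric_coords g d y $ i $ j)) 0 = M [i, j, k, l] +
        (\<Sum>b\<in>UNIV. q (h j k l) b * g x c $ i $ b) + (\<Sum>a\<in>UNIV. q (h i k l) a * g x c $ a $ j)"
        by (simp add: D2 C_def)
      also have "\<dots> = M [i, j, k, l] + h j k l i + h i k l j" unfolding q' q'' ..
      also have "\<dots> = normal_part M [i, j, k, l]"
        unfolding h_def normal_part_4
        by (simp add: Ms1[of i j] Ms1[of j k] Ms1[of j l] Ms1[of i k] Ms1[of i l] Ms1[of k l]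
          Ms2[of _ _ i j] Ms2[of _ _ j k] Ms2[of _ _ j l] Ms2[of _ _ i k] Ms2[of _ _ i l] field_simps)
      finally show ?thesis .
    qed
    then show "\<exists>d\<in>charts_at A x. snd d x = 0 \<and> snd d ` fst d = ball 0 e1 \<and>
      jac d c x = mat 1 \<and> (\<forall>i j k. pd k (\<lambda>y. metric_coords g d y $ i $ j) 0 = 0) \<and>
      (\<forall>i j k l. pd l (pd k (\<lambda>y. metric_coords g d y $ i $ j)) 0 = normal_part M [i, j, k, l])"
      using d D by (intro bexI[of _ d]) auto
  qed
qed

text \<open>The coordinates of the metric \<open>B $ i $ j + (\<Sum>k l. N [i, j, k, l] * y $ k * y $ l) / 2\<close> are normal
  because \<open>N\<close> is a normal tensor; hence no exponential map is needed to realize a jet in normal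
  coordinates.\<close>

lemma quadratic_metric_geodesic:
  fixes N :: "'n list \<Rightarrow> real" and B :: "real^'n^'n"
  assumes s1: "\<And>i j k l. N [j, i, k, l] = N [i, j, k, l]" and s2: "\<And>i j k l. N [i, j, l, k] = N [i, j, k, l]"
    and cyc: "\<And>i j k l. N [i, j, k, l] + N [i, k, j, l] + N [i, l, j, k] = 0"
    and G: "\<And>y i j. y \<in> ball 0 e \<Longrightarrow> G y $ i $ j = B $ i $ j + quad (\<lambda>k l. N [i, j, k, l]) 0 y"
    and v: "v \<in> ball 0 e"
  shows "is_geodesic G (\<lambda>t. t *\<^sub>R v)"
proof -
  have pdG: "pd k (\<lambda>z. G z $ i $ j) y = (\<Sum>m\<in>UNIV. N [i, j, k, m] * y $ m)" if "y \<in> ball 0 e" for y i j k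
  proof -
    have "pd k (\<lambda>z. G z $ i $ j) y = pd k (\<lambda>y. B $ i $ j + quad (\<lambda>k l. N [i, j, k, l]) 0 y) y"
      by (rule pd_cong[OF open_ball that G])
    also have "\<dots> = pd k (quad (\<lambda>k l. N [i, j, k, l]) 0) y"
      by (subst pd_add) (auto intro: smooth_on_differentiable[OF smooth_quad[OF open_UNIV]])
    also have "\<dots> = (\<Sum>m\<in>UNIV. N [i, j, k, m] * y $ m)"
      by (subst pd_quad) (auto simp: s2)
    finally show ?thesis .
  qed
  have chr: "(\<Sum>i\<in>UNIV. \<Sum>j\<in>UNIV. christoffel G (t *\<^sub>R v) k i j * v $ i * v $ j) = 0"
    if t: "t \<in> {0..1}" for t k
  proof -
    have tv: "t *\<^sub>R v \<in> ball 0 e"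
    proof -
      have "norm (t *\<^sub>R v) \<le> 1 * norm v" using t by (simp add: mult_left_le_one_le)
      then show ?thesis using v by simp
    qed
    \<comment> \<open>The bracket inside \<open>christoffel\<close> at t v. Its contraction with two
      copies of v is a combination of the sums in \<open>normal_contraction\<close>.\<close>
    define X where "X i j l = (\<Sum>m\<in>UNIV. N [j, l, i, m] * (t * v $ m)) + (\<Sum>m\<in>UNIV. N [i, l, j, m] * (t * v $ m)) -
      (\<Sum>m\<in>UNIV. N [i, j, l, m] * (t * v $ m))" for i j l
    have X: "(\<Sum>i\<in>UNIV. \<Sum>j\<in>UNIV. X i j l * v $ i * v $ j) = 0" for l
    proof -
      note z = normal_contraction[where N=N and v="\<lambda>m. v $ m", OF s1 s2 cyc]
      have a: "(\<Sum>i\<in>UNIV. \<Sum>j\<in>UNIV. \<Sum>m\<in>UNIV. N [i, l, j, m] * v $ i * v $ j * v $ m) = 0"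
        using z(1)[of l] by (simp add: s1[of l])
      have b: "(\<Sum>i\<in>UNIV. \<Sum>j\<in>UNIV. \<Sum>m\<in>UNIV. N [j, l, i, m] * v $ i * v $ j * v $ m) = 0"
        using a by (subst sum.swap) (simp add: mult_ac)
      have "(\<Sum>i\<in>UNIV. \<Sum>j\<in>UNIV. X i j l * v $ i * v $ j) =
        t * (\<Sum>i\<in>UNIV. \<Sum>j\<in>UNIV. \<Sum>m\<in>UNIV. N [j, l, i, m] * v $ i * v $ j * v $ m) +
        t * (\<Sum>i\<in>UNIV. \<Sum>j\<in>UNIV. \<Sum>m\<in>UNIV. N [i, l, j, m] * v $ i * v $ j * v $ m) -
        t * (\<Sum>i\<in>UNIV. \<Sum>j\<in>UNIV. \<Sum>m\<in>UNIV. N [i, j, l, m] * v $ i * v $ j * v $ m)"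
        by (simp add: X_def sum_distrib_left sum_distrib_right sum.distrib sum_subtractf algebra_simps)
      then show ?thesis unfolding a b z(2) by simp
    qed
    have "christoffel G (t *\<^sub>R v) k i j = (\<Sum>l\<in>UNIV. matrix_inv (G (t *\<^sub>R v)) $ k $ l * X i j l) / 2" for i j
      by (simp add: christoffel_def pdG[OF tv] X_def)
    then have "(\<Sum>i\<in>UNIV. \<Sum>j\<in>UNIV. christoffel G (t *\<^sub>R v) k i j * v $ i * v $ j) =
      (\<Sum>i\<in>UNIV. \<Sum>j\<in>UNIV. \<Sum>l\<in>UNIV. matrix_inv (G (t *\<^sub>R v)) $ k $ l / 2 * (X i j l * v $ i * v $ j))"
      by (simp add: sum_distrib_left sum_distrib_right sum_divide_distrib mult_ac)
    also have "\<dots> = (\<Sum>i\<in>UNIV. \<Sum>l\<in>UNIV. \<Sum>j\<in>UNIV. matrix_inv (G (t *\<^sub>R v)) $ k $ l / 2 * (X i j l * v $ i * v $ j))"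
      by (intro sum.cong refl sum.swap)
    also have "\<dots> = (\<Sum>l\<in>UNIV. \<Sum>i\<in>UNIV. \<Sum>j\<in>UNIV. matrix_inv (G (t *\<^sub>R v)) $ k $ l / 2 * (X i j l * v $ i * v $ j))"
      by (rule sum.swap)
    also have "\<dots> = (\<Sum>l\<in>UNIV. matrix_inv (G (t *\<^sub>R v)) $ k $ l / 2 * (\<Sum>i\<in>UNIV. \<Sum>j\<in>UNIV. X i j l * v $ i * v $ j))"
      by (simp only: sum_distrib_left)
    also have "\<dots> = 0" unfolding X by simp
    finally show ?thesis .
  qed
  have "((\<lambda>t. t *\<^sub>R v) has_vector_derivative v) (at t within {0..1})" for t
    by (auto intro!: derivative_eq_intros)
  then show ?thesis
    unfolding is_geodesic_def
    by (intro exI[of _ "\<lambda>_. v"] exI[of _ "\<lambda>_. 0"]) (auto simp: chr)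
qed

text \<open>The chart d comes from the quadratic change, whose purpose is to kill first derivatives;
  adding H does not alter the 1-jet, so d and with it S serve the whole fibre. All Jacobians between
  c, d and d' at x are the identity, so components may be compared freely among these
  charts.\<close>

lemma normal_form:
  assumes g: "metric_on A r W g" "x \<in> W" and c: "c \<in> charts_at A x"
  obtains S where "S \<in> S22 A x"
    "\<And>H. H \<in> S22 A x \<Longrightarrow> \<exists>W' g' N. metric_on A r W' g' \<and> x \<in> W' \<and> jet2 A g' x = jet_add (jet2 A g x) H \<and>
      is_normal_tensor A W' g' x N \<and> N \<in> normal_tensors A x \<and>
      (\<forall>I. length I = 4 \<longrightarrow> N c I = normal_part (\<lambda>I. S c I + H c I) I)"
proof -
  obtain d where d: "d \<in> charts_at A x" "snd d x = 0" "jac d c x = mat 1"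
    and d1: "\<And>i j k. pd k (\<lambda>y. metric_coords g d y $ i $ j) 0 = 0"
    by (rule ex_chart_first_derivatives_zero[OF g c]) blast
  have jcd: "jac c d x = mat 1" using jac_inverse[OF c d(1)] d(3) by simp
  define s where "s I = pd (I ! 3) (pd (I ! 2) (\<lambda>y. metric_coords g d y $ (I ! 0) $ (I ! 1))) 0" for I
  define S where "S = cotensor_of d 4 x s"
  have S: "S \<in> cotensors A 4 x" unfolding S_def by (rule cotensor_of_mem[OF d(1)])
  have Sd: "S d [i, j, k, l] = pd l (pd k (\<lambda>y. metric_coords g d y $ i $ j)) 0" for i j k l
    by (simp add: S_def cotensor_of_self[OF d(1)] s_def)
  note sy = metric_derivatives_sym[OF g d(1), unfolded d(2)]
  have S22: "S \<in> S22 A x"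
    by (rule S22I[OF S d(1)]) (simp_all only: Sd sy(2), rule sy(3))
  show thesis
  proof (rule that[OF S22])
    fix H assume H: "H \<in> S22 A x"
    have "jet_add (jet2 A g x) H \<in> J2M A r"
      using jet_add_mem[OF J2MI[OF g]] H by simp
    then obtain W1 g1 where j1: "jet_add (jet2 A g x) H = jet2 A g1 x" and g1: "metric_on A r W1 g1" "x \<in> W1"
      by (elim J2ME) auto
    define M where "M I = S d I + H d I" for I
    have "snd (jet_add (jet2 A g x) H) d = snd (jet2 A g1 x) d" using j1 by simp
    then have e: "metric_coords g d 0 = metric_coords g1 d 0"
      "(\<chi> i j k. pd k (\<lambda>z. metric_coords g d z $ i $ j) 0) = (\<chi> i j k. pd k (\<lambda>z. metric_coords g1 d z $ i $ j) 0)"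
      "(\<chi> i j k l. pd l (pd k (\<lambda>z. metric_coords g d z $ i $ j)) 0) + (\<chi> a b e f. H d [a, b, e, f]) =
       (\<chi> i j k l. pd l (pd k (\<lambda>z. metric_coords g1 d z $ i $ j)) 0)"
      unfolding jet_add_def snd_conv jet2_snd[OF d(1)] d(2) fst_conv by (simp_all only: prod.inject)
    have P0: "pd k (\<lambda>z. metric_coords g1 d z $ i $ j) (snd d x) = 0" for i j k
      using arg_cong[OF e(2), of "\<lambda>v. v $ i $ j $ k"] by (simp add: d1 d(2))
    have M2: "M [i, j, k, l] = pd l (pd k (\<lambda>z. metric_coords g1 d z $ i $ j)) (snd d x)" for i j k l
      using arg_cong[OF e(3), of "\<lambda>v. v $ i $ j $ k $ l"] by (simp add: M_def Sd d(2))
    define n where "n = normal_part M"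
    have Ms: "M [j, i, k, l] = M [i, j, k, l]" "M [i, j, l, k] = M [i, j, k, l]" for i j k l
      using S22_sym[OF S22] S22_sym[OF H] by (simp_all add: M_def)
    note ns = normal_part_sym[of M, OF Ms, folded n_def]
    obtain e0 where e0: "e0 > 0" and ex: "\<And>e. 0 < e \<and> e \<le> e0 \<Longrightarrow> (\<exists>d'\<in>charts_at A x. snd d' x = 0 \<and> snd d' ` fst d' = ball 0 e \<and>
      jac d' d x = mat 1 \<and> (\<forall>i j k. pd k (\<lambda>y. metric_coords g1 d' y $ i $ j) 0 = 0) \<and>
      (\<forall>i j k l. pd l (pd k (\<lambda>y. metric_coords g1 d' y $ i $ j)) 0 = n [i, j, k, l]))"
      using ex_chart_normal_second_derivatives[OF g1 d(1) P0 M2] unfolding n_def by blast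
    have g1x: "g1 x \<in> metrics_at A r x" using g1 by (simp add: metric_on_def)
    define B where "B = g1 x d"
    have Bs: "has_signature r B" unfolding B_def by (rule metrics_at_signature[OF g1x d(1)])
    \<comment> \<open>In d' the metric g1 has the required 2-jet, but rays need not be geodesics for
      it. It is replaced by the metric with quadratic components and the same 2-jet, for which d' is
      a normal chart.\<close>
    define G where "G y = (\<chi> i j. B $ i $ j + quad (\<lambda>k l. n [i, j, k, l]) 0 y)" for y
    have G0: "G 0 = B" by (simp add: G_def quad_0 vec_eq_iff)
    have sG: "smooth_on UNIV G"
      unfolding G_def smooth_on_vec_iff[OF open_UNIV] vec_lambda_beta
      by (intro allI smooth_on_add open_UNIV smooth_on_const smooth_quad)
    have Gs: "transpose (G y) = G y" for y
      using has_signature_symmetric[OF Bs] ns by (simp add: G_def vec_eq_iff transpose_def)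
    obtain O' where O': "open O'" "B \<in> O'" "\<And>B'. B' \<in> O' \<Longrightarrow> transpose B' = B' \<Longrightarrow> has_signature r B'"
      by (rule has_signature_open[OF Bs]) blast
    have "open (G -` O')" by (rule open_vimage[OF O'(1) smooth_on_continuous_on[OF sG]])
    moreover have "0 \<in> G -` O'" using O' G0 by simp
    ultimately obtain e1 where e1: "e1 > 0" "ball 0 e1 \<subseteq> G -` O'" using open_contains_ball by blast
    \<comment> \<open>The chart d' exists for radii up to e0, and G has the right signature on the
      ball of radius e1.\<close>
    define e where "e = min e0 e1"
    have e: "0 < e \<and> e \<le> e0" "ball 0 e \<subseteq> G -` O'" using e0 e1 by (auto simp: e_def subset_iff)
    from ex[OF e(1)] obtain d' where d': "d' \<in> charts_at A x" "snd d' x = 0" "snd d' ` fst d' = ball 0 e" "jac d' d x = mat 1"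
      and D1: "\<And>i j k. pd k (\<lambda>y. metric_coords g1 d' y $ i $ j) 0 = 0"
      and D2: "\<And>i j k l. pd l (pd k (\<lambda>y. metric_coords g1 d' y $ i $ j)) 0 = n [i, j, k, l]" by blast
    note m' = charts_atD[OF d'(1)]
    have sig: "has_signature r (G y)" if "y \<in> ball 0 e" for y using O'(3)[OF _ Gs] that e(2) by blast
    have im: "ball 0 e \<subseteq> snd d' ` fst d'" using d'(3) by simp
    note mo = metric_of[OF m'(1) open_ball im smooth_on_subset[OF sG subset_UNIV] sig]
    define g' where "g' = metric_of d' G"
    define W' where "W' = {z \<in> fst d'. snd d' z \<in> ball 0 e}"
    have W': "W' = fst d'" using d'(3) by (auto simp: W'_def)
    have g': "metric_on A r W' g'" "x \<in> W'" using mo(1) m' W' unfolding g'_def W'_def by simp_all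
    have g'G: "metric_coords g' d' y = G y" if "y \<in> ball 0 e" for y using mo(2)[OF _ that] unfolding g'_def by blast
    have b0: "0 \<in> ball (0::real^'n) e" using e by simp
    have G1: "pd k (\<lambda>z. metric_coords g' d' z $ i $ j) y = pd k (quad (\<lambda>k l. n [i, j, k, l]) 0) y" if "y \<in> ball 0 e" for i j k y
    proof -
      have "pd k (\<lambda>z. metric_coords g' d' z $ i $ j) y = pd k (\<lambda>z. B $ i $ j + quad (\<lambda>k l. n [i, j, k, l]) 0 z) y"
        by (rule pd_cong[OF open_ball that]) (simp add: g'G G_def)
      also have "\<dots> = pd k (quad (\<lambda>k l. n [i, j, k, l]) 0) y"
        by (subst pd_add) (auto intro: smooth_on_differentiable[OF smooth_quad[OF open_UNIV]])
      finally show ?thesis .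
    qed
    have G2: "pd l (pd k (\<lambda>z. metric_coords g' d' z $ i $ j)) 0 = n [i, j, k, l]" for i j k l
    proof -
      have "pd l (pd k (\<lambda>z. metric_coords g' d' z $ i $ j)) 0 = pd l (pd k (quad (\<lambda>k l. n [i, j, k, l]) 0)) 0"
        by (rule pd_cong[OF open_ball b0 G1])
      then show ?thesis by (simp add: pd2_quad ns)
    qed
    have G1': "pd k (\<lambda>z. metric_coords g' d' z $ i $ j) 0 = 0" for i j k
      unfolding G1[OF b0] by (rule quad_0) (simp add: ns)
    have "metric_coords g1 d' 0 = B"
      using metric_transform[OF g1x d(1) d'(1)] d'(4) metric_coords_at[OF d'(1), of g1]
      by (simp add: B_def d'(2))
    then have j': "jet2 A g' x = jet2 A g1 x"
      by (intro jet2_eqI[OF g1 g' d'(1)]) (simp add: jet2_snd[OF d'(1)] d'(2) D1 D2 G1' G2 g'G[OF b0] G0)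
    define N where "N = cotensor_of d' 4 x n"
    have N: "N \<in> cotensors A 4 x" unfolding N_def by (rule cotensor_of_mem[OF d'(1)])
    have Nd': "N d' I = n I" if "length I = 4" for I unfolding N_def by (rule cotensor_of_self[OF d'(1) that])
    have nt: "N \<in> normal_tensors A x"
      by (rule normal_tensorI[OF N d'(1)]) (simp_all add: Nd' ns)
    have geo: "is_geodesic (metric_coords g' d') (\<lambda>t. t *\<^sub>R v)" if "v \<in> ball 0 e" for v
      by (rule quadratic_metric_geodesic[where N=n and B=B and e=e]) (use that ns g'G in \<open>auto simp: G_def\<close>)
    have "normal_chart A W' g' x d'"
      unfolding normal_chart_def d'(3)
    proof (intro conjI ballI d' geo)
      show "fst d' \<subseteq> W'" by (simp add: W')
      fix v :: "real^'n" and t :: real assume v: "v \<in> ball 0 e" and t: "t \<in> {0..1}"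
      have "norm (t *\<^sub>R v) \<le> 1 * norm v" using t by (simp add: mult_left_le_one_le)
      then show "t *\<^sub>R v \<in> ball 0 e" using v by simp
    qed
    then have int: "is_normal_tensor A W' g' x N"
      unfolding is_normal_tensor_def using N
      by (auto simp: Nd' jet2_snd[OF d'(1)] d'(2) G2 intro!: exI[of _ d'])
    have j1c: "jac c d' x = mat 1"
      using jac_cocycle[OF c d(1) d'(1)] jcd jac_inverse[OF d'(1) d(1)] jac_inverse[OF d(1) d'(1)] d'(4) by simp
    have Nc: "N c I = n I" if "length I = 4" for I
      using cotensor_transform[OF N d'(1) c that] that by (simp add: j1c lin_act_id Nd')
    have Sc: "S c I = S d I" "H c I = H d I" if "length I = 4" for I
      using cotensor_transform[OF S d(1) c that] cotensor_transform[OF S22_cotensor[OF H] d(1) c that] that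
      by (simp_all add: jcd lin_act_id)
    have "N c I = normal_part (\<lambda>I. S c I + H c I) I" if I: "length I = 4" for I
    proof -
      obtain i j k l where "I = [i, j, k, l]" by (rule length_4E[OF I])
      then show ?thesis using Nc[OF I] by (simp add: n_def normal_part_4 M_def Sc)
    qed
    then show "\<exists>W' g' N. metric_on A r W' g' \<and> x \<in> W' \<and> jet2 A g' x = jet_add (jet2 A g x) H \<and>
      is_normal_tensor A W' g' x N \<and> N \<in> normal_tensors A x \<and>
      (\<forall>I. length I = 4 \<longrightarrow> N c I = normal_part (\<lambda>I. S c I + H c I) I)"
      using g' j' j1 int nt by (intro exI[of _ W'] exI[of _ g'] exI[of _ N]) simp
  qed
qed

end

subsection \<open>Multilinear forms on block tensors\<close>

lemma blocks_0 [simp]: "blocks 0 = {[]}"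
  by (auto simp: blocks_def)

lemma blocks_Suc: "blocks (Suc m) = (\<lambda>(b, B). b # B) ` ({b. length b = 4} \<times> blocks m)"
  by (auto simp: blocks_def length_Suc_conv image_iff)

lemma finite_blocks [simp]: "finite (blocks m :: 'n::finite list list set)"
  by (induction m) (auto simp: blocks_Suc)

lemma sum_blocks_Suc:
  fixes F :: "'n::finite list list \<Rightarrow> 'b::comm_monoid_add"
  shows "(\<Sum>B\<in>blocks (Suc m). F B) = (\<Sum>b\<in>{b. length b = 4}. \<Sum>B\<in>blocks m. F (b # B))"
proof -
  have "inj_on (\<lambda>(b, B). b # B) ({b :: 'n list. length b = 4} \<times> blocks m)" by (auto simp: inj_on_def)
  then show ?thesis
    unfolding blocks_Suc by (simp add: sum.reindex sum.cartesian_product case_prod_beta')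
qed

definition multi_eval :: "('n::finite list list \<Rightarrow> real) \<Rightarrow> ('n list \<Rightarrow> real) list \<Rightarrow> real" where
  "multi_eval K Xs = (\<Sum>B\<in>blocks (length Xs). K B * (\<Prod>s<length Xs. (Xs ! s) (B ! s)))"

lemma multi_eval_Nil [simp]: "multi_eval K [] = K []"
  by (simp add: multi_eval_def)

lemma multi_eval_Cons:
  "multi_eval K (X # Xs) = (\<Sum>b\<in>{b. length b = 4}. X b * multi_eval (\<lambda>B. K (b # B)) Xs)"
  by (simp add: multi_eval_def sum_blocks_Suc prod.lessThan_Suc_shift sum_distrib_left mult_ac del: prod.lessThan_Suc)

lemma multi_eval_cong:
  assumes "length Xs = length Ys" "\<And>s I. s < length Xs \<Longrightarrow> length I = 4 \<Longrightarrow> (Xs ! s) I = (Ys ! s) I"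
    "\<And>B. B \<in> blocks (length Xs) \<Longrightarrow> K B = K' B"
  shows "multi_eval K Xs = multi_eval K' Ys"
  unfolding multi_eval_def assms(1)[symmetric]
proof (rule sum.cong[OF refl])
  fix B :: "'a list list" assume B: "B \<in> blocks (length Xs)"
  have "(Xs ! s) (B ! s) = (Ys ! s) (B ! s)" if "s < length Xs" for s
    using that B by (intro assms) (auto simp: blocks_def)
  then show "K B * (\<Prod>s<length Xs. (Xs ! s) (B ! s)) = K' B * (\<Prod>s<length Xs. (Ys ! s) (B ! s))"
    using assms(3)[OF B] by simp
qed

lemma multi_eval_sum:
  "multi_eval (\<lambda>B. \<Sum>i\<in>S. c i * K i B) Xs = (\<Sum>i\<in>S. c i * multi_eval (K i) Xs)"
proof -
  have "multi_eval (\<lambda>B. \<Sum>i\<in>S. c i * K i B) Xs =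
    (\<Sum>B\<in>blocks (length Xs). \<Sum>i\<in>S. c i * (K i B * (\<Prod>s<length Xs. (Xs ! s) (B ! s))))"
    by (simp add: multi_eval_def sum_distrib_right mult.assoc)
  also have "\<dots> = (\<Sum>i\<in>S. c i * multi_eval (K i) Xs)"
    unfolding multi_eval_def sum_distrib_left by (rule sum.swap)
  finally show ?thesis .
qed

lemma multi_eval_scale: "multi_eval (\<lambda>B. c * K B) Xs = c * multi_eval K Xs"
  by (simp add: multi_eval_def sum_distrib_left mult.assoc)

lemma multi_eval_head:
  "multi_eval K ((\<lambda>I. X I + t * Y I) # Xs) = multi_eval K (X # Xs) + t * multi_eval K (Y # Xs)"
  by (simp add: multi_eval_Cons algebra_simps sum.distrib sum_distrib_left)

text \<open>Multilinearity: mapping every argument by the linear map with matrix \<Phi> amounts to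
  transforming the coefficients.\<close>

lemma multi_eval_expand:
  fixes \<Phi> :: "'n list \<Rightarrow> 'n::finite list \<Rightarrow> real"
  shows "multi_eval K (map (\<lambda>C I. \<Sum>b\<in>{b. length b = 4}. C b * \<Phi> b I) Cs) =
   multi_eval (\<lambda>B. multi_eval K (map \<Phi> B)) Cs"
proof (induction Cs arbitrary: K)
  case (Cons C Cs)
  let ?L = "{b :: 'n list. length b = 4}"
  have "multi_eval K (map (\<lambda>C I. \<Sum>b\<in>?L. C b * \<Phi> b I) (C # Cs)) =
    (\<Sum>b'\<in>?L. (\<Sum>b\<in>?L. C b * \<Phi> b b') * multi_eval (\<lambda>B. multi_eval (\<lambda>B'. K (b' # B')) (map \<Phi> B)) Cs)"
    by (simp add: multi_eval_Cons Cons.IH)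
  also have "\<dots> = (\<Sum>b\<in>?L. \<Sum>b'\<in>?L. C b * (\<Phi> b b' * multi_eval (\<lambda>B. multi_eval (\<lambda>B'. K (b' # B')) (map \<Phi> B)) Cs))"
    unfolding sum_distrib_right mult.assoc by (rule sum.swap)
  also have "\<dots> = multi_eval (\<lambda>B. multi_eval K (map \<Phi> B)) (C # Cs)"
    by (simp add: multi_eval_Cons multi_eval_sum sum_distrib_left)
  finally show ?case .
qed simp

definition symmetric_coef :: "nat \<Rightarrow> ('n::finite list list \<Rightarrow> real) \<Rightarrow> bool" where
  "symmetric_coef m K \<longleftrightarrow> (\<forall>B\<in>blocks m. \<forall>B'. mset B' = mset B \<longrightarrow> K B' = K B)"

lemma mset_blocks: "B \<in> blocks m \<Longrightarrow> mset B' = mset B \<Longrightarrow> B' \<in> blocks m"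
  by (auto simp: blocks_def dest: mset_eq_length mset_eq_setD)

lemma permute_blocks_bij:
  assumes "\<sigma> permutes {..<m}"
  shows "bij_betw (permute_list \<sigma>) (blocks m) (blocks m :: 'n::finite list list set)"
proof (rule bij_betwI[where g="permute_list (inv \<sigma>)"])
  have mem: "permute_list \<pi> B \<in> blocks m" if "\<pi> permutes {..<m}" "B \<in> blocks m" for \<pi> and B :: "'n list list"
    using that mset_blocks[OF that(2), of "permute_list \<pi> B"] by (auto simp: blocks_def)
  have inv: "inv \<sigma> permutes {..<m}" using assms by (rule permutes_inv)
  show "permute_list \<sigma> \<in> blocks m \<rightarrow> (blocks m :: 'n list list set)"
    "permute_list (inv \<sigma>) \<in> blocks m \<rightarrow> (blocks m :: 'n list list set)"
    using mem[OF assms] mem[OF inv] by auto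
  show "permute_list (inv \<sigma>) (permute_list \<sigma> B) = B" if "B \<in> blocks m" for B :: "'n list list"
    using that inv permute_list_compose[of "inv \<sigma>" B \<sigma>] permutes_inv_o(1)[OF assms]
    by (simp add: blocks_def)
  show "permute_list \<sigma> (permute_list (inv \<sigma>) B) = B" if "B \<in> blocks m" for B :: "'n list list"
    using that assms permute_list_compose[of \<sigma> B "inv \<sigma>"] permutes_inv_o(2)[OF assms]
    by (simp add: blocks_def)
qed

text \<open>Permuting the arguments is compensated by permuting the blocks in the same way, and
  symmetric coefficients do not notice the latter.\<close>

lemma multi_eval_permute:
  assumes K: "symmetric_coef (length Xs) K" and eq: "mset Ys = mset Xs"
  shows "multi_eval K Ys = multi_eval K Xs"
proof -
  define m where "m = length Xs"
  obtain \<sigma> where \<sigma>: "\<sigma> permutes {..<m}" "permute_list \<sigma> Xs = Ys"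
    using mset_eq_permutation[OF eq] by (auto simp: m_def)
  have l: "length Ys = m" using eq by (auto simp: m_def dest: mset_eq_length)
  have "multi_eval K Xs = (\<Sum>B\<in>blocks m. K B * (\<Prod>s<m. (Xs ! s) (B ! s)))"
    by (simp add: multi_eval_def m_def)
  also have "\<dots> = (\<Sum>B\<in>blocks m. K B * (\<Prod>s<m. (Xs ! \<sigma> s) (B ! \<sigma> s)))"
  proof -
    have "(\<Prod>s<m. (Xs ! s) (B ! s)) = (\<Prod>s<m. (Xs ! \<sigma> s) (B ! \<sigma> s))" for B
      using prod.permute[OF \<sigma>(1), of "\<lambda>s. (Xs ! s) (B ! s)"] by (simp add: o_def)
    then show ?thesis by simp
  qed
  also have "\<dots> = (\<Sum>B\<in>blocks m. K (permute_list \<sigma> B) * (\<Prod>s<m. (Ys ! s) (permute_list \<sigma> B ! s)))"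
  proof (intro sum.cong refl arg_cong2[where f="(*)"] prod.cong)
    fix B :: "'a list list" assume B: "B \<in> blocks m"
    then have lB: "length B = m" by (simp add: blocks_def)
    show "K B = K (permute_list \<sigma> B)"
      using K B \<sigma>(1) lB unfolding symmetric_coef_def m_def by (metis mset_permute_list)
    fix s assume "s \<in> {..<m}"
    then show "(Xs ! \<sigma> s) (B ! \<sigma> s) = (Ys ! s) (permute_list \<sigma> B ! s)"
      using \<sigma> lB by (auto simp: permute_list_nth m_def)
  qed
  also have "\<dots> = (\<Sum>B\<in>blocks m. K B * (\<Prod>s<m. (Ys ! s) (B ! s)))"
    by (rule sum.reindex_bij_betw[OF permute_blocks_bij[OF \<sigma>(1)]])
  finally show ?thesis by (simp add: multi_eval_def l)
qed

text \<open>A homogeneous polynomial comes with arbitrary coefficients. Averaging them over all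
  permutations keeps the polynomial and yields its polarization, to which the derivative formula for
  symmetric forms applies.\<close>

definition sym_coef :: "nat \<Rightarrow> ('n::finite list list \<Rightarrow> real) \<Rightarrow> 'n list list \<Rightarrow> real" where
  "sym_coef m a B = (\<Sum>\<sigma>\<in>{\<sigma>. \<sigma> permutes {..<m}}. 1 / fact m * a (permute_list \<sigma> B))"

lemma symmetric_sym_coef: "symmetric_coef m (sym_coef m a)"
  unfolding symmetric_coef_def
proof (intro ballI allI impI)
  fix B B' :: "'a list list" assume B: "B \<in> blocks m" and eq: "mset B' = mset B"
  then have l: "length B = m" by (simp add: blocks_def)
  obtain \<pi> where \<pi>: "\<pi> permutes {..<m}" "permute_list \<pi> B = B'"
    using mset_eq_permutation[OF eq] l by auto
  have "sym_coef m a B = (\<Sum>\<sigma>\<in>{\<sigma>. \<sigma> permutes {..<m}}. 1 / fact m * a (permute_list (\<pi> \<circ> \<sigma>) B))"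
    unfolding sym_coef_def by (rule setum_permutations_compose_left[OF \<pi>(1)])
  also have "\<dots> = sym_coef m a B'"
    unfolding sym_coef_def using l \<pi> by (intro sum.cong refl) (simp add: permute_list_compose flip: \<pi>(2))
  finally show "sym_coef m a B' = sym_coef m a B" ..
qed

lemma prod_nth_eq: "(\<Prod>s<length B. X (B ! s)) = prod_mset (image_mset X (mset B))"
proof -
  have "(\<Prod>s<length B. X (B ! s)) = prod_list (map X B)"
    by (simp add: prod.list_conv_set_nth lessThan_atLeast0)
  also have "\<dots> = prod_mset (mset (map X B))" by (simp only: prod_mset_prod_list)
  finally show ?thesis by simp
qed

text \<open>On equal arguments the product over the slots is invariant under permutations, so each
  of the m! summands reindexes to the original sum.\<close>

lemma multi_eval_sym_coef:
  "multi_eval (sym_coef m a) (replicate m X) = multi_eval a (replicate m X)"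
proof -
  let ?P = "\<lambda>B. \<Prod>s<m. X (B ! s)"
  have P: "?P (permute_list \<sigma> B) = ?P B" if "\<sigma> permutes {..<m}" "B \<in> blocks m" for \<sigma> B
    using that prod_nth_eq[of X B] prod_nth_eq[of X "permute_list \<sigma> B"] by (simp add: blocks_def)
  have e: "multi_eval K (replicate m X) = (\<Sum>B\<in>blocks m. K B * ?P B)" for K
    by (simp add: multi_eval_def)
  have "multi_eval (sym_coef m a) (replicate m X) =
    (\<Sum>\<sigma>\<in>{\<sigma>. \<sigma> permutes {..<m}}. \<Sum>B\<in>blocks m. 1 / fact m * a (permute_list \<sigma> B) * ?P B)"
    unfolding e sym_coef_def sum_distrib_right by (rule sum.swap)
  also have "\<dots> = (\<Sum>\<sigma>\<in>{\<sigma>. \<sigma> permutes {..<m}}. \<Sum>B\<in>blocks m. 1 / fact m * a B * ?P B)"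
  proof (rule sum.cong)
    fix \<sigma> assume "\<sigma> \<in> {\<sigma>. \<sigma> permutes {..<m}}"
    then have \<sigma>: "\<sigma> permutes {..<m}" by simp
    have "(\<Sum>B\<in>blocks m. 1 / fact m * a (permute_list \<sigma> B) * ?P B) =
      (\<Sum>B\<in>blocks m. 1 / fact m * a (permute_list \<sigma> B) * ?P (permute_list \<sigma> B))"
      using P[OF \<sigma>] by simp
    also have "\<dots> = (\<Sum>B\<in>blocks m. 1 / fact m * a B * ?P B)"
      by (rule sum.reindex_bij_betw[OF permute_blocks_bij[OF \<sigma>]])
    finally show "(\<Sum>B\<in>blocks m. 1 / fact m * a (permute_list \<sigma> B) * ?P B) =
      (\<Sum>B\<in>blocks m. 1 / fact m * a B * ?P B)" .
  qed simp
  also have "\<dots> = (\<Sum>B\<in>blocks m. a B * ?P B)"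
  proof -
    have "card {\<sigma>. \<sigma> permutes {..<m}} = fact m" by (rule card_permutations) auto
    then show ?thesis by (simp flip: sum_divide_distrib)
  qed
  finally show ?thesis by (simp add: e)
qed

lemma multi_eval_update:
  assumes "symmetric_coef (length Xs) K" "s < length Xs"
  shows "multi_eval K (Xs[s := Y]) = multi_eval K (Y # (take s Xs @ drop (Suc s) Xs))"
proof -
  have "mset (Xs[s := Y]) = mset (Y # (take s Xs @ drop (Suc s) Xs))"
    using assms(2) by (simp add: upd_conv_take_nth_drop)
  moreover have "length (Y # (take s Xs @ drop (Suc s) Xs)) = length Xs" using assms(2) by simp
  ultimately show ?thesis using multi_eval_permute assms(1) by metis
qed

text \<open>For symmetric forms this is the rule that the derivative of the n-th power is n times Y
  times the power n - 1. The induction splits off one varying argument and moves its X or Y part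
  into the fixed arguments, whence the general Zs.\<close>

lemma multi_eval_derivative:
  assumes "symmetric_coef (length Zs + n) K"
  shows "((\<lambda>t. multi_eval K (Zs @ replicate n (\<lambda>I. X I + t * Y I))) has_real_derivative
    n * multi_eval K (Y # Zs @ replicate (n - 1) X)) (at 0)"
  using assms
proof (induction n arbitrary: Zs)
  case 0
  then show ?case by simp
next
  case (Suc n)
  let ?R = "\<lambda>t. replicate n (\<lambda>I. X I + t * Y I)"
  have eq: "multi_eval K (Zs @ replicate (Suc n) (\<lambda>I. X I + t * Y I)) =
    multi_eval K ((X # Zs) @ ?R t) + t * multi_eval K ((Y # Zs) @ ?R t)" for t
  proof -
    have "multi_eval K (Zs @ replicate (Suc n) (\<lambda>I. X I + t * Y I)) =
      multi_eval K ((\<lambda>I. X I + t * Y I) # (Zs @ ?R t))"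
      using Suc.prems by (intro multi_eval_permute) auto
    then show ?thesis by (simp add: multi_eval_head)
  qed
  have XZ: "((\<lambda>t. multi_eval K ((X # Zs) @ ?R t)) has_real_derivative
    n * multi_eval K (Y # (X # Zs) @ replicate (n - 1) X)) (at 0)"
    using Suc.prems by (intro Suc.IH) simp
  have YZ: "((\<lambda>t. multi_eval K ((Y # Zs) @ ?R t)) has_real_derivative
    n * multi_eval K (Y # (Y # Zs) @ replicate (n - 1) X)) (at 0)"
    using Suc.prems by (intro Suc.IH) simp
  have R0: "?R 0 = replicate n X" by simp
  \<comment> \<open>For n = 0 the truncated n - 1 makes the two argument lists differ in length, but
    the factor n annihilates both sides.\<close>
  have e: "n * multi_eval K (Y # (X # Zs) @ replicate (n - 1) X) = n * multi_eval K (Y # Zs @ replicate n X)"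
  proof (cases n)
    case (Suc k)
    then have "multi_eval K (Y # (X # Zs) @ replicate k X) = multi_eval K (Y # Zs @ replicate n X)"
      using Suc.prems by (intro multi_eval_permute) auto
    then show ?thesis using Suc by simp
  qed simp
  show ?case
    unfolding eq
    by (rule DERIV_cong[OF DERIV_add[OF XZ[unfolded e] DERIV_mult[OF DERIV_ident YZ]]]) (simp add: algebra_simps)
qed

section \<open>Unit arrays, averaging and the transformation of blocks\<close>

definition delta :: "'n list \<Rightarrow> 'n list \<Rightarrow> real" where
  "delta b I = (if b = I then 1 else 0)"

text \<open>Projects arbitrary arrays onto those with the symmetries of \<open>S22\<close>. The
  coefficients of a multilinear form are its values on unit arrays, which lack these symmetries;
  composed with \<open>avg\<close>, \<open>normal_part\<close> can be evaluated on them.\<close>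

definition avg :: "('n list \<Rightarrow> real) \<Rightarrow> 'n list \<Rightarrow> real" where
  "avg C I = (let i = I ! 0; j = I ! 1; k = I ! 2; l = I ! 3 in
    (C [i, j, k, l] + C [j, i, k, l] + C [i, j, l, k] + C [j, i, l, k]) / 4)"

lemma avg_4: "avg C [i, j, k, l] = (C [i, j, k, l] + C [j, i, k, l] + C [i, j, l, k] + C [j, i, l, k]) / 4"
  by (simp add: avg_def)

lemma normal_part_cong:
  "(\<And>i j k l. M [i, j, k, l] = M' [i, j, k, l]) \<Longrightarrow> normal_part M = normal_part M'"
  by (rule ext) (simp add: normal_part_def)

lemma normal_part_sum:
  "normal_part (\<lambda>I. \<Sum>b\<in>S. c b * F b I) I = (\<Sum>b\<in>S. c b * normal_part (F b) I)"
  by (simp add: normal_part_def Let_def sum_divide_distrib[symmetric] sum_subtractf sum.distrib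
     sum_distrib_left[symmetric] right_diff_distrib distrib_left times_divide_eq_right)

lemma normal_part_add_scale:
  "normal_part (\<lambda>I. X I + t * Y I) I = normal_part X I + t * normal_part Y I"
  by (simp add: normal_part_def Let_def field_simps)

definition sym_normal_part :: "('n list \<Rightarrow> real) \<Rightarrow> 'n list \<Rightarrow> real" where
  "sym_normal_part C = normal_part (avg C)"

lemma sym_normal_part_sum: "sym_normal_part (\<lambda>I. \<Sum>b\<in>S. c b * F b I) I = (\<Sum>b\<in>S. c b * sym_normal_part (F b) I)"
proof -
  have "avg (\<lambda>I. \<Sum>b\<in>S. c b * F b I) I = (\<Sum>b\<in>S. c b * avg (F b) I)" for I
    by (simp add: avg_def Let_def sum_divide_distrib[symmetric] sum.distrib
     sum_distrib_left[symmetric] distrib_left times_divide_eq_right)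
  then show ?thesis unfolding sym_normal_part_def using normal_part_sum[of c "\<lambda>b. avg (F b)" S] by presburger
qed

lemma sym_normal_part_expand:
  fixes C :: "'n::finite list \<Rightarrow> real"
  shows "sym_normal_part C I = (\<Sum>b\<in>{b. length b = 4}. C b * sym_normal_part (delta b) I)"
proof -
  have "(\<Sum>b\<in>{b :: 'n list. length b = 4}. C b * delta b J) = C J" if "length J = 4" for J
    using that by (simp add: delta_def if_distrib[where f="\<lambda>x. y * x" for y] cong: if_cong)
  then have "avg C = avg (\<lambda>I. \<Sum>b\<in>{b. length b = 4}. C b * delta b I)"
    by (intro ext) (simp add: avg_def)
  then have "sym_normal_part C = sym_normal_part (\<lambda>I. \<Sum>b\<in>{b. length b = 4}. C b * delta b I)" by (simp add: sym_normal_part_def)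
  then show ?thesis by (simp only: sym_normal_part_sum)
qed

lemma sym_normal_part_symmetric:
  assumes "\<And>i j k l. C [j, i, k, l] = C [i, j, k, l]" "\<And>i j k l. C [i, j, l, k] = C [i, j, k, l]"
  shows "sym_normal_part C = normal_part C"
  unfolding sym_normal_part_def by (rule normal_part_cong) (simp add: avg_4 assms)

lemma sym_normal_part_delta_swap: "sym_normal_part (delta [b, a, e, f]) = sym_normal_part (delta [a, b, e, f])"
  "sym_normal_part (delta [a, b, f, e]) = sym_normal_part (delta [a, b, e, f])"
  unfolding sym_normal_part_def by (rule normal_part_cong, simp add: avg_4 delta_def conj_ac add_ac)+

text \<open>Acting on an index list made of blocks is evaluating a multilinear form on products of
  entries of Q, one product per block. This brings the transformation law of tensors into the
  language of \<open>multi_eval\<close>.\<close>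

lemma lin_act_blocks:
  "B \<in> blocks m \<Longrightarrow> lin_act (4 * m) Q t (concat B) =
    multi_eval (\<lambda>B'. t (concat B')) (map (\<lambda>b I. \<Prod>r<4. Q $ (b ! r) $ (I ! r)) B)"
proof (induction m arbitrary: B t)
  case 0
  then show ?case by (simp add: lin_act_0)
next
  case (Suc m)
  then obtain b B0 where B: "B = b # B0" "length b = 4" "B0 \<in> blocks m"
    by (auto simp: blocks_Suc)
  have "lin_act (4 * Suc m) Q t (concat B) = lin_act (4 + 4 * m) Q t (b @ concat B0)"
    by (simp add: B)
  also have "\<dots> = lin_act 4 Q (\<lambda>I. lin_act (4 * m) Q (\<lambda>I'. t (I @ I')) (concat B0)) b"
    by (rule lin_act_append[OF B(2)])
  also have "\<dots> = multi_eval (\<lambda>B'. t (concat B')) (map (\<lambda>b I. \<Prod>r<4. Q $ (b ! r) $ (I ! r)) B)"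
    by (simp add: B(1) Suc.IH[OF B(3)] multi_eval_Cons lin_act_def[of 4])
  finally show ?case .
qed

lemma lin_act_avg: "lin_act 4 Q (avg t) [a, b, e, f] = avg (lin_act 4 Q t) [a, b, e, f]"
proof -
  let ?s = "\<lambda>i j k l. lin_act 4 Q (\<lambda>I. t [I ! i, I ! j, I ! k, I ! l]) [a, b, e, f]"
  have 1: "lin_act 4 Q t [b, a, e, f] = ?s 1 0 2 3" "lin_act 4 Q t [a, b, f, e] = ?s 0 1 3 2"
    by (rule lin_act_swap)+
  have 2: "lin_act 4 Q t [b, a, f, e] = ?s 1 0 3 2"
    by (subst lin_act_swap(1), subst lin_act_swap(3)) simp
  have 0: "lin_act 4 Q t [a, b, e, f] = ?s 0 1 2 3"
    by (rule lin_act_4_cong) simp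
  have "lin_act 4 Q (avg t) [a, b, e, f] = lin_act 4 Q (\<lambda>I. (1/4) * (t [I ! 0, I ! 1, I ! 2, I ! 3] +
     t [I ! 1, I ! 0, I ! 2, I ! 3] + t [I ! 0, I ! 1, I ! 3, I ! 2] + t [I ! 1, I ! 0, I ! 3, I ! 2])) [a, b, e, f]"
    by (rule lin_act_4_cong) (simp add: avg_4)
  also have "\<dots> = (?s 0 1 2 3 + ?s 1 0 2 3 + ?s 0 1 3 2 + ?s 1 0 3 2) / 4"
    by (simp add: lin_act_def algebra_simps sum.distrib add_divide_distrib sum_divide_distrib)
  finally show ?thesis by (simp add: avg_4 0 1 2)
qed

lemma lin_act_delta:
  fixes b :: "'n::finite list"
  assumes "length b = 4"
  shows "lin_act 4 (transpose Q) (delta b) I = (\<Prod>r<4. Q $ (b ! r) $ (I ! r))"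
  using assms by (simp add: lin_act_def delta_def transpose_def if_distrib[where f="\<lambda>x. y * x" for y] cong: if_cong)

text \<open>Recovers the blocks from their concatenation: tensors are indexed by flat lists,
  multilinear forms by lists of blocks.\<close>

primrec chunks :: "nat \<Rightarrow> 'n list \<Rightarrow> 'n list list" where
  "chunks 0 I = []"
| "chunks (Suc m) I = take 4 I # chunks m (drop 4 I)"

lemma chunks_concat: "B \<in> blocks m \<Longrightarrow> chunks m (concat B) = B"
proof (induction m arbitrary: B)
  case (Suc m)
  then obtain b B0 where "B = b # B0" "length b = 4" "B0 \<in> blocks m" by (auto simp: blocks_Suc)
  then show ?case using Suc.IH by simp
qed simp

lemma length_concat_blocks: "B \<in> blocks m \<Longrightarrow> length (concat B) = 4 * m"
proof (induction m arbitrary: B)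
  case (Suc m)
  then show ?case by (auto simp: blocks_Suc)
qed simp

lemma ex_concat_blocks: "length I = 4 * m \<Longrightarrow> \<exists>B\<in>blocks m. I = concat B"
proof (induction m arbitrary: I)
  case (Suc m)
  then have "length (drop 4 I) = 4 * m" by simp
  from Suc.IH[OF this] obtain B where "B \<in> blocks m" "drop 4 I = concat B" by blast
  then have "I = concat (take 4 I # B)" using append_take_drop_id[of 4 I] by simp
  moreover have "take 4 I # B \<in> blocks (Suc m)"
    using \<open>B \<in> blocks m\<close> Suc.prems by (auto simp: blocks_def)
  ultimately show ?case by blast
qed simp

lemma ex_append_concat_blocks:
  assumes "length I = p + 4 * m"
  shows "\<exists>J B. length J = p \<and> B \<in> blocks m \<and> I = J @ concat B"
proof -
  have "length (drop p I) = 4 * m" using assms by simp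
  from ex_concat_blocks[OF this] obtain B where "B \<in> blocks m" "drop p I = concat B" by blast
  then show ?thesis using assms
    by (intro exI[of _ "take p I"] exI[of _ B]) (metis append_take_drop_id add_leD1 le_add1 length_take min.absorb2)
qed

lemma blocks_update: "B \<in> blocks m \<Longrightarrow> length b = 4 \<Longrightarrow> B[s := b] \<in> blocks m"
  using set_update_subset_insert[of B s b] by (auto simp: blocks_def)

lemma sym_normal_part_add: "sym_normal_part (\<lambda>I. X I + Y I) I = sym_normal_part X I + sym_normal_part Y I"
  by (simp add: sym_normal_part_def normal_part_def avg_def Let_def field_simps)

text \<open>If c_i denotes the entry with first index i and the other three behind it, averaging
  gives (c_i + c_j) / 2. Both parts of \<open>normal_part\<close> then equal a sixth of c_i + c_j +
  c_k + c_l and cancel. Such arrays are the effect of a cubic change of coordinates.\<close>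

lemma sym_normal_part_symmetric3:
  assumes "\<And>i j k l. C [i, k, j, l] = C [i, j, k, l]" "\<And>i j k l. C [i, j, l, k] = C [i, j, k, l]"
  shows "sym_normal_part C [i, j, k, l] = 0"
proof -
  have 1: "C [i, k, l, j] = C [i, j, k, l]" "C [i, l, j, k] = C [i, j, k, l]" "C [i, l, k, j] = C [i, j, k, l]"
    for i j k l using assms by metis+
  have a: "avg C [i, j, k, l] = (C [i, j, k, l] + C [j, i, k, l]) / 2" for i j k l
    by (simp add: avg_4 assms(2)[of _ _ l k])
  show ?thesis
    unfolding sym_normal_part_def normal_part_4 a
    using assms(1)[of i j k l] 1[of i j k l] assms(2)[of i j k l] assms(1)[of j i k l] 1[of j i k l] assms(2)[of j i k l]
     assms(1)[of k i j l] 1[of k i j l] assms(2)[of k i j l] assms(1)[of l i j k] 1[of l i j k] assms(2)[of l i j k]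
    by (simp add: field_simps)
qed

text \<open>By linearity the symmetrization moves onto the unit array, which thereby becomes
  symmetric in its last three indices. This is what puts the blocks of the derivative into the
  kernel of symmetrization.\<close>

lemma sym_normal_part_delta_symmetrize: "symmetrize3 (\<lambda>b e f. sym_normal_part (delta [a, b, e, f]) [i, j, k, l]) b e f = 0"
proof -
  have "symmetrize3 (\<lambda>b e f. sym_normal_part (delta [a, b, e, f]) [i, j, k, l]) b e f =
    sym_normal_part (\<lambda>I. delta [a, b, e, f] I + delta [a, b, f, e] I + delta [a, e, b, f] I + delta [a, e, f, b] I +
      delta [a, f, b, e] I + delta [a, f, e, b] I) [i, j, k, l]"
    by (simp only: symmetrize3_def sym_normal_part_add)
  also have "\<dots> = 0"
    by (rule sym_normal_part_symmetric3) (simp_all add: delta_def conj_ac add_ac)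
  finally show ?thesis .
qed

context smooth_manifold
begin

text \<open>Packages \<open>normal_form\<close> as a property of a jet and a tensor S. It does not
  mention T, so that one S can be used for two tensors in the proof of injectivity.\<close>

definition normal_form_at :: "nat \<Rightarrow> ('x, 'n) chart \<Rightarrow> ('x, 'n) jet \<Rightarrow> ('x, 'n) tensor \<Rightarrow> bool" where
  "normal_form_at r c j S \<longleftrightarrow> S \<in> S22 A (fst j) \<and> (\<forall>H\<in>S22 A (fst j). \<exists>W' g' N. metric_on A r W' g' \<and> fst j \<in> W' \<and>
      jet2 A g' (fst j) = jet_add j H \<and>
      is_normal_tensor A W' g' (fst j) N \<and> N \<in> normal_tensors A (fst j) \<and>
      (\<forall>I. length I = 4 \<longrightarrow> N c I = normal_part (\<lambda>I. S c I + H c I) I))"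

lemma ex_normal_form_at:
  assumes "j \<in> J2M A r" "c \<in> charts_at A (fst j)"
  shows "\<exists>S. normal_form_at r c j S"
proof -
  obtain W g where g: "j = jet2 A g (fst j)" "metric_on A r W g" "fst j \<in> W" using assms(1) by (rule J2ME)
  obtain S where "S \<in> S22 A (fst j)" "\<And>H. H \<in> S22 A (fst j) \<Longrightarrow> \<exists>W' g' N. metric_on A r W' g' \<and> fst j \<in> W' \<and>
      jet2 A g' (fst j) = jet_add (jet2 A g (fst j)) H \<and>
      is_normal_tensor A W' g' (fst j) N \<and> N \<in> normal_tensors A (fst j) \<and>
      (\<forall>I. length I = 4 \<longrightarrow> N c I = normal_part (\<lambda>I. S c I + H c I) I)"
    by (rule normal_form[OF g(2,3) assms(2)]) blast
  then have "normal_form_at r c j S" unfolding normal_form_at_def using g(1) by simp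
  then show ?thesis by blast
qed

text \<open>Each differentiation fills one of the slots still free and contributes their number as a
  factor, in total m! / (m - k)! after k steps. The statement ranges over all translates of j
  because the next derivative moves along the fibre.\<close>

lemma fibre_deriv_multi_eval:
  assumes K: "symmetric_coef m K"
    and f: "\<And>H. H \<in> S22 A (fst j) \<Longrightarrow> f (jet_add j H) = multi_eval K (replicate m (normal_part (\<lambda>I. S I + H c I)))"
  shows "set Hs \<subseteq> S22 A (fst j) \<Longrightarrow> length Hs \<le> m \<Longrightarrow> H \<in> S22 A (fst j) \<Longrightarrow>
    fibre_deriv Hs f (jet_add j H) = fact m / fact (m - length Hs) *
      multi_eval K (map (\<lambda>H. normal_part (H c)) Hs @ replicate (m - length Hs) (normal_part (\<lambda>I. S I + H c I)))"
proof (induction Hs arbitrary: H)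
  case Nil
  then show ?case by (simp add: f)
next
  case (Cons H1 Hs)
  define n where "n = m - length (H1 # Hs)"
  have n: "m - length Hs = Suc n" using Cons.prems by (simp add: n_def)
  define X where "X = normal_part (\<lambda>I. S I + H c I)"
  define Y where "Y = normal_part (H1 c)"
  define Zs where "Zs = map (\<lambda>H. normal_part (H c)) Hs"
  have "fibre_deriv Hs f (jet_add (jet_add j H) (\<lambda>c I. t * H1 c I)) =
    fact m / fact (Suc n) * multi_eval K (Zs @ replicate (Suc n) (\<lambda>I. X I + t * Y I))" for t
  proof -
    have "(\<lambda>c I. H c I + t * H1 c I) \<in> S22 A (fst j)"
      using Cons.prems by (intro lin_comb_S22) auto
    moreover have "normal_part (\<lambda>I. S I + (H c I + t * H1 c I)) = (\<lambda>I. X I + t * Y I)"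
      using normal_part_add_scale[of "\<lambda>I. S I + H c I" t "H1 c"] by (intro ext) (simp add: X_def Y_def add.assoc)
    ultimately show ?thesis
      using Cons.IH[of "\<lambda>c I. H c I + t * H1 c I"] Cons.prems by (simp add: jet_add_add n Zs_def)
  qed
  then have "fibre_deriv (H1 # Hs) f (jet_add j H) =
    deriv (\<lambda>t. fact m / fact (Suc n) * multi_eval K (Zs @ replicate (Suc n) (\<lambda>I. X I + t * Y I))) 0"
    by simp
  also have "\<dots> = fact m / fact (Suc n) * (Suc n * multi_eval K (Y # Zs @ replicate n X))"
  proof (rule DERIV_imp_deriv, rule DERIV_cmult)
    have "length Zs + Suc n = m" using n Cons.prems by (simp add: Zs_def)
    then show "((\<lambda>t. multi_eval K (Zs @ replicate (Suc n) (\<lambda>I. X I + t * Y I))) has_real_derivative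
      real (Suc n) * multi_eval K (Y # Zs @ replicate n X)) (at 0)"
      using multi_eval_derivative[of Zs "Suc n" K X Y] K by simp
  qed
  also have "\<dots> = fact m / fact n * multi_eval K (Y # Zs @ replicate n X)"
    by (simp add: field_simps del: of_nat_Suc)
  finally show ?case by (simp add: n_def X_def Y_def Zs_def)
qed

lemma fibre_deriv_full:
  assumes K: "symmetric_coef m K"
    and f: "\<And>H. H \<in> S22 A (fst j) \<Longrightarrow> f (jet_add j H) = multi_eval K (replicate m (normal_part (\<lambda>I. S I + H c I)))"
    and Hs: "set Hs \<subseteq> S22 A (fst j)" "length Hs = m"
  shows "fibre_deriv Hs f j = fact m * multi_eval K (map (\<lambda>H. normal_part (H c)) Hs)"
  using fibre_deriv_multi_eval[OF K f Hs(1) _ zero_S22] Hs(2) by (simp add: jet_add_0)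

end

subsection \<open>The \<open>m\<close>-th derivative along the fibres\<close>

text \<open>What homogeneity means on jets over gx: \<open>\<alpha> c J\<close> holds the symmetric
  coefficients of the component J of \<phi> in the chart c, and \<open>T_multi_eval\<close> says
  that on a fibre T is this polynomial composed with an affine map whose linear part is
  \<open>normal_part\<close>.\<close>

locale polynomial_tensor = smooth_manifold A
  for A :: "('x::{t2_space,second_countable_topology}, 'n::finite) chart set" +
  fixes r p m :: nat and x :: 'x and gx :: "('x, 'n) chart \<Rightarrow> real^'n^'n" and T :: "('x, 'n) op2"
    and \<alpha> :: "('x, 'n) chart \<Rightarrow> 'n list \<Rightarrow> 'n list list \<Rightarrow> real"
  assumes gx: "gx \<in> metrics_at A r x"
    and tensor: "\<And>j. j \<in> J2M A r \<Longrightarrow> T j \<in> tensors A p (fst j)"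
    and coef_sym: "\<And>c J. symmetric_coef m (\<alpha> c J)"
    and T_multi_eval: "\<And>c j S H J. c \<in> charts_at A x \<Longrightarrow> j \<in> J2M A r \<Longrightarrow> fst j = x \<Longrightarrow> jet_value j = gx \<Longrightarrow>
      normal_form_at r c j S \<Longrightarrow> H \<in> S22 A x \<Longrightarrow> length J = p \<Longrightarrow>
      T (jet_add j H) c J = multi_eval (\<alpha> c J) (replicate m (normal_part (\<lambda>I. S c I + H c I)))"
begin

definition over :: "('x, 'n) jet \<Rightarrow> bool" where
  "over j \<longleftrightarrow> j \<in> J2M A r \<and> fst j = x \<and> jet_value j = gx"

lemma overD: "over j \<Longrightarrow> j \<in> J2M A r" "over j \<Longrightarrow> fst j = x" "over j \<Longrightarrow> jet_value j = gx"
  by (auto simp: over_def)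

lemma ex_over: "\<exists>j. over j"
  using ex_jet[OF gx] by (auto simp: over_def)

lemma over_jet_add: "over j \<Longrightarrow> H \<in> S22 A x \<Longrightarrow> over (jet_add j H)"
  using jet_add_mem by (auto simp: over_def)

lemma T_deriv:
  assumes j: "over j" and c: "c \<in> charts_at A x" and J: "length J = p"
    and Hs: "set Hs \<subseteq> S22 A x" "length Hs = m"
  shows "fibre_deriv Hs (\<lambda>i. T i c J) j = fact m * multi_eval (\<alpha> c J) (map (\<lambda>H. normal_part (H c)) Hs)"
proof -
  obtain S where S: "normal_form_at r c j S" using ex_normal_form_at[OF overD(1)[OF j], of c] c overD(2)[OF j] by auto
  show ?thesis
    by (rule fibre_deriv_full[OF coef_sym T_multi_eval[OF c overD[OF j] S _ J]]) (use Hs overD[OF j] in auto)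
qed

text \<open>The coefficients \<alpha> of c and d are not related by assumption. But the component of
  T in d is a linear combination of its components in c, hence again a polynomial of the same kind,
  with the combined coefficients of c.\<close>

lemma T_deriv_transform:
  assumes j: "over j" and c: "c \<in> charts_at A x" and d: "d \<in> charts_at A x" and J: "length J = p"
    and Hs: "set Hs \<subseteq> S22 A x" "length Hs = m"
  shows "fibre_deriv Hs (\<lambda>i. T i d J) j =
    lin_act p (jac c d x) (\<lambda>I. fact m * multi_eval (\<alpha> c I) (map (\<lambda>H. normal_part (H c)) Hs)) J"
proof -
  obtain S where S: "normal_form_at r c j S" using ex_normal_form_at[OF overD(1)[OF j], of c] c overD(2)[OF j] by auto
  define q where "q I = (\<Prod>r<p. jac c d x $ (J ! r) $ (I ! r))" for I
  define K where "K B = (\<Sum>I\<in>{I. length I = p}. q I * \<alpha> c I B)" for B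
  have Kf: "K = (\<lambda>B. \<Sum>I\<in>{I. length I = p}. q I * \<alpha> c I B)" by (rule ext) (rule K_def)
  have K: "symmetric_coef m K"
    unfolding symmetric_coef_def
  proof (intro ballI allI impI)
    fix B B' :: "'n list list" assume "B \<in> blocks m" "mset B' = mset B"
    then have "\<alpha> c I B' = \<alpha> c I B" for I using coef_sym[of c I] unfolding symmetric_coef_def by blast
    then show "K B' = K B" by (simp add: K_def)
  qed
  have "T (jet_add j H) d J = multi_eval K (replicate m (normal_part (\<lambda>I. S c I + H c I)))"
    if H: "H \<in> S22 A (fst j)" for H
  proof -
    have H': "H \<in> S22 A x" using H overD[OF j] by simp
    have "T (jet_add j H) \<in> tensors A p x"
      using tensor[OF overD(1)[OF over_jet_add[OF j H']]] overD[OF j] by simp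
    from tensor_transform[OF this c d J]
    have "T (jet_add j H) d J = lin_act p (jac c d x) (T (jet_add j H) c) J" .
    also have "\<dots> = (\<Sum>I\<in>{I. length I = p}. q I * multi_eval (\<alpha> c I) (replicate m (normal_part (\<lambda>I. S c I + H c I))))"
      unfolding lin_act_def q_def by (intro sum.cong refl) (simp add: T_multi_eval[OF c overD[OF j] S H'])
    finally show ?thesis unfolding Kf multi_eval_sum .
  qed
  then have "fibre_deriv Hs (\<lambda>i. T i d J) j = fact m * multi_eval K (map (\<lambda>H. normal_part (H c)) Hs)"
    by (rule fibre_deriv_full[OF K]) (use Hs overD[OF j] in auto)
  also have "\<dots> = lin_act p (jac c d x) (\<lambda>I. fact m * multi_eval (\<alpha> c I) (map (\<lambda>H. normal_part (H c)) Hs)) J"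
    unfolding Kf multi_eval_sum lin_act_def q_def by (simp add: sum_distrib_left mult_ac)
  finally show ?thesis .
qed

text \<open>The coefficients of the m-th differential of \<phi> composed with
  \<open>normal_part\<close>: m! times the polarization, evaluated on averaged unit arrays. No jet
  occurs in it, so independence of the jet is built in.\<close>

definition K :: "('x, 'n) tensor" where
  "K c I = (if c \<in> charts_at A x \<and> length I = p + 4 * m
    then fact m * multi_eval (\<alpha> c (take p I)) (map (\<lambda>b. sym_normal_part (delta b)) (chunks m (drop p I))) else 0)"

lemma K_outside: "c \<notin> charts_at A x \<Longrightarrow> K c I = 0"
  by (simp add: K_def)

lemma K_eq:
  assumes "c \<in> charts_at A x" "length J = p" "B \<in> blocks m"
  shows "K c (J @ concat B) = fact m * multi_eval (\<alpha> c J) (map (\<lambda>b. sym_normal_part (delta b)) B)"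
  using assms by (simp add: K_def chunks_concat length_concat_blocks)

lemma K_multi_eval:
  assumes "c \<in> charts_at A x" "length J = p" "length Cs = m"
  shows "multi_eval (\<lambda>B. K c (J @ concat B)) Cs = fact m * multi_eval (\<alpha> c J) (map sym_normal_part Cs)"
proof -
  have "multi_eval (\<lambda>B. K c (J @ concat B)) Cs =
    multi_eval (\<lambda>B. fact m * multi_eval (\<alpha> c J) (map (\<lambda>b. sym_normal_part (delta b)) B)) Cs"
    using assms by (intro multi_eval_cong) (auto simp: K_eq)
  also have "\<dots> = fact m * multi_eval (\<alpha> c J) (map (\<lambda>C I. \<Sum>b\<in>{b. length b = 4}. C b * sym_normal_part (delta b) I) Cs)"
    unfolding multi_eval_scale multi_eval_expand ..
  also have "(\<lambda>C I. \<Sum>b\<in>{b. length b = 4}. C b * sym_normal_part (delta b) I) = (sym_normal_part :: ('n list \<Rightarrow> real) \<Rightarrow> _)"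
    by (intro ext) (rule sym_normal_part_expand[symmetric])
  finally show ?thesis .
qed

text \<open>The directions along which fibre derivatives produce the components of K. Averaging puts
  them into \<open>S22\<close>; it changes no value, since \<open>sym_normal_part\<close> averages
  as well.\<close>

definition E :: "('x, 'n) chart \<Rightarrow> 'n list \<Rightarrow> ('x, 'n) tensor" where
  "E c b = cotensor_of c 4 x (avg (delta b))"

lemma E_self: "c \<in> charts_at A x \<Longrightarrow> E c b c [i, j, k, l] = avg (delta b) [i, j, k, l]"
  by (simp add: E_def cotensor_of_self)

lemma E_S22: "c \<in> charts_at A x \<Longrightarrow> E c b \<in> S22 A x"
  by (rule S22I[where c=c]) (simp_all add: E_self, simp_all add: E_def cotensor_of_mem avg_4)

lemma K_deriv:
  assumes "over j" "c \<in> charts_at A x" "length J = p" "B \<in> blocks m"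
  shows "K c (J @ concat B) = fibre_deriv (map (E c) B) (\<lambda>i. T i c J) j"
proof -
  have "normal_part (E c b c) = sym_normal_part (delta b)" for b
    unfolding sym_normal_part_def by (rule normal_part_cong) (rule E_self[OF assms(2)])
  then show ?thesis
    using T_deriv[OF assms(1-3), of "map (E c) B"] E_S22[OF assms(2)] assms
    by (simp add: K_eq o_def blocks_def image_subset_iff)
qed

lemma normal_part_S22: "H \<in> S22 A x \<Longrightarrow> normal_part (H c) = sym_normal_part (H c)"
  using sym_normal_part_symmetric[of "H c"] S22_sym[of H x c] by metis

lemma T_deriv_K:
  assumes "over j" "c \<in> charts_at A x" "length J = p" "set Hs \<subseteq> S22 A x" "length Hs = m"
  shows "fibre_deriv Hs (\<lambda>i. T i c J) j = multi_eval (\<lambda>B. K c (J @ concat B)) (map (\<lambda>H. H c) Hs)"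
proof -
  have "map (\<lambda>H. normal_part (H c)) Hs = map sym_normal_part (map (\<lambda>H. H c) Hs)"
  proof -
    have "normal_part (H c) = sym_normal_part (H c)" if "H \<in> set Hs" for H
      using normal_part_S22 assms(4) that by blast
    then show ?thesis by simp
  qed
  then show ?thesis using assms by (simp only: T_deriv K_multi_eval length_map)
qed

lemma E_transform:
  assumes c: "c \<in> charts_at A x" and d: "d \<in> charts_at A x" and b: "length b = 4"
  shows "normal_part (E d b c) = sym_normal_part (\<lambda>I. \<Prod>r<4. jac c d x $ (b ! r) $ (I ! r))"
proof -
  have "E d b c [i, j, k, l] = avg (\<lambda>I. \<Prod>r<4. jac c d x $ (b ! r) $ (I ! r)) [i, j, k, l]" for i j k l
    using c d by (simp add: E_def cotensor_of_def lin_act_avg) (simp add: avg_4 lin_act_delta[OF b])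
  then show ?thesis unfolding sym_normal_part_def by (rule normal_part_cong)
qed

text \<open>A component in d is the fibre derivative along the directions \<open>E d\<close>.
  Computed through c, the first p indices transform by \<open>T_deriv_transform\<close>, and the
  components of \<open>E d b\<close> in c are averaged products of Jacobian entries, which transform
  the blocks by \<open>lin_act_blocks\<close>.\<close>

lemma K_tensor: "K \<in> tensors A (p + 4 * m) x"
proof -
  have "K d I = lin_act (p + 4 * m) (jac c d x) (K c) I"
    if c: "c \<in> charts_at A x" and d: "d \<in> charts_at A x" and I: "length I = p + 4 * m" for c d I
  proof -
    obtain J B where J: "length J = p" and B: "B \<in> blocks m" and I: "I = J @ concat B"
      using ex_append_concat_blocks[OF I] by blast
    obtain j where j: "over j" using ex_over by blast
    let ?Q = "jac c d x"
    let ?w = "\<lambda>b I. \<Prod>r<4. ?Q $ (b ! r) $ (I ! r)"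
    have lB: "length B = m" using B by (simp add: blocks_def)
    have e: "map (\<lambda>H. normal_part (H c)) (map (E d) B) = map sym_normal_part (map ?w B)"
      using E_transform[OF c d] B by (auto simp: blocks_def)
    have "K d I = lin_act p ?Q (\<lambda>I. fact m * multi_eval (\<alpha> c I) (map (\<lambda>H. normal_part (H c)) (map (E d) B))) J"
      unfolding I K_deriv[OF j d J B]
      by (rule T_deriv_transform[OF j c d J]) (use E_S22[OF d] lB in auto)
    also have "\<dots> = lin_act p ?Q (\<lambda>I. fact m * multi_eval (\<alpha> c I) (map sym_normal_part (map ?w B))) J"
      unfolding e ..
    also have "\<dots> = lin_act p ?Q (\<lambda>I. multi_eval (\<lambda>B'. K c (I @ concat B')) (map ?w B)) J"
      by (rule lin_act_cong) (simp only: K_multi_eval[OF c] length_map lB)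
    also have "\<dots> = lin_act p ?Q (\<lambda>I. lin_act (4 * m) ?Q (\<lambda>I'. K c (I @ I')) (concat B)) J"
      by (rule lin_act_cong) (simp add: lin_act_blocks[OF B])
    also have "\<dots> = lin_act (p + 4 * m) ?Q (K c) I"
      unfolding I by (rule lin_act_append[OF J, symmetric])
    finally show ?thesis .
  qed
  moreover have "supported_at A (p + 4 * m) x K" by (auto simp: supported_at_def K_def)
  ultimately show ?thesis unfolding tensors_def mem_Collect_eq by blast
qed

lemma K_symmetric:
  assumes "length J = p" "B \<in> blocks m" "mset B' = mset B"
  shows "K c (J @ concat B') = K c (J @ concat B)"
proof (cases "c \<in> charts_at A x")
  case True
  have "multi_eval (\<alpha> c J) (map (\<lambda>b. sym_normal_part (delta b)) B') = multi_eval (\<alpha> c J) (map (\<lambda>b. sym_normal_part (delta b)) B)"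
    using assms coef_sym[of c J] by (intro multi_eval_permute) (auto simp: blocks_def)
  then show ?thesis using True assms mset_blocks[OF assms(2,3)] by (simp add: K_eq)
qed (simp add: K_outside)

text \<open>Symmetry of the form moves the block s to the head, where the form is visibly linear in
  it.\<close>

lemma K_update:
  assumes c: "c \<in> charts_at A x" "length J = p" "B \<in> blocks m" "s < m" "length b = 4"
  shows "K c (J @ concat (B[s := b])) = fact m * multi_eval (\<alpha> c J)
    (sym_normal_part (delta b) # (take s (map (\<lambda>b. sym_normal_part (delta b)) B) @ drop (Suc s) (map (\<lambda>b. sym_normal_part (delta b)) B)))"
proof -
  have "length B = m" using assms by (simp add: blocks_def)
  then show ?thesis
    using multi_eval_update[of "map (\<lambda>b. sym_normal_part (delta b)) B" "\<alpha> c J" s "sym_normal_part (delta b)"] coef_sym[of c J] assms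
    by (simp add: K_eq blocks_update map_update)
qed

lemma K_sym_normal: "K \<in> sym_normal_tensors A p m x"
proof -
  have sw: "K c (J @ concat (B[s := [a, b, e, f]])) = K c (J @ concat (B[s := [b, a, e, f]])) \<and>
          K c (J @ concat (B[s := [a, b, e, f]])) = K c (J @ concat (B[s := [a, b, f, e]]))"
    if "length J = p" "B \<in> blocks m" "s < m" for c J B s a b e f
    using that sym_normal_part_delta_swap[of b a e f] sym_normal_part_delta_swap(2)[of a b e f]
    by (cases "c \<in> charts_at A x") (simp_all add: K_update K_outside)
  have sy: "symmetrize3 (\<lambda>b e f. K c (J @ concat (B[s := [a, b, e, f]]))) b e f = 0"
    if "length J = p" "B \<in> blocks m" "s < m" for c J B s a b e f
  proof (cases "c \<in> charts_at A x")
    case c: True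
    define R where "R = take s (map (\<lambda>b. sym_normal_part (delta b)) B) @ drop (Suc s) (map (\<lambda>b. sym_normal_part (delta b)) B)"
    define M where "M b' = multi_eval (\<lambda>B. \<alpha> c J (b' # B)) R" for b'
    have "K c (J @ concat (B[s := [a, b, e, f]])) = (\<Sum>b'\<in>{b'. length b' = 4}. sym_normal_part (delta [a, b, e, f]) b' * (fact m * M b'))"
      for a b e f
      by (simp add: K_update[OF c that] multi_eval_Cons R_def[symmetric] M_def[symmetric] sum_distrib_left mult_ac)
    then have "symmetrize3 (\<lambda>b e f. K c (J @ concat (B[s := [a, b, e, f]]))) b e f =
      (\<Sum>b'\<in>{b'. length b' = 4}. symmetrize3 (\<lambda>b e f. sym_normal_part (delta [a, b, e, f]) b') b e f * (fact m * M b'))"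
      by (simp add: symmetrize3_def sum.distrib distrib_right)
    also have "\<dots> = 0"
    proof (rule sum.neutral, intro ballI)
      fix b' :: "'n list" assume "b' \<in> {b'. length b' = 4}"
      then obtain i j k l where "b' = [i, j, k, l]" by (auto elim: length_4E)
      then show "symmetrize3 (\<lambda>b e f. sym_normal_part (delta [a, b, e, f]) b') b e f * (fact m * M b') = 0"
        by (simp only: sym_normal_part_delta_symmetrize mult_zero_left)
    qed
    finally show ?thesis .
  qed (simp add: K_outside symmetrize3_def)
  show ?thesis
    unfolding sym_normal_tensors_def sym_block_tensors_def mem_Collect_eq
    using K_tensor K_symmetric sw sy by blast
qed

lemma K_is_derivative:
  assumes j: "over j"
  shows "is_mth_derivative A p m T j K"
proof -
  have "fibre_deriv Hs (\<lambda>i. T i c J) j = (\<Sum>B\<in>blocks m. K c (J @ concat B) * (\<Prod>s<m. (Hs ! s) c (B ! s)))"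
    if "length Hs = m" "set Hs \<subseteq> S22 A x" "c \<in> charts_at A x" "length J = p" for Hs c J
    using T_deriv_K[OF j that(3,4,2,1)] that(1) by (simp add: multi_eval_def)
  then show ?thesis
    using K_sym_normal overD(2)[OF j] by (auto simp: is_mth_derivative_def sym_normal_tensors_def)
qed

end

section \<open>Homogeneous tensors are polynomial on the fibres\<close>

context smooth_manifold
begin

lemma second_order_tensorD:
  assumes "second_order_tensor A r p T"
  shows "T \<in> extensional (J2M A r)" "j \<in> J2M A r \<Longrightarrow> T j \<in> tensors A p (fst j)"
    "c \<in> A \<Longrightarrow> length J = p \<Longrightarrow> \<exists>D (F :: (real^'n) \<times> 'n jet_coords \<Rightarrow> real). open D \<and> smooth_on D F \<and>
           (\<forall>j\<in>J2M A r. fst j \<in> fst c \<longrightarrow>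
              (snd c (fst j), snd j c) \<in> D \<and> T j c J = F (snd c (fst j), snd j c))"
  using assms unfolding second_order_tensor_def by blast+

lemma J2M_value: "j \<in> J2M A r \<Longrightarrow> jet_value j \<in> metrics_at A r (fst j)"
  by (erule J2ME) (metis jet_value_jet2 metric_on_def)

text \<open>Homogeneity constrains T only on metrics that have a normal chart.
  \<open>normal_form\<close> supplies such a metric for every jet over gx and every translate of it,
  and T depends on the jet alone.\<close>

lemma ex_polynomial_tensor:
  assumes gx: "gx \<in> metrics_at A r x" and T: "second_order_tensor A r p T" and h: "homogeneous_at A r p m x gx T"
  shows "\<exists>\<alpha>. polynomial_tensor A r p m x gx T \<alpha>"
proof -
  obtain \<phi> where \<phi>: "homogeneous_polynomial_map A p m x \<phi>"
    and T\<phi>: "\<And>W g N. metric_on A r W g \<and> x \<in> W \<and> g x = gx \<and> is_normal_tensor A W g x N \<Longrightarrow> T (jet2 A g x) = \<phi> N"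
    using h unfolding homogeneous_at_def by blast
  have "\<exists>a. \<forall>N\<in>normal_tensors A x. \<forall>J. length J = p \<longrightarrow> \<phi> N c J = (\<Sum>B\<in>blocks m. a J B * (\<Prod>s<m. N c (B ! s)))"
    if "c \<in> charts_at A x" for c
    using \<phi> that unfolding homogeneous_polynomial_map_def by blast
  then have "\<forall>c. \<exists>a. c \<in> charts_at A x \<longrightarrow> (\<forall>N\<in>normal_tensors A x. \<forall>J. length J = p \<longrightarrow>
      \<phi> N c J = (\<Sum>B\<in>blocks m. a J B * (\<Prod>s<m. N c (B ! s))))" by blast
  from choice[OF this] obtain a where a: "\<And>c N J. c \<in> charts_at A x \<Longrightarrow> N \<in> normal_tensors A x \<Longrightarrow> length J = p \<Longrightarrow>
      \<phi> N c J = (\<Sum>B\<in>blocks m. a c J B * (\<Prod>s<m. N c (B ! s)))"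
    by blast
  have "polynomial_tensor A r p m x gx T (\<lambda>c J. sym_coef m (a c J))"
  proof
    show "gx \<in> metrics_at A r x" by (rule gx)
    show "T j \<in> tensors A p (fst j)" if "j \<in> J2M A r" for j
      using second_order_tensorD(2)[OF T that] .
    show "symmetric_coef m (sym_coef m (a c J))" for c J by (rule symmetric_sym_coef)
    fix c j S H J
    assume c: "c \<in> charts_at A x" and j: "j \<in> J2M A r" "fst j = x" "jet_value j = gx"
      and S: "normal_form_at r c j S" and H: "H \<in> S22 A x" and J: "length (J :: 'n list) = p"
    obtain W' g' N where g': "metric_on A r W' g'" "x \<in> W'" "jet2 A g' x = jet_add j H"
      and N: "is_normal_tensor A W' g' x N" "N \<in> normal_tensors A x"
        "\<And>I. length I = 4 \<Longrightarrow> N c I = normal_part (\<lambda>I. S c I + H c I) I"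
      using S H unfolding normal_form_at_def j(2) by blast
    have "g' x \<in> metrics_at A r x" using g' by (simp add: metric_on_def)
    then have "g' x = gx" using jet_value_jet2[of g' x r] g'(3) j(3) by simp
    then have "T (jet_add j H) c J = \<phi> N c J" using T\<phi>[of W' g' N] g' N(1) by simp
    also have "\<dots> = multi_eval (a c J) (replicate m (N c))"
      by (simp add: a[OF c N(2) J] multi_eval_def)
    also have "\<dots> = multi_eval (sym_coef m (a c J)) (replicate m (N c))"
      by (rule multi_eval_sym_coef[symmetric])
    also have "\<dots> = multi_eval (sym_coef m (a c J)) (replicate m (normal_part (\<lambda>I. S c I + H c I)))"
      by (rule multi_eval_cong) (simp_all add: N(3))
    finally show "T (jet_add j H) c J = multi_eval (sym_coef m (a c J)) (replicate m (normal_part (\<lambda>I. S c I + H c I)))" .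
  qed
  then show ?thesis by blast
qed

subsection \<open>Direct images\<close>

text \<open>The direct image of a jet without reference to a representing metric, so that naturality
  combines with translations along the fibre. Components are only relabelled: the chart d reads what
  the chart pulled back from d read before.\<close>

definition push_jet :: "'x set \<Rightarrow> ('x \<Rightarrow> 'x) \<Rightarrow> ('x, 'n) jet \<Rightarrow> ('x, 'n) jet" where
  "push_jet U \<tau> j = (\<tau> (fst j), \<lambda>d. if d \<in> charts_at A (\<tau> (fst j)) then snd j (pull_chart U \<tau> d) else 0)"

lemma pull_chart_mem:
  assumes \<tau>: "diffeo A U V \<tau>" and x: "x \<in> U"
  shows "d \<in> A \<Longrightarrow> pull_chart U \<tau> d \<in> charts_at A x \<longleftrightarrow> d \<in> charts_at A (\<tau> x)"
  using pull_chart(1)[OF \<tau>, of d] x by (auto simp: charts_at_def pull_chart_def)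

lemma snd_pull_chart: "snd (pull_chart U \<tau> d) x = snd d (\<tau> x)"
  by (simp add: pull_chart_def)

lemma metric_coords_push:
  assumes \<tau>: "diffeo A U V \<tau>" and d: "d \<in> A" and y: "y \<in> snd d ` (fst d \<inter> V)"
  shows "metric_coords (push_metric A U \<tau> g) d y = metric_coords g (pull_chart U \<tau> d) y"
  using pull_chart(3)[OF \<tau> d y] d by (simp add: metric_coords_def push_metric_def)

lemma push_metric_on:
  assumes \<tau>: "diffeo A U V \<tau>" and g: "metric_on A r W g"
  shows "metric_on A r (V \<inter> inv_into U \<tau> -` W) (push_metric A U \<tau> g)"
proof -
  note di = diffeo_inv[OF \<tau>]
  let ?W = "V \<inter> inv_into U \<tau> -` W"
  have W: "open ?W"
    using \<tau> g by (intro continuous_open_preimage) (auto simp: diffeo_def homeomorphism_def metric_on_def)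
  have at: "push_metric A U \<tau> g y \<in> metrics_at A r y" if y: "y \<in> ?W" for y
  proof -
    define z where "z = inv_into U \<tau> y"
    have z: "z \<in> U" "\<tau> z = y" "z \<in> W" using y di by (auto simp: z_def)
    have gz: "g z \<in> metrics_at A r z" using g z by (simp add: metric_on_def)
    have pg: "push_metric A U \<tau> g y d = g z (pull_chart U \<tau> d)" if "d \<in> A" for d
      using that by (simp add: push_metric_def z_def)
    note mem = pull_chart_at[OF \<tau> z(1), unfolded z(2)]
    have 1: "push_metric A U \<tau> g y d = 0" if "d \<notin> charts_at A y" for d
    proof (cases "d \<in> A")
      case True
      then have "pull_chart U \<tau> d \<notin> charts_at A z" using pull_chart_mem[OF \<tau> z(1) True] that z by simp
      then show ?thesis using metric_zero[OF gz] pg[OF True] by simp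
    qed (simp add: push_metric_def)
    have 2: "push_metric A U \<tau> g y c = transpose (jac c d y) ** push_metric A U \<tau> g y d ** jac c d y"
      if c: "c \<in> charts_at A y" and d: "d \<in> charts_at A y" for c d
      using metric_transform[OF gz mem[OF d] mem[OF c]] jac_pull_chart[OF \<tau> z(1), unfolded z(2), OF c d]
        pg charts_atD(1)[OF c] charts_atD(1)[OF d] by simp
    have 3: "has_signature r (push_metric A U \<tau> g y c)" if c: "c \<in> charts_at A y" for c
      using metrics_at_signature[OF gz mem[OF c]] pg charts_atD(1)[OF c] by simp
    show ?thesis unfolding metrics_at_def mem_Collect_eq using 1 2 3 by blast
  qed
  have "smooth_on (snd d ` (fst d \<inter> ?W)) (metric_coords (push_metric A U \<tau> g) d)" if d: "d \<in> A" for d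
  proof -
    let ?O = "snd d ` (fst d \<inter> ?W)"
    have O: "open ?O" by (rule open_image_Int[OF d W])
    have sub: "?O \<subseteq> snd (pull_chart U \<tau> d) ` (fst (pull_chart U \<tau> d) \<inter> W)"
    proof
      fix y assume "y \<in> ?O"
      then obtain z where z: "z \<in> fst d" "z \<in> V" "inv_into U \<tau> z \<in> W" "y = snd d z" by auto
      then show "y \<in> snd (pull_chart U \<tau> d) ` (fst (pull_chart U \<tau> d) \<inter> W)"
        using di(2,4)[OF z(2)] by (auto simp: pull_chart_def intro!: image_eqI[of _ _ "inv_into U \<tau> z"])
    qed
    have "smooth_on ?O (metric_coords g (pull_chart U \<tau> d))"
      by (rule smooth_on_subset[OF metric_coords_smooth[OF g pull_chart(1)[OF \<tau> d]] sub])
    moreover have "metric_coords (push_metric A U \<tau> g) d y = metric_coords g (pull_chart U \<tau> d) y" if "y \<in> ?O" for y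
      using that by (intro metric_coords_push[OF \<tau> d]) auto
    ultimately show ?thesis using smooth_on_cong[OF O, of "metric_coords (push_metric A U \<tau> g) d"] by simp
  qed
  then show ?thesis using W at by (simp add: metric_on_def)
qed

lemma jet2_push:
  assumes \<tau>: "diffeo A U V \<tau>" and x: "x \<in> U"
  shows "jet2 A (push_metric A U \<tau> g) (\<tau> x) = push_jet U \<tau> (jet2 A g x)"
proof -
  note di = diffeo_inv[OF \<tau>]
  have "snd (jet2 A (push_metric A U \<tau> g) (\<tau> x)) d = snd (jet2 A g x) (pull_chart U \<tau> d)"
    if d: "d \<in> charts_at A (\<tau> x)" for d
  proof -
    note m = charts_atD[OF d]
    let ?O = "snd d ` (fst d \<inter> V)"
    have O: "open ?O" "snd d (\<tau> x) \<in> ?O"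
      using \<tau> m x di by (auto intro!: open_image_Int simp: diffeo_def)
    note e = metric_coords_push[OF \<tau> m(1), of _ g]
    have 1: "pd k (\<lambda>z. metric_coords (push_metric A U \<tau> g) d z $ i $ j) y =
      pd k (\<lambda>z. metric_coords g (pull_chart U \<tau> d) z $ i $ j) y" if "y \<in> ?O" for i j k y
      by (rule pd_cong[OF O(1) that]) (simp add: e)
    have 2: "pd l (pd k (\<lambda>z. metric_coords (push_metric A U \<tau> g) d z $ i $ j)) (snd d (\<tau> x)) =
      pd l (pd k (\<lambda>z. metric_coords g (pull_chart U \<tau> d) z $ i $ j)) (snd d (\<tau> x))" for i j k l
      by (rule pd_cong[OF O 1])
    show ?thesis
      using pull_chart_at[OF \<tau> x d] d by (simp add: jet2_snd snd_pull_chart 1[OF O(2)] 2 e[OF O(2)])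
  qed
  then show ?thesis by (auto simp: push_jet_def jet2_def)
qed

lemma push_jet_mem:
  assumes \<tau>: "diffeo A U V \<tau>" and j: "j \<in> J2M A r" and x: "fst j \<in> U"
  shows "push_jet U \<tau> j \<in> J2M A r"
proof -
  obtain W g where g: "j = jet2 A g (fst j)" "metric_on A r W g" "fst j \<in> W" using j by (rule J2ME)
  note di = diffeo_inv[OF \<tau>]
  have "jet2 A (push_metric A U \<tau> g) (\<tau> (fst j)) \<in> J2M A r"
    by (rule J2MI[OF push_metric_on[OF \<tau> g(2)]]) (use x di g in auto)
  then show ?thesis using jet2_push[OF \<tau> x, of g] g(1) by simp
qed

lemma push_jet_value:
  assumes "c \<in> charts_at A (\<tau> (fst j))"
  shows "jet_value (push_jet U \<tau> j) c = jet_value j (pull_chart U \<tau> c)"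
  using assms by (simp add: jet_value_def push_jet_def)

lemma natural_push:
  assumes T: "natural_tensor A r p T" and \<tau>: "diffeo A U V \<tau>" and j: "j \<in> J2M A r" and x: "fst j \<in> U"
  shows "T (push_jet U \<tau> j) = push_tensor A U \<tau> (T j)"
proof -
  obtain W g where g: "j = jet2 A g (fst j)" "metric_on A r W g" "fst j \<in> W" using j by (rule J2ME)
  have "T (jet2 A (push_metric A U \<tau> g) (\<tau> (fst j))) = push_tensor A U \<tau> (T (jet2 A g (fst j)))"
    using T \<tau> g x unfolding natural_tensor_def by blast
  then show ?thesis using jet2_push[OF \<tau> x, of g] g(1) by simp
qed

lemma push_cotensor:
  assumes \<tau>: "diffeo A U V \<tau>" and x: "x \<in> U" and H: "H \<in> cotensors A k x"
  shows "push_tensor A U \<tau> H \<in> cotensors A k (\<tau> x)"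
proof -
  note mem = pull_chart_at[OF \<tau> x]
  have 1: "push_tensor A U \<tau> H d I = 0" if "d \<notin> charts_at A (\<tau> x) \<or> length I \<noteq> k" for d I
    using that pull_chart_mem[OF \<tau> x, of d] cotensor_zero[OF H, of "pull_chart U \<tau> d" I]
    by (auto simp: push_tensor_def)
  have 2: "push_tensor A U \<tau> H c J = lin_act k (transpose (jac c d (\<tau> x))) (push_tensor A U \<tau> H d) J"
    if c: "c \<in> charts_at A (\<tau> x)" and d: "d \<in> charts_at A (\<tau> x)" and J: "length J = k" for c d J
    using cotensor_transform[OF H mem[OF d] mem[OF c] J] charts_atD(1)[OF c] charts_atD(1)[OF d]
      jac_pull_chart[OF \<tau> x c d] by (simp add: push_tensor_def[abs_def])
  show ?thesis
    unfolding cotensors_def supported_at_def mem_Collect_eq using 1 2 by blast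
qed

lemma push_jet_add:
  assumes \<tau>: "diffeo A U V \<tau>" and x: "fst j \<in> U" and H: "H \<in> cotensors A 4 (fst j)"
  shows "push_jet U \<tau> (jet_add j H) = jet_add (push_jet U \<tau> j) (push_tensor A U \<tau> H)"
proof -
  have pt: "push_tensor A U \<tau> H d I = H (pull_chart U \<tau> d) I" if "d \<in> charts_at A (\<tau> (fst j))" for d I
    using charts_atD(1)[OF that] by (simp add: push_tensor_def)
  have z: "push_tensor A U \<tau> H d I = 0" if "d \<notin> charts_at A (\<tau> (fst j))" for d I
    using cotensor_zero[OF push_cotensor[OF \<tau> x H]] that by blast
  show ?thesis
    by (auto simp: push_jet_def jet_add_def z zero_prod_def vec_eq_iff pt intro!: ext)
qed

text \<open>The direct image is affine on the fibres of the 2-jets over the 1-jets, by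
  \<open>push_jet_add\<close>. Naturality can therefore be differentiated along them, with the
  directions transported too.\<close>

lemma fibre_deriv_push:
  assumes T: "natural_tensor A r p T" and \<tau>: "diffeo A U V \<tau>" and c: "c \<in> A"
  shows "j \<in> J2M A r \<Longrightarrow> fst j \<in> U \<Longrightarrow> set Hs \<subseteq> S22 A (fst j) \<Longrightarrow>
    fibre_deriv (map (push_tensor A U \<tau>) Hs) (\<lambda>i. T i c J) (push_jet U \<tau> j) =
    fibre_deriv Hs (\<lambda>i. T i (pull_chart U \<tau> c) J) j"
proof (induction Hs arbitrary: j)
  case Nil
  then show ?case using natural_push[OF T \<tau>] c by (simp add: push_tensor_def)
next
  case (Cons H Hs)
  have "fibre_deriv (map (push_tensor A U \<tau>) Hs) (\<lambda>i. T i c J)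
      (jet_add (push_jet U \<tau> j) (\<lambda>c I. t * push_tensor A U \<tau> H c I)) =
    fibre_deriv Hs (\<lambda>i. T i (pull_chart U \<tau> c) J) (jet_add j (\<lambda>c I. t * H c I))" for t
  proof -
    have tH: "(\<lambda>c I. t * H c I) \<in> S22 A (fst j)" using Cons.prems by (intro scale_S22) auto
    have "(\<lambda>c I. t * push_tensor A U \<tau> H c I) = push_tensor A U \<tau> (\<lambda>c I. t * H c I)"
      by (simp add: push_tensor_def fun_eq_iff)
    then have "jet_add (push_jet U \<tau> j) (\<lambda>c I. t * push_tensor A U \<tau> H c I) = push_jet U \<tau> (jet_add j (\<lambda>c I. t * H c I))"
      using push_jet_add[OF \<tau> Cons.prems(2) S22_cotensor[OF tH]] by simp
    then show ?thesis
      using Cons.IH[of "jet_add j (\<lambda>c I. t * H c I)"] jet_add_mem[OF Cons.prems(1) tH] Cons.prems by simp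
  qed
  then show ?case by simp
qed

lemma congruence_cancel:
  fixes L X Y :: "real^'m^'m::finite"
  assumes "invertible L" "transpose L ** X ** L = transpose L ** Y ** L"
  shows "X = Y"
proof -
  obtain M :: "real^'m^'m" where M: "L ** M = mat 1" "M ** L = mat 1" using assms(1) by (auto simp: invertible_def)
  have M': "transpose M ** transpose L = mat 1" by (simp add: M flip: matrix_transpose_mul)
  have e: "transpose M ** (transpose L ** Z ** L) ** M = (transpose M ** transpose L) ** Z ** (L ** M)" for Z
    by (simp add: matrix_mul_assoc)
  have "transpose M ** (transpose L ** X ** L) ** M = transpose M ** (transpose L ** Y ** L) ** M"
    by (simp only: assms(2))
  then show ?thesis unfolding e by (simp add: M M')
qed

end

section \<open>Consequences of naturality: invariance and injectivity\<close>

context polynomial_tensor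
begin

text \<open>The Jacobian L is the congruence between the value of j and gx, so the direct image has
  the value gx at x.\<close>

lemma over_push:
  assumes \<tau>: "diffeo A U V \<tau>" and j: "j \<in> J2M A r" "fst j \<in> U" "\<tau> (fst j) = x"
    and c: "c \<in> charts_at A x" and c': "c' \<in> charts_at A (fst j)"
    and v: "jet_value j c' = transpose L ** gx c ** L" and L: "invertible L" "jac c' (pull_chart U \<tau> c) (fst j) = L"
  shows "over (push_jet U \<tau> j)"
proof -
  note p = pull_chart_at[OF \<tau> j(2), unfolded j(3), OF c]
  have mem: "push_jet U \<tau> j \<in> J2M A r" by (rule push_jet_mem[OF \<tau> j(1,2)])
  have fst: "fst (push_jet U \<tau> j) = x" by (simp add: push_jet_def j(3))
  have "transpose L ** gx c ** L = transpose L ** jet_value j (pull_chart U \<tau> c) ** L"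
    using metric_transform[OF J2M_value[OF j(1)] p c'] v L by simp
  then have "gx c = jet_value j (pull_chart U \<tau> c)" by (rule congruence_cancel[OF L(1)])
  then have "jet_value (push_jet U \<tau> j) c = gx c"
    using push_jet_value[of c \<tau> j U] c j(3) by simp
  then have "jet_value (push_jet U \<tau> j) = gx"
    using metrics_at_eqI[OF J2M_value[OF mem, unfolded fst] gx c] by blast
  then show ?thesis using mem fst by (simp add: over_def)
qed

text \<open>A linear diffeomorphism with Jacobian Q fixes x and the value gx. Transporting jet and
  directions along it shows that K has equal components in c and in the chart pulled back from c,
  while the transformation law relates these by Q.\<close>

lemma K_orthogonal:
  assumes nat: "natural_tensor A r p T"
  shows "orthogonal_invariant A (p + 4 * m) x gx K"
  unfolding orthogonal_invariant_def
proof (intro ballI allI impI)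
  fix c :: "('x, 'n) chart" and Q :: "real^'n^'n" and I :: "'n list"
  assume c: "c \<in> charts_at A x" and Q: "transpose Q ** gx c ** Q = gx c" and I: "length I = p + 4 * m"
  have "invertible (gx c)" by (rule has_signature_invertible[OF metrics_at_signature[OF gx c]])
  then obtain G :: "real^'n^'n" where "G ** gx c = mat 1" by (auto simp: invertible_def)
  then have "(G ** transpose Q ** gx c) ** Q = mat 1"
    using Q by (simp flip: matrix_mul_assoc)
  then have Qi: "invertible Q" using invertible_left_inverse by blast
  obtain U V \<tau> where \<tau>: "diffeo A U V \<tau>" "x \<in> U" "\<tau> x = x" "jac c (pull_chart U \<tau> c) x = Q"
    by (rule ex_linear_diffeo[OF c c Qi])
  let ?c = "pull_chart U \<tau> c"
  have c': "?c \<in> charts_at A x" using pull_chart_at[OF \<tau>(1,2)] \<tau>(3) c by simp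
  obtain j where j: "over j" using ex_over by blast
  have jx: "j \<in> J2M A r" "fst j = x" "jet_value j = gx" using overD[OF j] by auto
  have pj: "over (push_jet U \<tau> j)"
    by (rule over_push[OF \<tau>(1) jx(1) _ _ c, where c'=c and L=Q]) (use jx \<tau> c Q Qi in auto)
  \<comment> \<open>Direct images only relabel charts, so both tensors have the same averaged unit
    array as components in c.\<close>
  have EE: "push_tensor A U \<tau> (E ?c b) = E c b" if "length b = 4" for b
  proof (rule cotensor_eqI[OF _ _ c])
    show "push_tensor A U \<tau> (E ?c b) \<in> cotensors A 4 x"
      using push_cotensor[OF \<tau>(1,2) S22_cotensor[OF E_S22[OF c']]] \<tau>(3) by simp
    show "E c b \<in> cotensors A 4 x" by (rule S22_cotensor[OF E_S22[OF c]])
    fix I :: "'n list" assume "length I = 4"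
    then show "push_tensor A U \<tau> (E ?c b) c I = E c b c I"
      using charts_atD(1)[OF c] by (auto simp: push_tensor_def E_self[OF c] E_self[OF c'] elim!: length_4E)
  qed
  obtain J B where J: "length J = p" and B: "B \<in> blocks m" and I': "I = J @ concat B"
    using ex_append_concat_blocks[OF I] by blast
  have e: "map (push_tensor A U \<tau>) (map (E ?c) B) = map (E c) B"
    using EE B by (auto simp: blocks_def)
  have "K c I = fibre_deriv (map (push_tensor A U \<tau>) (map (E ?c) B)) (\<lambda>i. T i c J) (push_jet U \<tau> j)"
    unfolding I' e by (rule K_deriv[OF pj c J B])
  also have "\<dots> = fibre_deriv (map (E ?c) B) (\<lambda>i. T i ?c J) j"
    by (rule fibre_deriv_push[OF nat \<tau>(1) charts_atD(1)[OF c] jx(1)]) (use jx \<tau> E_S22[OF c'] in auto)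
  also have "\<dots> = K ?c I" unfolding I' by (rule K_deriv[OF j c' J B, symmetric])
  also have "\<dots> = lin_act (p + 4 * m) Q (K c) I"
    using tensor_transform[OF K_tensor c c' I] \<tau>(4) by simp
  finally show "lin_act (p + 4 * m) Q (K c) I = K c I" ..
qed

text \<open>A homogeneous polynomial is 1/m! times its m-th differential on equal arguments. As S
  has the symmetries of \<open>S22\<close>, its plain and its averaged normal parts agree.\<close>

lemma T_from_K:
  assumes j: "over j" and c: "c \<in> charts_at A x" and S: "normal_form_at r c j S" and J: "length J = p"
  shows "T j c J = 1 / fact m * multi_eval (\<lambda>B. K c (J @ concat B)) (replicate m (S c))"
proof -
  have S': "S \<in> S22 A x" using S overD(2)[OF j] by (simp add: normal_form_at_def)
  have "T j c J = multi_eval (\<alpha> c J) (replicate m (normal_part (S c)))"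
    using T_multi_eval[OF c overD[OF j] S zero_S22 J] by (simp add: jet_add_0)
  then show ?thesis
    using K_multi_eval[OF c J, of "replicate m (S c)"] by (simp add: normal_part_S22[OF S'])
qed

end

text \<open>Two instances of the locale are compared, which is why this stands outside it. For jets
  over gx both tensors are given by \<open>T_from_K\<close> with the same S and the same K; every
  other jet is first transported to one over gx.\<close>

lemma polynomial_tensor_determined:
  assumes 1: "polynomial_tensor A r p m x gx T1 \<alpha>1" and 2: "polynomial_tensor A r p m x gx T2 \<alpha>2"
    and n1: "natural_tensor A r p T1" and n2: "natural_tensor A r p T2"
    and K: "polynomial_tensor.K A p m x \<alpha>1 = polynomial_tensor.K A p m x \<alpha>2"
  shows "T1 = T2"
proof -
  interpret P1: polynomial_tensor A r p m x gx T1 \<alpha>1 by (rule 1)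
  interpret P2: polynomial_tensor A r p m x gx T2 \<alpha>2 by (rule 2)
  have s1: "second_order_tensor A r p T1" and s2: "second_order_tensor A r p T2"
    using n1 n2 by (auto simp: natural_tensor_def)
  obtain c where c: "c \<in> charts_at A x" using P1.ex_chart_at by blast
  have over: "T1 j = T2 j" if j: "P1.over j" for j
  proof -
    have j2: "P2.over j" using j by (simp add: P1.over_def P2.over_def)
    note jx = P1.overD[OF j]
    obtain S where S: "P1.normal_form_at r c j S" using P1.ex_normal_form_at[OF jx(1), of c] c jx(2) by auto
    show ?thesis
    proof (rule P1.tensor_eqI[OF _ _ c])
      show "T1 j \<in> tensors A p x" "T2 j \<in> tensors A p x"
        using P1.tensor[OF jx(1)] P2.tensor[OF jx(1)] jx(2) by simp_all
      show "T1 j c J = T2 j c J" if "length J = p" for J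
        using P1.T_from_K[OF j c S that] P2.T_from_K[OF j2 c S that] K by simp
    qed
  qed
  show ?thesis
  proof (rule extensionalityI[OF P1.second_order_tensorD(1)[OF s1] P1.second_order_tensorD(1)[OF s2]])
    fix i assume i: "i \<in> J2M A r"
    obtain c' where c': "c' \<in> charts_at A (fst i)" using P1.ex_chart_at by blast
    \<comment> \<open>Equal signatures make the two values congruent; the diffeomorphism with
      Jacobian L will carry i to a jet over gx.\<close>
    obtain L :: "real^'b^'b" where L: "invertible L" "jet_value i c' = transpose L ** gx c ** L"
      by (rule same_signature_congruent[OF P1.metrics_at_signature[OF P1.gx c] P1.metrics_at_signature[OF P1.J2M_value[OF i] c']])
    obtain U V \<tau> where \<tau>: "diffeo A U V \<tau>" "fst i \<in> U" "\<tau> (fst i) = x" "jac c' (pull_chart U \<tau> c) (fst i) = L"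
      by (rule P1.ex_linear_diffeo[OF c c' L(1)])
    have "P1.over (P1.push_jet U \<tau> i)"
      by (rule P1.over_push[OF \<tau>(1) i \<tau>(2,3) c c' L(2,1) \<tau>(4)])
    then have e: "push_tensor A U \<tau> (T1 i) = push_tensor A U \<tau> (T2 i)"
      using over P1.natural_push[OF n1 \<tau>(1) i \<tau>(2)] P1.natural_push[OF n2 \<tau>(1) i \<tau>(2)] by metis
    have p: "pull_chart U \<tau> c \<in> charts_at A (fst i)"
      using P1.pull_chart_at[OF \<tau>(1,2)] \<tau>(3) c by simp
    show "T1 i = T2 i"
    proof (rule P1.tensor_eqI[OF P1.tensor[OF i] P2.tensor[OF i] p])
      show "T1 i (pull_chart U \<tau> c) I = T2 i (pull_chart U \<tau> c) I" for I
        using fun_cong[OF fun_cong[OF e, of c], of I] P1.charts_atD(1)[OF c] by (simp add: push_tensor_def)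
    qed
  qed
qed

subsection \<open>The divergence\<close>

lemma has_derivative_vec_lambda:
  fixes f :: "'n::finite \<Rightarrow> 'a::real_normed_vector \<Rightarrow> 'b::real_normed_vector"
  assumes "\<And>i. (f i has_derivative f' i) (at x)"
  shows "((\<lambda>x. \<chi> i. f i x) has_derivative (\<lambda>v. \<chi> i. f' i v)) (at x)"
proof -
  have "((\<lambda>x. \<Sum>i\<in>UNIV. axis i (f i x)) has_derivative (\<lambda>v. \<Sum>i\<in>UNIV. axis i (f' i v))) (at x)"
    by (intro has_derivative_sum bounded_linear.has_derivative[OF bounded_linear_axis] assms)
  moreover have "(\<Sum>i\<in>UNIV. axis i (h i)) = (\<chi> i. h i)" for h :: "'n \<Rightarrow> 'b"
    using vec_eq_sum_axis[of "\<chi> i. h i"] by simp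
  ultimately show ?thesis by simp
qed

context smooth_manifold
begin

lemma jet_coords_has_derivative:
  assumes g: "metric_on A r W g" "x \<in> W" and c: "c \<in> charts_at A x"
  shows "((\<lambda>z. (z, snd (jet2 A g (chart_inv c z)) c)) has_derivative
    (\<lambda>v. (v, frechet_derivative (metric_coords g c) (at (snd c x)) v,
      \<chi> i j k. frechet_derivative (pd k (\<lambda>z. metric_coords g c z $ i $ j)) (at (snd c x)) v,
      \<chi> i j k l. frechet_derivative (pd l (pd k (\<lambda>z. metric_coords g c z $ i $ j))) (at (snd c x)) v)))
    (at (snd c x))"
proof -
  note m = charts_atD[OF c]
  let ?O = "snd c ` (fst c \<inter> W)"
  have W: "open W" using g by (simp add: metric_on_def)
  have O: "open ?O" "snd c x \<in> ?O" using open_image_Int[OF m(1) W] m g by auto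
  have s: "smooth_on ?O (metric_coords g c)" by (rule metric_coords_smooth[OF g(1) m(1)])
  have sij: "smooth_on ?O (\<lambda>z. metric_coords g c z $ i $ j)" for i j by (intro smooth_on_vec_nth O s)
  have d: "(f has_derivative frechet_derivative f (at (snd c x))) (at (snd c x))"
    if "smooth_on ?O f" for f :: "real^'n \<Rightarrow> 'b::real_normed_vector"
    using smooth_on_differentiable[OF that O(2)] by (simp add: frechet_derivative_works)
  have D: "((\<lambda>z. (z, metric_coords g c z, \<chi> i j k. pd k (\<lambda>z. metric_coords g c z $ i $ j) z,
      \<chi> i j k l. pd l (pd k (\<lambda>z. metric_coords g c z $ i $ j)) z)) has_derivative
    (\<lambda>v. (v, frechet_derivative (metric_coords g c) (at (snd c x)) v,
      \<chi> i j k. frechet_derivative (pd k (\<lambda>z. metric_coords g c z $ i $ j)) (at (snd c x)) v,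
      \<chi> i j k l. frechet_derivative (pd l (pd k (\<lambda>z. metric_coords g c z $ i $ j))) (at (snd c x)) v)))
    (at (snd c x))"
    by (intro has_derivative_Pair has_derivative_vec_lambda has_derivative_ident d s smooth_on_pd sij)
  have "(z, snd (jet2 A g (chart_inv c z)) c) = (z, metric_coords g c z, \<chi> i j k. pd k (\<lambda>z. metric_coords g c z $ i $ j) z,
      \<chi> i j k l. pd l (pd k (\<lambda>z. metric_coords g c z $ i $ j)) z)" if "z \<in> ?O" for z
  proof -
    have z: "z \<in> snd c ` fst c" using that by blast
    then have "c \<in> charts_at A (chart_inv c z)" using m chart_inv_mem by (auto simp: charts_at_def)
    then show ?thesis using chart_inv_right[OF m(1) z] by (simp add: jet2_snd)
  qed
  then show ?thesis
    using has_derivative_transform_within_open[OF D O] by simp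
qed

text \<open>The third derivatives of the metric enter the first derivatives of the tensor field through the
  derivative along the fibre of the 2-jets over the 1-jets.\<close>

lemma pd_tensor_difference:
  assumes T: "second_order_tensor A r p T" and J: "length J = p"
    and g: "metric_on A r W g" "x \<in> W" and g': "metric_on A r W' g'" "x \<in> W'"
    and c: "c \<in> charts_at A x" and eq: "jet2 A g' x = jet2 A g x" and H: "H \<in> S22 A x"
    and d3: "\<And>a b e f. pd k (pd f (pd e (\<lambda>z. metric_coords g' c z $ a $ b))) (snd c x) =
      pd k (pd f (pd e (\<lambda>z. metric_coords g c z $ a $ b))) (snd c x) + H c [a, b, e, f]"
  shows "pd k (\<lambda>z. T (jet2 A g' (chart_inv c z)) c J) (snd c x) =
    pd k (\<lambda>z. T (jet2 A g (chart_inv c z)) c J) (snd c x) + fibre_deriv [H] (\<lambda>i. T i c J) (jet2 A g x)"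
proof -
  note m = charts_atD[OF c]
  define j where "j = jet2 A g x"
  have j: "j \<in> J2M A r" "fst j = x" using J2MI[OF g] by (simp_all add: j_def)
  obtain D and F :: "(real^'n) \<times> 'n jet_coords \<Rightarrow> real" where D: "open D" and F: "smooth_on D F"
    and TF: "\<And>j. j \<in> J2M A r \<Longrightarrow> fst j \<in> fst c \<Longrightarrow> (snd c (fst j), snd j c) \<in> D \<and> T j c J = F (snd c (fst j), snd j c)"
    using second_order_tensorD(3)[OF T m(1) J] by blast
  let ?y = "(snd c x, snd j c)"
  have y: "?y \<in> D" using TF[OF j(1)] j m by simp
  have dF: "(F has_derivative frechet_derivative F (at ?y)) (at ?y)"
    using smooth_on_differentiable[OF F y] by (simp add: frechet_derivative_works)
  interpret F: linear "frechet_derivative F (at ?y)"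
    by (rule linear_frechet_derivative[OF smooth_on_differentiable[OF F y]])
  \<comment> \<open>The chain rule for F along the field of 2-jets. For metrics with equal 2-jets at
    x only the last slot, that of the third derivatives, can differ.\<close>
  have pdT: "pd k (\<lambda>z. T (jet2 A h (chart_inv c z)) c J) (snd c x) = frechet_derivative F (at ?y)
     (axis k 1, pd k (metric_coords h c) (snd c x), \<chi> i j k'. pd k (pd k' (\<lambda>z. metric_coords h c z $ i $ j)) (snd c x),
      \<chi> i j k' l. pd k (pd l (pd k' (\<lambda>z. metric_coords h c z $ i $ j))) (snd c x))"
    if h: "metric_on A r V h" "x \<in> V" and e: "jet2 A h x = j" for V h
  proof -
    let ?O = "snd c ` (fst c \<inter> V)"
    have V: "open V" using h by (simp add: metric_on_def)
    have O: "open ?O" "snd c x \<in> ?O" using open_image_Int[OF m(1) V] m h by auto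
    have yx: "(snd c x, snd (jet2 A h (chart_inv c (snd c x))) c) = ?y"
      using m e by (simp add: chart_inv_left)
    note D1 = has_derivative_compose[OF jet_coords_has_derivative[OF h c], unfolded yx, OF dF]
    have "T (jet2 A h (chart_inv c z)) c J = F (z, snd (jet2 A h (chart_inv c z)) c)" if "z \<in> ?O" for z
    proof -
      obtain w where w: "w \<in> fst c" "w \<in> V" "z = snd c w" using \<open>z \<in> ?O\<close> by blast
      have cz: "chart_inv c z = w" using w m by (simp add: chart_inv_left)
      have "jet2 A h w \<in> J2M A r" by (rule J2MI[OF h(1) w(2)])
      then show ?thesis using TF[of "jet2 A h w"] w cz by simp
    qed
    then have "pd k (\<lambda>z. T (jet2 A h (chart_inv c z)) c J) (snd c x) =
      pd k (\<lambda>z. F (z, snd (jet2 A h (chart_inv c z)) c)) (snd c x)"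
      by (rule pd_cong[OF O])
    then show ?thesis unfolding has_derivative_imp_pd[OF D1] by (simp add: pd_def)
  qed
  \<comment> \<open>Translation along the fibre moves only the last slot, so the fibre derivative is
    the same differential of F applied to a vertical vector.\<close>
  have "fibre_deriv [H] (\<lambda>i. T i c J) j = frechet_derivative F (at ?y) (0, 0, 0, \<chi> a b e f. H c [a, b, e, f])"
  proof -
    obtain b0 p0 s0 where s: "snd j c = (b0, p0, s0)" by (cases "snd j c") auto
    let ?X = "\<chi> a b e f. H c [a, b, e, f]"
    have line: "((\<lambda>t. (snd c x, b0, p0, s0 + t *\<^sub>R ?X)) has_derivative (\<lambda>t. (0, 0, 0, t *\<^sub>R ?X))) (at 0)"
      by (auto intro!: derivative_eq_intros)
    have y0: "(snd c x, b0, p0, s0 + 0 *\<^sub>R ?X) = ?y" by (simp add: s)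
    note D2 = has_derivative_compose[OF line, unfolded y0, OF dF]
    have "T (jet_add j (\<lambda>c I. t * H c I)) c J = F (snd c x, b0, p0, s0 + t *\<^sub>R ?X)" for t
    proof -
      have "(\<lambda>c I. t * H c I) \<in> S22 A (fst j)" using scale_S22[OF H] j by simp
      from TF[OF jet_add_mem[OF j(1) this]]
      have "T (jet_add j (\<lambda>c I. t * H c I)) c J = F (snd c x, snd (jet_add j (\<lambda>c I. t * H c I)) c)"
        using j m by simp
      moreover have "snd (jet_add j (\<lambda>c I. t * H c I)) c = (b0, p0, s0 + t *\<^sub>R ?X)"
        by (simp add: jet_add_def s vec_eq_iff)
      ultimately show ?thesis by simp
    qed
    then have "fibre_deriv [H] (\<lambda>i. T i c J) j = deriv (\<lambda>t. F (snd c x, b0, p0, s0 + t *\<^sub>R ?X)) 0" by simp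
    also have "\<dots> = frechet_derivative F (at ?y) (0, 0, 0, ?X)"
    proof (rule DERIV_imp_deriv)
      have "frechet_derivative F (at ?y) (0, 0, 0, t *\<^sub>R ?X) = t * frechet_derivative F (at ?y) (0, 0, 0, ?X)" for t
        using F.scaleR[of t "(0, 0, 0, ?X)"] by simp
      then show "((\<lambda>t. F (snd c x, b0, p0, s0 + t *\<^sub>R ?X)) has_real_derivative frechet_derivative F (at ?y) (0, 0, 0, ?X)) (at 0)"
        using D2 unfolding has_field_derivative_def by (simp add: mult_commute_abs)
    qed
    finally show ?thesis .
  qed
  moreover have "pd k (metric_coords g' c) (snd c x) = pd k (metric_coords g c) (snd c x)"
    "pd k (pd k' (\<lambda>z. metric_coords g' c z $ a $ b)) (snd c x) = pd k (pd k' (\<lambda>z. metric_coords g c z $ a $ b)) (snd c x)" for a b k'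
  proof -
    have e: "(\<chi> i j k. pd k (\<lambda>z. metric_coords g' c z $ i $ j) (snd c x)) =
       (\<chi> i j k. pd k (\<lambda>z. metric_coords g c z $ i $ j) (snd c x))"
      "(\<chi> i j k l. pd l (pd k (\<lambda>z. metric_coords g' c z $ i $ j)) (snd c x)) =
       (\<chi> i j k l. pd l (pd k (\<lambda>z. metric_coords g c z $ i $ j)) (snd c x))"
      using arg_cong[OF eq, of "\<lambda>i. snd i c"] unfolding jet2_snd[OF c] by (simp_all only: prod.inject)
    show "pd k (pd k' (\<lambda>z. metric_coords g' c z $ a $ b)) (snd c x) = pd k (pd k' (\<lambda>z. metric_coords g c z $ a $ b)) (snd c x)"
      using arg_cong[OF e(2), of "\<lambda>v. v $ a $ b $ k' $ k"] by simp
    have n: "pd k (metric_coords h c) (snd c x) $ i $ j' = pd k (\<lambda>z. metric_coords h c z $ i $ j') (snd c x)"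
      if h: "metric_on A r V h" "x \<in> V" for V h i j'
    proof -
      let ?O = "snd c ` (fst c \<inter> V)"
      have V: "open V" using h by (simp add: metric_on_def)
      have O: "open ?O" "snd c x \<in> ?O" using open_image_Int[OF m(1) V] m h by auto
      note s = metric_coords_smooth[OF h(1) m(1)]
      show ?thesis
        using pd_vec_nth[OF smooth_on_differentiable[OF s O(2)]]
          pd_vec_nth[OF smooth_on_differentiable[OF smooth_on_vec_nth[OF O(1) s] O(2)]] by simp
    qed
    show "pd k (metric_coords g' c) (snd c x) = pd k (metric_coords g c) (snd c x)"
      using arg_cong[OF e(1), of "\<lambda>v. v $ i $ j' $ k" for i j'] by (simp add: vec_eq_iff n[OF g] n[OF g'])
  qed
  ultimately show ?thesis
    unfolding pdT[OF g j_def[symmetric]] pdT[OF g' eq[folded j_def]] j_def[symmetric]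
    by (simp add: d3 flip: F.add) (simp add: plus_vec_def)
qed

text \<open>The symmetries of U say that \<open>U k [a, b, e, f]\<close> can be the third
  derivative, in directions e, f and k, of the component ab of a metric. The perturbation keeps the
  Christoffel symbols and the value of T at x, so in the divergence only the partial derivatives of
  T change.\<close>

lemma divergence_free_fibre:
  assumes T: "second_order_tensor A r p T" and div: "divergence_free A r p T" and p: "p \<ge> 1"
    and j: "j \<in> J2M A r" "fst j = x" and c: "c \<in> charts_at A x" and J: "length J = p - 1"
    and U: "\<And>k a b e f. U k [b, a, e, f] = U k [a, b, e, f]" "\<And>k a b e f. U k [a, b, f, e] = U k [a, b, e, f]"
      "\<And>k a b e f. U f [a, b, e, k] = U k [a, b, e, f]"
  shows "(\<Sum>k\<in>UNIV. fibre_deriv [cotensor_of c 4 x (U k)] (\<lambda>i. T i c (J @ [k])) j) = 0"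
proof -
  note m = charts_atD[OF c]
  obtain W g where g: "j = jet2 A g (fst j)" "metric_on A r W g" "fst j \<in> W" using j(1) by (rule J2ME)
  note g = g[unfolded j(2)]
  \<comment> \<open>The direction k joins the two derivative indices, so that \<open>u a b\<close>
    is symmetric in three indices and fits \<open>cubic\<close>.\<close>
  define u where "u a b e f k = U k [a, b, e, f]" for a b e f k
  have us: "u a b k l n = u a b l k n" "u a b k l n = u a b k n l" for a b k l n
    using U(2,3) by (simp_all add: u_def)
  define q where "q a b = cubic (u a b) (snd c x)" for a b
  have q0: "q a b (snd c x) = 0" "pd e (q a b) (snd c x) = 0" "pd f (pd e (q a b)) (snd c x) = 0"
    "pd k (pd f (pd e (q a b))) z = u a b e f k" for a b e f k z
    unfolding q_def by (rule cubic_0; rule us)+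
  define P where "P z = (\<chi> a b. q a b z)" for z
  have P1: "smooth_on UNIV P" unfolding P_def q_def by (simp add: smooth_on_vec_iff smooth_cubic)
  have P2: "P (snd c x) = 0" by (simp add: P_def vec_eq_iff q0)
  have "u b a = u a b" for a b by (intro ext) (simp add: u_def U(1))
  then have P3: "transpose (P z) = P z" for z by (simp add: P_def q_def vec_eq_iff transpose_def)
  obtain W' g' V where g': "metric_on A r W' g'" "x \<in> W'" "open V" "snd c x \<in> V" "V \<subseteq> snd c ` (fst c \<inter> W)"
    and G': "\<And>z. z \<in> V \<Longrightarrow> metric_coords g' c z = metric_coords g c z + P z"
    by (rule metric_perturbation[OF g(2,3) c P1 P2 P3]) blast
  have sG: "smooth_on V (\<lambda>z. metric_coords g c z $ a $ b)" for a b
    by (intro smooth_on_vec_nth g' smooth_on_subset[OF metric_coords_smooth[OF g(2) m(1)] g'(5)])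
  have sq: "smooth_on V (q a b)" for a b unfolding q_def by (intro smooth_cubic g')
  have 0: "metric_coords g' c z $ a $ b = metric_coords g c z $ a $ b + q a b z" if "z \<in> V" for z a b
    using G'[OF that] by (simp add: P_def)
  have 1: "pd e (\<lambda>z. metric_coords g' c z $ a $ b) z = pd e (\<lambda>z. metric_coords g c z $ a $ b) z + pd e (q a b) z"
    if "z \<in> V" for z a b e
    using pd_cong[OF g'(3) that 0] smooth_pd2_add(1)[OF g'(3) sG sq that] by simp
  have 2: "pd f (pd e (\<lambda>z. metric_coords g' c z $ a $ b)) z =
    pd f (pd e (\<lambda>z. metric_coords g c z $ a $ b)) z + pd f (pd e (q a b)) z" if "z \<in> V" for z a b e f
  proof -
    have "pd f (pd e (\<lambda>z. metric_coords g' c z $ a $ b)) z =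
      pd f (\<lambda>z. pd e (\<lambda>z. metric_coords g c z $ a $ b) z + pd e (q a b) z) z"
      by (rule pd_cong[OF g'(3) that 1])
    then show ?thesis
      using smooth_pd2_add(1)[OF g'(3) smooth_on_pd[OF sG] smooth_on_pd[OF sq] that] by simp
  qed
  have 3: "pd k (pd f (pd e (\<lambda>z. metric_coords g' c z $ a $ b))) (snd c x) =
    pd k (pd f (pd e (\<lambda>z. metric_coords g c z $ a $ b))) (snd c x) + u a b e f k" for a b e f k
  proof -
    have "pd k (pd f (pd e (\<lambda>z. metric_coords g' c z $ a $ b))) (snd c x) =
      pd k (\<lambda>z. pd f (pd e (\<lambda>z. metric_coords g c z $ a $ b)) z + pd f (pd e (q a b)) z) (snd c x)"
      by (rule pd_cong[OF g'(3,4) 2])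
    then show ?thesis
      using smooth_pd2_add(1)[OF g'(3) smooth_on_pd[OF smooth_on_pd[OF sG]] smooth_on_pd[OF smooth_on_pd[OF sq]] g'(4)]
      by (simp add: q0)
  qed
  have eq: "jet2 A g' x = jet2 A g x"
    by (rule jet2_eqI[OF g(2,3) g'(1,2) c])
      (simp add: jet2_snd[OF c] G'[OF g'(4)] P2 1[OF g'(4)] 2[OF g'(4)] q0)
  define H where "H k = cotensor_of c 4 x (U k)" for k
  have Hc: "H k c I = U k I" if "length I = 4" for k I unfolding H_def by (rule cotensor_of_self[OF c that])
  have HS: "H k \<in> S22 A x" for k
    by (rule S22I[OF _ c]) (simp_all add: Hc U, simp add: H_def cotensor_of_mem[OF c])
  have dT: "pd k (\<lambda>z. T (jet2 A g' (chart_inv c z)) c (J @ [k])) (snd c x) =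
    pd k (\<lambda>z. T (jet2 A g (chart_inv c z)) c (J @ [k])) (snd c x) + fibre_deriv [H k] (\<lambda>i. T i c (J @ [k])) j" for k
    unfolding g(1)
    by (rule pd_tensor_difference[OF T _ g(2,3) g'(1,2) c eq HS]) (use J p in \<open>auto simp: 3 Hc u_def\<close>)
  have chr: "christoffel (metric_coords g' c) (snd c x) k i l = christoffel (metric_coords g c) (snd c x) k i l" for k i l
    by (simp add: christoffel_def G'[OF g'(4)] P2 1[OF g'(4)] q0)
  have cx: "chart_inv c (snd c x) = x" using m by (simp add: chart_inv_left)
  have "divergence g' (\<lambda>z. T (jet2 A g' z)) x c J = divergence g (\<lambda>z. T (jet2 A g z)) x c J +
    (\<Sum>k\<in>UNIV. fibre_deriv [H k] (\<lambda>i. T i c (J @ [k])) j)"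
    unfolding divergence_def cov_deriv_def dT chr cx eq by (simp add: sum.distrib)
  moreover have "divergence g' (\<lambda>z. T (jet2 A g' z)) x c J = 0" "divergence g (\<lambda>z. T (jet2 A g z)) x c J = 0"
    using div g g' c J unfolding divergence_free_def by blast+
  ultimately show ?thesis by (simp add: H_def)
qed

text \<open>\<open>deriv\<close> is defined by choice, so to differentiate a vanishing sum of fibre
  derivatives term by term, each term has to be known to be differentiable.\<close>

lemma fibre_deriv_line:
  assumes K: "symmetric_coef m K"
    and f: "\<And>H. H \<in> S22 A (fst j) \<Longrightarrow> f (jet_add j H) = multi_eval K (replicate m (normal_part (\<lambda>I. S I + H c I)))"
    and Hs: "set Hs \<subseteq> S22 A (fst j)" "length Hs \<le> m" and H: "H \<in> S22 A (fst j)"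
  shows "(\<lambda>t. fibre_deriv Hs f (jet_add j (\<lambda>c I. t * H c I))) differentiable (at 0)"
proof -
  let ?Zs = "map (\<lambda>H. normal_part (H c)) Hs" and ?n = "m - length Hs"
  have "fibre_deriv Hs f (jet_add j (\<lambda>c I. t * H c I)) = fact m / fact ?n *
      multi_eval K (?Zs @ replicate ?n (\<lambda>I. normal_part S I + t * normal_part (H c) I))" for t
    using fibre_deriv_multi_eval[OF K f Hs scale_S22[OF H, of t]] normal_part_add_scale[of S t "H c", abs_def]
    by simp
  moreover have "((\<lambda>t. fact m / fact ?n * multi_eval K (?Zs @ replicate ?n (\<lambda>I. normal_part S I + t * normal_part (H c) I)))
     has_real_derivative fact m / fact ?n * (?n * multi_eval K (normal_part (H c) # ?Zs @ replicate (?n - 1) (normal_part S)))) (at 0)"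
    using K Hs by (intro DERIV_cmult multi_eval_derivative) simp
  ultimately show ?thesis by (auto simp: real_differentiable_def)
qed

end

text \<open>U symmetrizes an averaged unit array over the three labels j, e, f, the first attached
  to the direction k. The resulting symmetries make it admissible as the coefficients of a cubic
  perturbation, and contracting it with a tensor singles out the three terms of
  \<open>Div\<close>.\<close>

lemma avg_delta_cyclic:
  fixes a b j e f :: 'n
  defines "U \<equiv> \<lambda>k I. of_bool (k = j) * avg (delta [a, b, e, f]) I + of_bool (k = e) * avg (delta [a, b, f, j]) I +
    of_bool (k = f) * avg (delta [a, b, j, e]) I"
  shows "U k [q, p, r, s] = U k [p, q, r, s]" "U k [p, q, s, r] = U k [p, q, r, s]" "U s [p, q, r, k] = U k [p, q, r, s]"
proof -
  define d where "d u v = (of_bool (u = v) :: real)" for u v :: 'n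
  have D: "avg (delta [a, b, e, f]) [p, q, r, s] = (d a p * d b q + d a q * d b p) * (d e r * d f s + d e s * d f r) / 4" for e f p q r s
  proof -
    have "delta [a, b, e, f] [p, q, r, s] = d a p * d b q * d e r * d f s" for a b e f p q r s
      by (simp add: delta_def d_def)
    then show ?thesis by (simp add: avg_4 algebra_simps)
  qed
  have dk: "of_bool (k = j) = d k j" for k j by (simp add: d_def)
  have U: "U k [p, q, r, s] = (d k j * ((d a p * d b q + d a q * d b p) * (d e r * d f s + d e s * d f r)) +
    d k e * ((d a p * d b q + d a q * d b p) * (d f r * d j s + d f s * d j r)) +
    d k f * ((d a p * d b q + d a q * d b p) * (d j r * d e s + d j s * d e r))) / 4" for k p q r s
    unfolding U_def D dk by (simp add: add_divide_distrib)
  have ds: "d u v = d v u" for u v by (simp add: d_def eq_commute)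
  show "U k [q, p, r, s] = U k [p, q, r, s]" "U k [p, q, s, r] = U k [p, q, r, s]"
    unfolding U by (simp_all add: algebra_simps)
  show "U s [p, q, r, k] = U k [p, q, r, s]"
    unfolding U ds[of s] ds[of k] by (simp add: algebra_simps)
qed

context polynomial_tensor
begin

text \<open>The divergence identity holds at every jet over gx, so it can be differentiated along
  the fibre. The head of the list is the outermost derivative: \<open>H k\<close> comes last because
  it belongs to the identity itself, and the induction differentiates the vanishing sum in the
  directions before it.\<close>

lemma divergence_free_fibre_deriv:
  assumes T: "second_order_tensor A r p T" and div: "divergence_free A r p T" and p: "p \<ge> 1"
    and c: "c \<in> charts_at A x" and J: "length J = p - 1"
    and U: "\<And>k a b e f. U k [b, a, e, f] = U k [a, b, e, f]" "\<And>k a b e f. U k [a, b, f, e] = U k [a, b, e, f]"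
      "\<And>k a b e f. U f [a, b, e, k] = U k [a, b, e, f]"
  defines "H \<equiv> \<lambda>k. cotensor_of c 4 x (U k)"
  shows "over j \<Longrightarrow> set Hs \<subseteq> S22 A x \<Longrightarrow> length Hs < m \<Longrightarrow>
    (\<Sum>k\<in>UNIV. fibre_deriv (Hs @ [H k]) (\<lambda>i. T i c (J @ [k])) j) = 0"
proof (induction Hs arbitrary: j)
  case Nil
  then show ?case
    using divergence_free_fibre[where U=U, OF T div p overD(1,2)[OF Nil(1)] c J U] by (simp add: H_def)
next
  case (Cons H0 Hs)
  note j = overD[OF Cons.prems(1)]
  have HS: "H k \<in> S22 A x" for k
    by (rule S22I[OF _ c]) (simp_all add: H_def cotensor_of_self[OF c] U cotensor_of_mem[OF c])
  have Jk: "length (J @ [k]) = p" for k using J p by simp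
  obtain S where S: "normal_form_at r c j S" using ex_normal_form_at[OF j(1), of c] c j(2) by auto
  let ?\<phi> = "\<lambda>k t. fibre_deriv (Hs @ [H k]) (\<lambda>i. T i c (J @ [k])) (jet_add j (\<lambda>c I. t * H0 c I))"
  have H0: "H0 \<in> S22 A x" using Cons.prems by simp
  have z: "(\<Sum>k\<in>UNIV. ?\<phi> k t) = 0" for t
    using Cons.prems by (intro Cons.IH over_jet_add scale_S22) auto
  have "?\<phi> k differentiable (at 0)" for k
    by (rule fibre_deriv_line[OF coef_sym T_multi_eval[OF c j S _ Jk]]) (use Cons.prems HS H0 j in auto)
  then have D: "(?\<phi> k has_real_derivative deriv (?\<phi> k) 0) (at 0)" for k
    using DERIV_deriv_iff_real_differentiable by blast
  have "((\<lambda>t. \<Sum>k\<in>UNIV. ?\<phi> k t) has_real_derivative (\<Sum>k\<in>UNIV. deriv (?\<phi> k) 0)) (at 0)"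
    by (intro DERIV_sum D)
  then have "(\<Sum>k\<in>UNIV. deriv (?\<phi> k) 0) = 0"
    unfolding z using DERIV_unique[OF _ DERIV_const] by blast
  then show ?case by simp
qed

text \<open>The directions \<open>E c\<close> produce the m - 1 blocks of B, and the test array of
  \<open>avg_delta_cyclic\<close> produces the remaining one. In the sum over k only k = j, e, f
  contribute, each with one term of the cyclic sum.\<close>

lemma K_Div:
  assumes T: "second_order_tensor A r p T" and div: "divergence_free A r p T" and p: "p \<ge> 1" and m: "m \<ge> 1"
  shows "K \<in> Div A p m x"
proof -
  have "K c ((J @ [j]) @ concat ([a, b, e, f] # B)) + K c ((J @ [e]) @ concat ([a, b, f, j] # B)) +
       K c ((J @ [f]) @ concat ([a, b, j, e] # B)) = 0"
    if J: "length J = p - 1" and B: "B \<in> blocks (m - 1)" for c J j a b e f B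
  proof (cases "c \<in> charts_at A x")
    case c: True
    define U where "U k I = of_bool (k = j) * avg (delta [a, b, e, f]) I + of_bool (k = e) * avg (delta [a, b, f, j]) I +
      of_bool (k = f) * avg (delta [a, b, j, e]) I" for k I
    note Us = avg_delta_cyclic[where a=a and b=b and e=e and f=f and j=j, folded U_def]
    define H where "H k = cotensor_of c 4 x (U k)" for k
    have Hc: "H k c I = U k I" if "length I = 4" for k I unfolding H_def by (rule cotensor_of_self[OF c that])
    have HS: "H k \<in> S22 A x" for k
      by (rule S22I[OF _ c]) (simp_all add: Hc Us, simp add: H_def cotensor_of_mem[OF c])
    obtain j0 where j0: "over j0" using ex_over by blast
    have Jk: "length (J @ [k]) = p" for k using J p by simp
    have lB: "length B = m - 1" using B by (simp add: blocks_def)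
    have bB: "b # B \<in> blocks m" if "length b = 4" for b
      using B that m by (auto simp: blocks_def)
    define N where "N = map (\<lambda>b. sym_normal_part (delta b)) B"
    have fd: "fibre_deriv (map (E c) B @ [H k]) (\<lambda>i. T i c (J @ [k])) j0 =
      of_bool (k = j) * K c ((J @ [k]) @ concat ([a, b, e, f] # B)) + of_bool (k = e) * K c ((J @ [k]) @ concat ([a, b, f, j] # B)) +
      of_bool (k = f) * K c ((J @ [k]) @ concat ([a, b, j, e] # B))" for k
    proof -
      have "normal_part (E c b c) = sym_normal_part (delta b)" for b
        unfolding sym_normal_part_def by (rule normal_part_cong) (rule E_self[OF c])
      then have e1: "map (\<lambda>H. normal_part (H c)) (map (E c) B @ [H k]) = N @ [normal_part (H k c)]"
        by (simp add: N_def)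
      have e2: "normal_part (H k c) = (\<lambda>I. of_bool (k = j) * sym_normal_part (delta [a, b, e, f]) I +
         of_bool (k = e) * sym_normal_part (delta [a, b, f, j]) I + of_bool (k = f) * sym_normal_part (delta [a, b, j, e]) I)" (is "_ = ?R")
      proof -
        \<comment> \<open>The leading 0 gives the sum the shape X + t * Y three times over, as
          required by \<open>normal_part_add_scale\<close>.\<close>
        have "normal_part (H k c) = normal_part (\<lambda>I. 0 + of_bool (k = j) * avg (delta [a, b, e, f]) I + of_bool (k = e) * avg (delta [a, b, f, j]) I +
           of_bool (k = f) * avg (delta [a, b, j, e]) I)"
          by (rule normal_part_cong) (simp add: Hc U_def)
        also have "\<dots> = ?R"
          by (rule ext, simp only: normal_part_add_scale) (simp add: sym_normal_part_def normal_part_def)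
        finally show ?thesis .
      qed
      have lN: "length N = m - 1" by (simp add: N_def lB)
      have "fibre_deriv (map (E c) B @ [H k]) (\<lambda>i. T i c (J @ [k])) j0 =
        fact m * multi_eval (\<alpha> c (J @ [k])) (N @ [?R])"
        unfolding e1[symmetric] e2[symmetric]
        by (subst T_deriv[OF j0 c Jk]) (use E_S22[OF c] HS lB m in auto)
      \<comment> \<open>The test direction is the last in the list of derivatives but stands for the
        first block; symmetry moves it to the head.\<close>
      also have "multi_eval (\<alpha> c (J @ [k])) (N @ [?R]) = multi_eval (\<alpha> c (J @ [k])) (?R # N)"
        using coef_sym[of c "J @ [k]"] lN m by (intro multi_eval_permute) auto
      also have "\<dots> = of_bool (k = j) * multi_eval (\<alpha> c (J @ [k])) (sym_normal_part (delta [a, b, e, f]) # N) +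
        of_bool (k = e) * multi_eval (\<alpha> c (J @ [k])) (sym_normal_part (delta [a, b, f, j]) # N) +
        of_bool (k = f) * multi_eval (\<alpha> c (J @ [k])) (sym_normal_part (delta [a, b, j, e]) # N)"
        by (simp add: multi_eval_Cons sum_distrib_left sum.distrib algebra_simps)
      finally have fd': "fibre_deriv (map (E c) B @ [H k]) (\<lambda>i. T i c (J @ [k])) j0 =
        of_bool (k = j) * (fact m * multi_eval (\<alpha> c (J @ [k])) (sym_normal_part (delta [a, b, e, f]) # N)) +
        of_bool (k = e) * (fact m * multi_eval (\<alpha> c (J @ [k])) (sym_normal_part (delta [a, b, f, j]) # N)) +
        of_bool (k = f) * (fact m * multi_eval (\<alpha> c (J @ [k])) (sym_normal_part (delta [a, b, j, e]) # N))"
        by (simp add: algebra_simps)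
      have Kb: "K c ((J @ [k]) @ concat ([a, b, e, f] # B)) = fact m * multi_eval (\<alpha> c (J @ [k])) (sym_normal_part (delta [a, b, e, f]) # N)"
        for a b e f
        by (subst K_eq[OF c Jk bB]) (simp_all add: N_def)
      show ?thesis unfolding Kb by (rule fd')
    qed
    have "(\<Sum>k\<in>UNIV. fibre_deriv (map (E c) B @ [H k]) (\<lambda>i. T i c (J @ [k])) j0) = 0"
      unfolding H_def
      by (rule divergence_free_fibre_deriv[where U=U, OF T div p c J Us j0]) (use E_S22[OF c] lB m in auto)
    then show ?thesis unfolding fd sum.distrib by simp
  qed (simp add: K_outside)
  then show ?thesis unfolding Div_def using K_sym_normal by blast
qed

end

theorem theorem4p2:
  fixes A :: "('x::{t2_space,second_countable_topology}, 'n::finite) chart set"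
    and r p m :: nat
    and x :: 'x
    and gx :: "('x, 'n) chart \<Rightarrow> real^'n^'n"
  assumes "smooth_structure A"
    and "p \<ge> 1"
    and "gx \<in> metrics_at A r x"
    and "m \<ge> 1"
  shows "\<exists>\<Phi>. \<Phi> \<in> div_free_natural_tensors A r p m x gx \<rightarrow> Div_invariant A p m x gx \<and>
    inj_on \<Phi> (div_free_natural_tensors A r p m x gx) \<and>
    (\<forall>T\<in>div_free_natural_tensors A r p m x gx.
       \<forall>j\<in>J2M A r. fst j = x \<and> jet_value j = gx \<longrightarrow> is_mth_derivative A p m T j (\<Phi> T))"
proof -
  interpret smooth_manifold A by standard (rule assms(1))
  let ?D = "div_free_natural_tensors A r p m x gx"
  \<comment> \<open>The coefficients are fixed once for each T, so that \<Phi> becomes a function of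
    T.\<close>
  have "\<forall>T. \<exists>\<alpha>. T \<in> ?D \<longrightarrow> polynomial_tensor A r p m x gx T \<alpha>"
    using ex_polynomial_tensor[OF assms(3)]
    unfolding div_free_natural_tensors_def natural_tensor_def by blast
  from choice[OF this] obtain \<alpha> where \<alpha>: "\<And>T. T \<in> ?D \<Longrightarrow> polynomial_tensor A r p m x gx T (\<alpha> T)" by blast
  define \<Phi> where "\<Phi> T = polynomial_tensor.K A p m x (\<alpha> T)" for T
  have mem: "\<Phi> T \<in> Div_invariant A p m x gx"
    and deriv: "\<And>j. j \<in> J2M A r \<Longrightarrow> fst j = x \<Longrightarrow> jet_value j = gx \<Longrightarrow> is_mth_derivative A p m T j (\<Phi> T)"
    if T: "T \<in> ?D" for T
  proof -
    interpret polynomial_tensor A r p m x gx T "\<alpha> T" by (rule \<alpha>[OF T])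
    have t: "natural_tensor A r p T" "second_order_tensor A r p T" "divergence_free A r p T"
      using T by (auto simp: div_free_natural_tensors_def natural_tensor_def)
    show "\<Phi> T \<in> Div_invariant A p m x gx"
      unfolding \<Phi>_def Div_invariant_def
      using K_Div[OF t(2,3) assms(2,4)] K_orthogonal[OF t(1)] by blast
    show "is_mth_derivative A p m T j (\<Phi> T)" if "j \<in> J2M A r" "fst j = x" "jet_value j = gx" for j
      unfolding \<Phi>_def by (rule K_is_derivative) (use that in \<open>simp add: over_def\<close>)
  qed
  have "inj_on \<Phi> ?D"
  proof (rule inj_onI)
    fix T1 T2 assume T: "T1 \<in> ?D" "T2 \<in> ?D" and eq: "\<Phi> T1 = \<Phi> T2"
    have "natural_tensor A r p T1" "natural_tensor A r p T2"
      using T by (auto simp: div_free_natural_tensors_def)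
    then show "T1 = T2"
      using polynomial_tensor_determined[OF \<alpha>[OF T(1)] \<alpha>[OF T(2)]] eq by (simp add: \<Phi>_def)
  qed
  then show ?thesis using mem deriv by (intro exI[of _ \<Phi>]) blast
qed

end
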